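(* Fix $\beta>0$ and $\kappa_a,\kappa_b\in[0,\infty)$. Let $a(n),b(n)>-1$ satisfy $a(n)=\frac{n\beta}{2}\kappa_a+o((n\beta)^{1/2})$ and $b(n)=\frac{n\beta}{2}\kappa_b+o((n\beta)^{1/2})$ as $n\to\infty$. Let $\mu_n$ be the spectral measure of the MANOVA beta ensemble Jacobi matrix $J_{n,\beta}(a(n),b(n))$. Then, as $n\to\infty$, $\mu_n$ converges weakly, almost surely, to the Kesten-McKey distribution $km_{u_-,u_+}$ with parameters $(u_-,u_+)$ (that is, $\langle\mu_n,f\rangle\to\langle km_{u_-,u_+},f\rangle$ almost surely for every bounded continuous $f:\mathbb{R}\to\mathbb{R}$). Moreover, for any polynomial $p$, $$\frac{\sqrt{n\beta}}{\sqrt2}\big(\langle\mu_n,p\rangle-\langle km_{u_-,u_+},p\rangle\big)\to\mathcal{N}(0,\sigma_p^2)\quad\text{in distribution as } n\to\infty,$$ where $\sigma_p^2$ is a constant (not depending on $n$).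
   Context: Notation: $\langle\mu,f\rangle=\int f\,d\mu$; $\mathcal{N}(0,\sigma^2)$ is the normal distribution with variance $\sigma^2$ (possibly degenerate); $\mathrm{Beta}(x,y)$ is the beta distribution. For $a,b>-1$, let $p_1,\dots,p_{2n-1}$ be independent with $p_k\sim\mathrm{Beta}\big(\frac{2n-k}{4}\beta,\frac{2n-k-2}{4}\beta+a+b+2\big)$ for $k$ even and $p_k\sim\mathrm{Beta}\big(\frac{2n-k-1}{4}\beta+a+1,\frac{2n-k-1}{4}\beta+b+1\big)$ for $k$ odd, and set $p_{-1}=p_0=0$. $J_{n,\beta}(a,b)$ is the $n\times n$ symmetric tridiagonal matrix with diagonal entries $a_k=p_{2k-2}(1-p_{2k-3})+p_{2k-1}(1-p_{2k-2})$, $1\le k\le n$, and off-diagonal entries $b_k=\sqrt{p_{2k-1}(1-p_{2k-2})p_{2k}(1-p_{2k-1})}$, $1\le k\le n-1$, in positions $(k,k+1)$ and $(k+1,k)$. The matrices for different $n$ are defined on a common probability space. The spectral measure of an $n\times n$ Jacobi matrix $J$ (real symmetric tridiagonal with positive off-diagonal entries) is the unique probability measure $\mu$ on $\mathbb{R}$ with $\int x^k d\mu=J^k(1,1)$ for all $k\ge0$. $km_{u_-,u_+}$ is the probability measure with density $\frac{2+\kappa_a+\kappa_b}{2\pi}\frac{\sqrt{(x-u_-)(u_+-x)}}{x(1-x)}$ on $(u_-,u_+)$, where $u_\pm=\Big(\frac{\sqrt{(1+\kappa_a)(1+\kappa_a+\kappa_b)}\pm\sqrt{1+\kappa_b}}{2+\kappa_a+\kappa_b}\Big)^2$.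 *)

theory Defs
  imports "HOL-Probability.Probability" "Jordan_Normal_Form.Matrix"
begin

section \<open>Beta and (possibly degenerate) normal distributions\<close>

definition beta_density :: "real \<Rightarrow> real \<Rightarrow> real \<Rightarrow> real" where
  "beta_density x y t =
     indicator {0<..<1} t * (t powr (x - 1) * (1 - t) powr (y - 1) / Beta x y)"

text \<open>
  The library's \<^const>\<open>normal_density\<close> is parametrised by the standard deviation and vanishes
  identically for standard deviation 0, so the degenerate case is the Dirac measure at 0.
\<close>

definition centered_normal :: "real \<Rightarrow> real measure" where
  "centered_normal v =
     (if v = 0 then return borel 0
      else density lborel (\<lambda>x. ennreal (normal_density 0 (sqrt v) x)))"


section \<open>The MANOVA beta ensemble\<close>

definition manova_alpha1 :: "nat \<Rightarrow> real \<Rightarrow> real \<Rightarrow> real \<Rightarrow> nat \<Rightarrow> real" where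
  "manova_alpha1 n \<beta> a b k =
     (if even k then (2 * real n - real k) / 4 * \<beta>
      else (2 * real n - real k - 1) / 4 * \<beta> + a + 1)"

definition manova_alpha2 :: "nat \<Rightarrow> real \<Rightarrow> real \<Rightarrow> real \<Rightarrow> nat \<Rightarrow> real" where
  "manova_alpha2 n \<beta> a b k =
     (if even k then (2 * real n - real k - 2) / 4 * \<beta> + a + b + 2
      else (2 * real n - real k - 1) / 4 * \<beta> + b + 1)"

definition manova_variables ::
  "'w measure \<Rightarrow> nat \<Rightarrow> real \<Rightarrow> real \<Rightarrow> real \<Rightarrow> (nat \<Rightarrow> 'w \<Rightarrow> real) \<Rightarrow> bool" where
  "manova_variables M n \<beta> a b p \<longleftrightarrow>
     prob_space.indep_vars M (\<lambda>_. borel) p {1..2 * n - 1} \<and>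
     (\<forall>k\<in>{1..2 * n - 1}. distributed M lborel (p k)
        (\<lambda>t. ennreal (beta_density (manova_alpha1 n \<beta> a b k) (manova_alpha2 n \<beta> a b k) t)))"

text \<open>
  The convention \<open>p\<^sub>-\<^sub>1 = p\<^sub>0 = 0\<close>: only the values of \<open>p\<close> at positive indices are used.
\<close>

definition pext :: "(nat \<Rightarrow> real) \<Rightarrow> int \<Rightarrow> real" where
  "pext p k = (if k \<le> 0 then 0 else p (nat k))"

definition manova_diag :: "(nat \<Rightarrow> real) \<Rightarrow> int \<Rightarrow> real" where
  "manova_diag p k =
     pext p (2*k - 2) * (1 - pext p (2*k - 3)) + pext p (2*k - 1) * (1 - pext p (2*k - 2))"

definition manova_offdiag :: "(nat \<Rightarrow> real) \<Rightarrow> int \<Rightarrow> real" where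
  "manova_offdiag p k =
     sqrt (pext p (2*k - 1) * (1 - pext p (2*k - 2)) * pext p (2*k) * (1 - pext p (2*k - 1)))"

text \<open>
  Matrix indices of type \<^typ>\<open>'a mat\<close> start at 0, whereas the entries are numbered from 1.
\<close>

definition manova_jacobi :: "nat \<Rightarrow> (nat \<Rightarrow> real) \<Rightarrow> real mat" where
  "manova_jacobi n p = mat n n (\<lambda>(i, j).
     if i = j then manova_diag p (int i + 1)
     else if j = i + 1 then manova_offdiag p (int i + 1)
     else if i = j + 1 then manova_offdiag p (int j + 1)
     else 0)"


section \<open>Spectral measures\<close>

text \<open>
  Bochner integrals of non-integrable functions are 0, so the existence of all moments has to be
  required explicitly.
\<close>

definition is_spectral_measure :: "real mat \<Rightarrow> real measure \<Rightarrow> bool" where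
  "is_spectral_measure J \<mu> \<longleftrightarrow>
     prob_space \<mu> \<and> sets \<mu> = sets borel \<and>
     (\<forall>k. integrable \<mu> (\<lambda>x. x ^ k) \<and> (\<integral>x. x ^ k \<partial>\<mu>) = (J ^\<^sub>m k) $$ (0, 0))"

definition spectral_measure :: "real mat \<Rightarrow> real measure" where
  "spectral_measure J = (THE \<mu>. is_spectral_measure J \<mu>)"


section \<open>The Kesten-McKay distribution\<close>

definition u_minus :: "real \<Rightarrow> real \<Rightarrow> real" where
  "u_minus ka kb = ((sqrt ((1 + ka) * (1 + ka + kb)) - sqrt (1 + kb)) / (2 + ka + kb))\<^sup>2"

definition u_plus :: "real \<Rightarrow> real \<Rightarrow> real" where
  "u_plus ka kb = ((sqrt ((1 + ka) * (1 + ka + kb)) + sqrt (1 + kb)) / (2 + ka + kb))\<^sup>2"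

definition kesten_mckay :: "real \<Rightarrow> real \<Rightarrow> real measure" where
  "kesten_mckay ka kb = density lborel (\<lambda>x. ennreal (
     indicator {u_minus ka kb <..< u_plus ka kb} x *
     ((2 + ka + kb) / (2 * pi) *
      (sqrt ((x - u_minus ka kb) * (u_plus ka kb - x)) / (x * (1 - x))))))"

end

theory Submission
  imports Defs "HOL-Computational_Algebra.Fundamental_Theorem_Algebra"
begin

text \<open>
  The k-th moment of the spectral measure of an n x n Jacobi matrix is the corner entry of its
  k-th power, which for k < n is a sum over lattice paths and involves only the first k rows. For
  the MANOVA ensemble it is therefore a fixed function \<open>manova_moment\<close> of the first 2k beta
  variables, the same for every n > k, and a polynomial as long as all variables lie in [0,1]. The
  parameters of each fixed beta variable grow linearly in n, so that it concentrates at a constant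
  (\<open>km_odd\<close> or \<open>km_even\<close>, by parity) with Gaussian fluctuations of order \<open>1 / sqrt n\<close>. Both claims
  follow from this:

    \<^item> The fourth central moments of the beta variables are of order \<open>1 / n\<^sup>2\<close>, hence summable;
      whatever the joint law of the different n, each variable converges almost surely, and so
      does every moment of \<open>\<mu> n\<close>. All these measures live on one compact interval, where moments
      determine weak convergence (\<open>tendsto_integral_of_moments\<close>).
    \<^item> Linearising the moments at the limit point leaves a quadratic error, which is negligible
      after multiplication by \<open>sqrt n\<close>. The linear part is a sum of independent, asymptotically
      normal variables; its characteristic function converges to a Gaussian one, and Levy's
      continuity theorem applies.

  Three further points have to be supplied.

  Spectral measures exist and are unique. The functional \<open>q \<mapsto> (q(J))(1,1)\<close> on polynomials is
  nonnegative on squares and degenerate, and such a functional is given by a Gauss quadrature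
  formula (\<open>unique_representing_measure\<close>). The required roots are real and simple by the argument
  that shows the same for the minimal polynomial of a symmetric matrix.

  The limit is the Kesten-McKay distribution. At the limit point the Jacobi matrix has constant
  entries beyond its first row, so its orthogonal polynomials P satisfy the recurrence of the
  Chebyshev polynomials U except at the start. Multiplying the Kesten-McKay density by x (1 - x)
  gives a semicircle density, for which the U are orthogonal, and \<open>x (1 - x) U\<^sub>j\<close> is a combination
  of only \<open>P\<^sub>j\<close>, \<open>P\<^sub>j\<^sub>+\<^sub>1\<close>, \<open>P\<^sub>j\<^sub>+\<^sub>2\<close> (\<open>bernstein_szego\<close>). Together with two explicit integrals
  this determines all Kesten-McKay integrals of the P, and so its moments.

  The central limit theorem for beta variables (\<open>beta_central_limit\<close>). A beta density divided by
  its maximum is dominated by a Gaussian, because its logarithm is strongly concave. Dominated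
  convergence therefore applies to integrals against the rescaled density, and the normalising
  constant cancels in a quotient.
\<close>

section \<open>Positive functionals on polynomials\<close>

lemma prod_linear_dvd:
  fixes q :: "real poly"
  assumes "finite X" and "\<And>x. x \<in> X \<Longrightarrow> poly q x = 0"
  shows "(\<Prod>x\<in>X. [:-x, 1:]) dvd q"
  using assms
proof (induction X arbitrary: q rule: finite_induct)
  case empty
  then show ?case by simp
next
  case (insert x X)
  then obtain s where s: "q = [:-x, 1:] * s"
    by (metis insertI1 poly_eq_0_iff_dvd dvdE)
  have "poly s y = 0" if "y \<in> X" for y
  proof -
    have "poly q y = 0" "y \<noteq> x" using insert that by auto
    then show ?thesis by (simp add: s)
  qed
  then have "(\<Prod>x\<in>X. [:-x, 1:]) dvd s" using insert.IH by blast
  then show ?case using insert.hyps by (simp add: s mult_dvd_mono del: mult_pCons_left)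
qed

lemma poly_eqI_real:
  fixes p q :: "real poly"
  assumes "\<And>x. poly p x = poly q x"
  shows "p = q"
  using assms by (simp add: poly_eq_poly_eq_iff[symmetric] fun_eq_iff)

lemma map_poly_of_real_add:
  "map_poly complex_of_real (p + q) = map_poly of_real p + map_poly of_real q"
  by (rule poly_eqI) (simp add: coeff_map_poly)

lemma map_poly_of_real_mult:
  "map_poly complex_of_real (p * q) = map_poly of_real p * map_poly of_real q"
  by (rule poly_eqI) (simp add: coeff_map_poly coeff_mult)

text \<open>
  The example to keep in mind is \<open>L q = \<langle>q(J) e, e\<rangle>\<close> for a symmetric matrix J and a vector e,
  where \<open>L (q * q)\<close> is the squared norm of \<open>q(J) e\<close>.
\<close>

locale positive_functional =
  fixes L :: "real poly \<Rightarrow> real"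
  assumes add: "L (p + q) = L p + L q"
    and smult: "L (Polynomial.smult c p) = c * L p"
    and square_nonneg: "L (p * p) \<ge> 0"
begin

lemma zero [simp]: "L 0 = 0" using smult[of 0 0] by simp

lemma diff: "L (p - q) = L p - L q"
  using add[of "p - q" q] by simp

lemma sum: "L (\<Sum>i\<in>I. f i) = (\<Sum>i\<in>I. L (f i))"
  by (induction I rule: infinite_finite_induct) (auto simp: add)

text \<open>
  This is the equality case of the Cauchy-Schwarz inequality: the polynomial \<open>t \<mapsto> L ((q + t P)\<^sup>2)\<close>
  is nonnegative and has no quadratic term, so it has no linear term either.
\<close>

lemma null_square_annihilates:
  assumes "L (P * P) = 0"
  shows "L (P * q) = 0"
proof (rule ccontr)
  assume nz: "L (P * q) \<noteq> 0"
  \<comment> \<open>The value of t at which the linear function takes the value -1.\<close>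
  define t where "t = - (L (q * q) + 1) / (2 * L (P * q))"
  have "(q + Polynomial.smult t P) * (q + Polynomial.smult t P) = q * q + Polynomial.smult (2 * t)
      (P * q) + Polynomial.smult (t * t) (P * P)"
    by (rule poly_eqI_real) (simp add: algebra_simps)
  then have "L ((q + Polynomial.smult t P) * (q + Polynomial.smult t P)) = L (q * q) + 2 * t * L (P
      * q)"
    using assms by (simp add: add smult)
  also have "\<dots> = -1" using nz by (simp add: t_def field_simps)
  finally show False using square_nonneg[of "q + Polynomial.smult t P"] by simp
qed

text \<open>
  A nonzero P of least degree with \<open>L (P * P) = 0\<close> behaves like the minimal polynomial of a
  symmetric matrix. If it had a double root x, then \<open>P / (X - x)\<close> would have a square divisible by
  P and would contradict minimality. If it had the nonreal roots \<open>s \<plusminus> i t\<close> and Q is the quotient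
  of P by \<open>(X - s)\<^sup>2 + t\<^sup>2\<close>, then \<open>0 = L (P Q) = L (((X - s) Q)\<^sup>2) + t\<^sup>2 L (Q\<^sup>2)\<close>, and Q would
  contradict minimality. So P is a constant multiple of a product of distinct real linear factors.
\<close>

lemma null_square_real_roots:
  assumes "P \<noteq> 0" and "L (P * P) = 0"
  obtains X where "finite X" and "\<And>T. L ((\<Prod>x\<in>X. [:-x, 1:]) * T) = 0"
proof -
  define null where "null P \<longleftrightarrow> P \<noteq> 0 \<and> L (P * P) = 0" for P
  have "null P" using assms by (simp add: null_def)
  then obtain P where P: "null P" and min: "\<And>Q. null Q \<Longrightarrow> degree P \<le> degree Q"
    using ex_has_least_nat[of null P degree] by blast
  have ann: "L (P * T) = 0" for T
    using P null_square_annihilates by (auto simp: null_def)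
  have Pn0: "P \<noteq> 0" using P by (simp add: null_def)
  define X where "X = {x. poly P x = 0}"
  have finX: "finite X" unfolding X_def using Pn0 by (rule poly_roots_finite)
  define D where "D = (\<Prod>x\<in>X. [:-x, 1:])"
  have "D dvd P" unfolding D_def by (rule prod_linear_dvd[OF finX]) (auto simp: X_def)
  then obtain S where S: "P = D * S" by (elim dvdE)
  have Sn0: "S \<noteq> 0" and Dn0: "D \<noteq> 0" using Pn0 S by auto
  have "degree S = 0"
  proof (rule ccontr)
    assume "degree S \<noteq> 0"
    then have "degree (map_poly complex_of_real S) \<noteq> 0" by (simp add: degree_map_poly)
    then have "\<not> constant (poly (map_poly complex_of_real S))" by (simp add: constant_degree)
    then obtain z where z: "poly (map_poly complex_of_real S) z = 0"
      using fundamental_theorem_of_algebra by blast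
    show False
    proof (cases "Im z = 0")
      case True
      define x where "x = Re z"
      have zx: "z = complex_of_real x" using True by (simp add: x_def complex_eq_iff)
      have "complex_of_real (poly S x) = 0" using z unfolding zx
        by (simp add: poly_altdef degree_map_poly coeff_map_poly)
      then have Sx: "poly S x = 0" by simp
      then have "x \<in> X" by (simp add: X_def S)
      define l where "l = [:-x, 1:]"
      obtain S' where S': "S = l * S'" using Sx unfolding l_def by (metis poly_eq_0_iff_dvd dvdE)
      have "l dvd D" unfolding D_def l_def using \<open>x \<in> X\<close> finX by (intro dvd_prodI) auto
      then obtain D' where D': "D = l * D'" by (elim dvdE)
      define Q where "Q = l * (D' * S')"
      have PQ: "P = l * Q" by (simp add: S S' D' Q_def ac_simps)
      have "Q * Q = P * (D' * S')" by (simp add: PQ) (simp add: Q_def ac_simps)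
      then have "L (Q * Q) = 0" using ann by (simp only:)
      then have "null Q" using PQ Pn0 by (auto simp: null_def)
      moreover have "degree P = Suc (degree Q)"
      proof -
        have "Q \<noteq> 0" "l \<noteq> 0" using PQ Pn0 by auto
        then show ?thesis unfolding PQ by (subst degree_mult_eq) (auto simp: l_def)
      qed
      ultimately show False using min by fastforce
    next
      case False
      define s t where "s = Re z" and "t = Im z"
      define E where "E = [:-s, 1:] * [:-s, 1:] + [:t * t:]"
      have Ez: "poly (map_poly complex_of_real E) z = 0"
        by (simp add: E_def map_poly_pCons complex_eq_iff s_def t_def algebra_simps)
      have degE: "degree E = 2" by (simp add: E_def)
      have En0: "E \<noteq> 0" using degE by auto
      define r where "r = S mod E"
      have "S = E * (S div E) + r" by (simp add: r_def)
      then have "map_poly complex_of_real S =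
          map_poly complex_of_real E * map_poly complex_of_real (S div E) + map_poly complex_of_real r"
        by (metis map_poly_of_real_mult map_poly_of_real_add)
      then have rz: "poly (map_poly complex_of_real r) z = 0" using z Ez by simp
      have "degree r < 2 \<or> r = 0" unfolding r_def using degree_mod_less[OF En0, of S] degE by auto
      then obtain a b where rab: "r = [:a, b:]"
      proof -
        assume *: "\<And>a b. r = [:a, b:] \<Longrightarrow> thesis"
        have "r = [:coeff r 0, coeff r 1:]"
          using \<open>degree r < 2 \<or> r = 0\<close>
          by (auto simp: poly_eq_iff coeff_pCons coeff_eq_0 split: nat.splits)
        then show thesis by (rule *)
      qed
      have "b = 0" "a = 0" using rz False by (auto simp: rab map_poly_pCons complex_eq_iff)
      then have "r = 0" by (simp add: rab)
      then have SE: "S = E * (S div E)" using \<open>S = E * (S div E) + r\<close> by simp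
      define Q where "Q = D * (S div E)"
      have PQ: "P = E * Q" using SE by (simp add: S Q_def ac_simps)
      have "P * Q = ([:-s, 1:] * Q) * ([:-s, 1:] * Q) + Polynomial.smult (t * t) (Q * Q)"
        unfolding PQ E_def by (rule poly_eqI_real) (simp add: algebra_simps)
      then have "L (([:-s, 1:] * Q) * ([:-s, 1:] * Q)) + (t * t) * L (Q * Q) = 0"
        using ann[of Q] by (simp add: add smult)
      moreover have "L (([:-s, 1:] * Q) * ([:-s, 1:] * Q)) \<ge> 0" by (rule square_nonneg)
      moreover have "(t * t) * L (Q * Q) \<ge> 0" using square_nonneg by simp
      ultimately have "(t * t) * L (Q * Q) = 0" by linarith
      then have "null Q" using False PQ Pn0 by (auto simp: null_def t_def)
      moreover have "degree P = 2 + degree Q"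
      proof -
        have "Q \<noteq> 0" using PQ Pn0 by auto
        then show ?thesis unfolding PQ using degE En0 by (subst degree_mult_eq) auto
      qed
      ultimately show False using min by fastforce
    qed
  qed
  then obtain c where c: "S = [:c:]" by (auto elim: degree_eq_zeroE)
  have "c \<noteq> 0" using Sn0 c by simp
  have "L (D * T) = 0" for T
  proof -
    have "D * T = P * Polynomial.smult (1 / c) T" using \<open>c \<noteq> 0\<close> by (simp add: S c)
    then show ?thesis using ann by (simp add: smult)
  qed
  then show ?thesis using that finX by (auto simp: D_def)
qed

text \<open>
  This is Gauss quadrature. Multiples of the product of the \<open>X - x\<close> are annihilated, so \<open>L q\<close>
  depends only on the values of q on the finite set X of roots. In terms of the Lagrange
  polynomials \<open>l x\<close> it is the sum of the \<open>L (l x) q(x)\<close>, and \<open>L (l x) = L ((l x)\<^sup>2) \<ge> 0\<close>.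
  Conversely, a measure with these moments integrates the square of the product to 0; hence it is
  carried by X, and its mass at x must be \<open>L (l x)\<close>.
\<close>

lemma unique_representing_measure:
  assumes one: "L 1 = 1" and P: "P \<noteq> 0" "L (P * P) = 0"
  shows "\<exists>!\<mu>. prob_space \<mu> \<and> sets \<mu> = sets borel \<and>
           (\<forall>k. integrable \<mu> (\<lambda>x. x ^ k) \<and> (\<integral>x. x ^ k \<partial>\<mu>) = L (monom 1 k))"
    (is "\<exists>!\<mu>. ?R \<mu>")
proof -
  obtain X where X: "finite X" and ann: "\<And>T. L ((\<Prod>x\<in>X. [:-x, 1:]) * T) = 0"
    using null_square_real_roots[OF P] by blast
  define D where "D = (\<Prod>x\<in>X. [:-x, 1::real:])"
  have van: "L q = 0" if "\<And>x. x \<in> X \<Longrightarrow> poly q x = 0" for q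
    using prod_linear_dvd[OF X that] ann by (auto elim!: dvdE)
  define l where "l x = Polynomial.smult (1 / (\<Prod>y\<in>X - {x}. x - y)) (\<Prod>y\<in>X - {x}. [:-y, 1:])" for x
  have l: "poly (l x) y = (if y = x then 1 else 0)" if "x \<in> X" "y \<in> X" for x y
  proof -
    have "(\<Prod>y\<in>X - {x}. x - y) \<noteq> 0" using X by (simp add: prod_zero_iff)
    then show ?thesis using that X by (auto simp: l_def poly_prod prod_zero_iff)
  qed
  have wnn: "L (l x) \<ge> 0" if "x \<in> X" for x
  proof -
    have "L (l x * l x - l x) = 0" by (rule van) (use that in \<open>auto simp: l\<close>)
    then show ?thesis using square_nonneg[of "l x"] by (simp add: diff)
  qed
  have quad: "L q = (\<Sum>x\<in>X. L (l x) * poly q x)" for q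
  proof -
    have "L (q - (\<Sum>x\<in>X. Polynomial.smult (poly q x) (l x))) = 0"
    proof (rule van)
      fix y assume "y \<in> X"
      then have "(\<Sum>x\<in>X. poly q x * poly (l x) y) = (\<Sum>x\<in>X. if y = x then poly q x else 0)"
        by (intro sum.cong) (auto simp: l)
      also have "\<dots> = poly q y" using X \<open>y \<in> X\<close> by simp
      finally show "poly (q - (\<Sum>x\<in>X. Polynomial.smult (poly q x) (l x))) y = 0"
        by (simp add: poly_sum)
    qed
    then show ?thesis by (simp add: diff sum smult mult.commute)
  qed
  define \<nu> where "\<nu> = distr (point_measure X (\<lambda>x. ennreal (L (l x)))) borel (\<lambda>x. x)"
  have meas: "(\<lambda>x. x) \<in> point_measure X (\<lambda>x. ennreal (L (l x))) \<rightarrow>\<^sub>M borel"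
    by (auto simp: measurable_def space_point_measure sets_point_measure)
  have int: "integrable \<nu> (\<lambda>x. x ^ k)" for k
    unfolding \<nu>_def using X by (subst integrable_distr_eq[OF meas])
      (auto intro!: integrable_point_measure_finite)
  have mom: "(\<integral>x. x ^ k \<partial>\<nu>) = L (monom 1 k)" for k
  proof -
    have "(\<integral>x. x ^ k \<partial>\<nu>) = (\<Sum>x\<in>X. L (l x) * x ^ k)"
      unfolding \<nu>_def using X wnn
      by (subst integral_distr[OF meas]) (auto simp: lebesgue_integral_point_measure_finite)
    then show ?thesis by (simp add: quad[of "monom 1 k"] poly_monom)
  qed
  have prob: "prob_space \<nu>"
    unfolding \<nu>_def
  proof (intro prob_space.prob_space_distr[OF _ meas] prob_spaceI)
    show "emeasure (point_measure X (\<lambda>x. ennreal (L (l x))))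
        (space (point_measure X (\<lambda>x. ennreal (L (l x))))) = 1"
      using quad[of 1] one X wnn
      by (simp add: space_point_measure emeasure_point_measure_finite sum_ennreal)
  qed
  have ex: "?R \<nu>" using int mom prob by (auto simp: \<nu>_def)
  have formula: "emeasure \<mu> A = ennreal (L (\<Sum>x\<in>X \<inter> A. l x))"
    if mu: "?R \<mu>" and A: "A \<in> sets borel" for \<mu> A
  proof -
    interpret prob_space \<mu> using mu by simp
    have [measurable_cong]: "sets \<mu> = sets borel" using mu by simp
    have poly_eq: "poly q = (\<lambda>x. \<Sum>k\<le>degree q. coeff q k * x ^ k)" for q :: "real poly"
      by (simp add: poly_altdef fun_eq_iff)
    have ip: "integrable \<mu> (poly q)" for q
      using mu unfolding poly_eq by (intro Bochner_Integration.integrable_sum) auto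
    have mp: "(\<integral>x. poly q x \<partial>\<mu>) = L q" for q
    proof -
      have "(\<integral>x. poly q x \<partial>\<mu>) = (\<Sum>k\<le>degree q. coeff q k * (\<integral>x. x ^ k \<partial>\<mu>))"
        using mu by (simp add: poly_eq)
      also have "\<dots> = L (\<Sum>k\<le>degree q. Polynomial.smult (coeff q k) (monom 1 k))"
        using mu by (simp add: sum smult)
      also have "(\<Sum>k\<le>degree q. Polynomial.smult (coeff q k) (monom 1 k)) = q"
        by (simp add: smult_monom poly_as_sum_of_monoms)
      finally show ?thesis .
    qed
    have "(\<integral>x. poly (D * D) x \<partial>\<mu>) = 0" unfolding mp using ann by (simp only: D_def)
    moreover have "AE x in \<mu>. 0 \<le> poly (D * D) x" by simp
    ultimately have "AE x in \<mu>. poly (D * D) x = 0"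
      using integral_nonneg_eq_0_iff_AE[OF ip] by blast
    then have AEX: "AE x in \<mu>. x \<in> X"
      by eventually_elim (use X in \<open>auto simp: D_def poly_prod prod_zero_iff\<close>)
    have "(\<integral>x. indicator A x \<partial>\<mu>) = (\<integral>x. poly (\<Sum>x\<in>X \<inter> A. l x) x \<partial>\<mu>)"
    proof (rule integral_cong_AE)
      show "AE x in \<mu>. indicator A x = poly (\<Sum>x\<in>X \<inter> A. l x) x"
        using AEX
      proof eventually_elim
        case (elim x)
        have "poly (\<Sum>x\<in>X \<inter> A. l x) x = (\<Sum>y\<in>X \<inter> A. if x = y then 1 else 0)"
          unfolding poly_sum by (intro sum.cong) (auto simp: l elim)
        then show ?case using X elim by (simp add: indicator_def)
      qed
    qed (use A ip in auto)
    then show ?thesis using A mu by (simp add: mp emeasure_eq_measure)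
  qed
  show ?thesis
  proof (rule ex1I[of _ \<nu>])
    show "?R \<nu>" by (rule ex)
    fix \<mu> assume mu: "?R \<mu>"
    then show "\<mu> = \<nu>"
      using ex formula[OF mu] formula[OF ex] by (intro measure_eqI) auto
  qed
qed

end

section \<open>Jacobi matrices and their spectral measures\<close>

text \<open>
  The first row of the k-th power of the infinite Jacobi matrix with diagonal A and off-diagonal
  entries b, where \<open>B i = (b i)\<^sup>2\<close>, with column i divided by the product of the first i
  off-diagonal entries. This normalisation makes the entries polynomials in A and B, without
  square roots. A zero in B cuts off a finite matrix.
\<close>

fun jacobi_row :: "(nat \<Rightarrow> real) \<Rightarrow> (nat \<Rightarrow> real) \<Rightarrow> nat \<Rightarrow> nat \<Rightarrow> real" where
  "jacobi_row A B 0 i = (if i = 0 then 1 else 0)"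
| "jacobi_row A B (Suc k) i =
     A i * jacobi_row A B k i + (if i = 0 then 0 else jacobi_row A B k (i - 1))
       + B i * jacobi_row A B k (Suc i)"

text \<open>
  The monic orthogonal polynomials of the Jacobi matrix.
\<close>

fun jacobi_poly :: "(nat \<Rightarrow> real) \<Rightarrow> (nat \<Rightarrow> real) \<Rightarrow> nat \<Rightarrow> real poly" where
  "jacobi_poly A B 0 = 1"
| "jacobi_poly A B (Suc 0) = [:- A 0, 1:]"
| "jacobi_poly A B (Suc (Suc i)) =
     [:- A (Suc i), 1:] * jacobi_poly A B (Suc i) - Polynomial.smult (B i) (jacobi_poly A B i)"

text \<open>
  The first row of \<open>q(J)\<close>, normalised as in \<open>jacobi_row\<close>.
\<close>

definition poly_row :: "(nat \<Rightarrow> real) \<Rightarrow> (nat \<Rightarrow> real) \<Rightarrow> real poly \<Rightarrow> nat \<Rightarrow> real" where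
  "poly_row A B q i = (\<Sum>k\<le>degree q. coeff q k * jacobi_row A B k i)"

lemma jacobi_row_eq_0: "k < i \<Longrightarrow> jacobi_row A B k i = 0"
  by (induction k arbitrary: i) auto

lemma jacobi_row_cong:
  assumes "\<And>j. j \<le> i + k \<Longrightarrow> A j = A' j" and "\<And>j. j < i + k \<Longrightarrow> B j = B' j"
  shows "jacobi_row A B k i = jacobi_row A' B' k i"
  using assms by (induction k arbitrary: i) auto

text \<open>
  Each step of the recursion has three terms with coefficients of size 2, 1 and 1.
\<close>

lemma jacobi_row_bound:
  assumes "\<And>i. \<bar>A i\<bar> \<le> 2" and "\<And>i. \<bar>B i\<bar> \<le> 1"
  shows "\<bar>jacobi_row A B k i\<bar> \<le> 4 ^ k"
proof (induction k arbitrary: i)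
  case (Suc k)
  have 1: "\<bar>A i * jacobi_row A B k i\<bar> \<le> 2 * 4 ^ k"
    unfolding abs_mult using assms(1) Suc by (intro mult_mono) auto
  have 2: "\<bar>B i * jacobi_row A B k (Suc i)\<bar> \<le> 1 * 4 ^ k"
    unfolding abs_mult using assms(2) Suc by (intro mult_mono) auto
  have 3: "\<bar>if i = 0 then 0 else jacobi_row A B k (i - 1)\<bar> \<le> 4 ^ k"
    using Suc[of "i - 1"] by auto
  show ?case using 1 2 3 by simp
qed simp

lemma poly_row_altdef:
  assumes "degree q \<le> n"
  shows "poly_row A B q i = (\<Sum>k\<le>n. coeff q k * jacobi_row A B k i)"
  unfolding poly_row_def using assms
  by (intro sum.mono_neutral_left) (auto simp: coeff_eq_0)

lemma poly_row_0 [simp]: "poly_row A B 0 i = 0" by (simp add: poly_row_def)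

lemma poly_row_monom: "poly_row A B (monom 1 k) i = jacobi_row A B k i"
proof -
  have "poly_row A B (monom 1 k) i = (\<Sum>j\<le>k. coeff (monom 1 k) j * jacobi_row A B j i)"
    by (rule poly_row_altdef) (simp add: degree_monom_le)
  also have "\<dots> = (\<Sum>j\<le>k. if j = k then jacobi_row A B j i else 0)"
    by (intro sum.cong) auto
  finally show ?thesis by simp
qed

lemma poly_row_1: "poly_row A B 1 i = (if i = 0 then 1 else 0)"
  by (simp add: poly_row_def)

lemma poly_row_add: "poly_row A B (p + q) i = poly_row A B p i + poly_row A B q i"
proof -
  let ?n = "max (degree p) (degree q)"
  have "degree (p + q) \<le> ?n" by (rule degree_add_le_max)
  then show ?thesis
    by (simp add: poly_row_altdef[of _ ?n] sum.distrib algebra_simps)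
qed

lemma poly_row_smult: "poly_row A B (Polynomial.smult c p) i = c * poly_row A B p i"
  by (simp add: poly_row_altdef[OF degree_smult_le] poly_row_def sum_distrib_left mult.assoc)

lemma poly_row_pCons:
  "poly_row A B (pCons c q) i = (if i = 0 then c else 0) + (A i * poly_row A B q i
     + (if i = 0 then 0 else poly_row A B q (i - 1)) + B i * poly_row A B q (Suc i))"
proof -
  have "poly_row A B (pCons c q) i =
      (\<Sum>k\<le>Suc (degree q). coeff (pCons c q) k * jacobi_row A B k i)"
    by (rule poly_row_altdef) (rule degree_pCons_le)
  also have "\<dots> = c * jacobi_row A B 0 i
      + (\<Sum>k\<le>degree q. coeff q k * jacobi_row A B (Suc k) i)"
    by (simp add: sum.atMost_Suc_shift del: jacobi_row.simps sum.atMost_Suc)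
  finally show ?thesis
    by (cases "i = 0")
      (simp_all add: poly_row_def algebra_simps sum.distrib sum_distrib_left)
qed

text \<open>
  The recurrence of the orthogonal polynomials is the one that solves the rows of J for the unit
  vectors.
\<close>

lemma poly_row_jacobi_poly: "poly_row A B (jacobi_poly A B j) i = (if i = j then 1 else 0)"
proof (induction j arbitrary: i rule: induct_nat_012)
  case 0
  then show ?case by (simp add: poly_row_1)
next
  case 1
  have *: "jacobi_poly A B (Suc 0) = pCons (- A 0) 1" by (simp add: one_pCons)
  show ?case unfolding * poly_row_pCons poly_row_1 by auto
next
  case (ge2 j)
  have *: "jacobi_poly A B (Suc (Suc j)) = Polynomial.smult (- A (Suc j)) (jacobi_poly A B (Suc j))
      + pCons 0 (jacobi_poly A B (Suc j)) + Polynomial.smult (- B j) (jacobi_poly A B j)"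
    by simp
  show ?case unfolding * poly_row_add poly_row_smult poly_row_pCons ge2 by auto
qed

text \<open>
  The rows are the coordinates of the monomials in the basis of orthogonal polynomials. A
  functional with value 1 at 1 that vanishes on all later orthogonal polynomials therefore has the
  moments \<open>jacobi_row A B k 0\<close>.
\<close>

lemma jacobi_poly_expansion:
  "x ^ k = (\<Sum>i\<le>k. jacobi_row A B k i * poly (jacobi_poly A B i) x)"
proof (induction k)
  case (Suc k)
  define P where "P i = poly (jacobi_poly A B i) x" for i
  define r where "r i = jacobi_row A B k i" for i
  have r0: "r i = 0" if "k < i" for i using that by (simp add: r_def jacobi_row_eq_0)
  have rec: "x * P i = P (Suc i) + A i * P i + (if i = 0 then 0 else B (i - 1) * P (i - 1))" for i
    by (cases i) (auto simp: P_def algebra_simps)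
  have "x ^ Suc k = (\<Sum>i\<le>k. r i * (x * P i))"
    by (simp add: Suc P_def r_def sum_distrib_left mult_ac)
  also have "\<dots> = (\<Sum>i\<le>k. r i * P (Suc i)) + (\<Sum>i\<le>k. r i * (A i * P i))
      + (\<Sum>i\<le>k. r i * (if i = 0 then 0 else B (i - 1) * P (i - 1)))"
    by (simp add: rec algebra_simps sum.distrib)
  also have "(\<Sum>i\<le>k. r i * P (Suc i)) = (\<Sum>i\<le>Suc k. (if i = 0 then 0 else r (i - 1)) * P i)"
    by (simp add: sum.atMost_Suc_shift del: sum.atMost_Suc)
  also have "(\<Sum>i\<le>k. r i * (A i * P i)) = (\<Sum>i\<le>Suc k. A i * r i * P i)"
    by (simp add: r0 mult_ac)
  also have "(\<Sum>i\<le>k. r i * (if i = 0 then 0 else B (i - 1) * P (i - 1)))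
      = (\<Sum>i\<le>Suc (Suc k). r i * (if i = 0 then 0 else B (i - 1) * P (i - 1)))"
    by (simp add: r0)
  also have "\<dots> = (\<Sum>i\<le>Suc k. B i * r (Suc i) * P i)"
    by (subst sum.atMost_Suc_shift) (simp add: mult_ac del: sum.atMost_Suc)
  also have "(\<Sum>i\<le>Suc k. (if i = 0 then 0 else r (i - 1)) * P i) + (\<Sum>i\<le>Suc k. A i * r i * P i)
      + (\<Sum>i\<le>Suc k. B i * r (Suc i) * P i) = (\<Sum>i\<le>Suc k. jacobi_row A B (Suc k) i * P i)"
    unfolding r_def by (simp add: algebra_simps flip: sum.distrib del: sum.atMost_Suc)
  finally show ?case by (simp add: P_def)
qed simp

text \<open>
  J is symmetric for the inner product with the weights \<open>\<Prod>j<i. B j\<close>. All weights from index n on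
  are 0, so the inner product sees only the first n coordinates.
\<close>

lemma poly_row_mult:
  assumes n: "n \<ge> 1" and B0: "B (n - 1) = 0"
  shows "poly_row A B (p * q) 0 =
           (\<Sum>i<n. (\<Prod>j<i. B j) * poly_row A B p i * poly_row A B q i)"
proof (induction p arbitrary: q)
  case 0
  then show ?case by simp
next
  case (pCons c p)
  obtain m where m: "n = Suc m" using n by (cases n) auto
  define w where "w i = (\<Prod>j<i. B j)" for i
  have wS: "w (Suc i) = w i * B i" "w 0 = 1" for i by (simp_all add: w_def)
  define u v where "u = poly_row A B p" and "v = poly_row A B q"
  have left: "(\<Sum>i<n. w i * (if i = 0 then 0 else f (i - 1)) * g i) = (\<Sum>i<m. w (Suc i) * f i * g (Suc
      i))" for f g
    unfolding m by (simp add: sum.lessThan_Suc_shift del: sum.lessThan_Suc)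
  have right: "(\<Sum>i<n. w i * (B i * f (Suc i)) * g i) = (\<Sum>i<m. w (Suc i) * f (Suc i) * g i)" for f g
    using B0 unfolding m by (simp add: wS mult_ac)
  have sym: "(\<Sum>i<n. w i * (if i = 0 then 0 else u (i - 1)) * v i) + (\<Sum>i<n. w i * (B i * u (Suc i)) *
      v i)
      = (\<Sum>i<n. w i * (if i = 0 then 0 else v (i - 1)) * u i) + (\<Sum>i<n. w i * (B i * v (Suc i)) * u i)"
    unfolding left right by (simp add: mult_ac)
  have delta: "(\<Sum>i<n. w i * (if i = 0 then c else 0) * v i) = c * v 0"
    unfolding m by (simp add: sum.lessThan_Suc_shift wS del: sum.lessThan_Suc)
  have "(\<Sum>i<n. w i * poly_row A B (pCons c p) i * v i) =
      (\<Sum>i<n. w i * (if i = 0 then c else 0) * v i) + (\<Sum>i<n. w i * (A i * u i) * v i)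
      + ((\<Sum>i<n. w i * (if i = 0 then 0 else u (i - 1)) * v i) + (\<Sum>i<n. w i * (B i * u (Suc i)) * v i))"
    unfolding poly_row_pCons u_def v_def by (simp add: algebra_simps flip: sum.distrib)
  also have "\<dots> = c * v 0 + (\<Sum>i<n. w i * u i * poly_row A B (pCons 0 q) i)"
    unfolding sym delta poly_row_pCons unfolding u_def v_def
        by (simp add: algebra_simps flip: sum.distrib)
  also have "(\<Sum>i<n. w i * u i * poly_row A B (pCons 0 q) i) = poly_row A B (p * pCons 0 q) 0"
    unfolding u_def w_def by (rule pCons.IH[symmetric])
  also have "c * v 0 + poly_row A B (p * pCons 0 q) 0 = poly_row A B (pCons c p * q) 0"
    by (simp add: v_def poly_row_add poly_row_smult)
  finally show ?case by (simp add: w_def v_def)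
qed

text \<open>
  The weights in \<open>poly_row_mult\<close> are nonnegative, which gives positivity, and the orthogonal
  polynomial of degree n has its only nonzero coordinate at a place of weight 0, which gives
  degeneracy.
\<close>

lemma jacobi_measure_unique:
  assumes n: "n \<ge> 1" and B0: "B (n - 1) = 0" and B: "\<And>i. B i \<ge> 0"
  shows "\<exists>!\<mu>. prob_space \<mu> \<and> sets \<mu> = sets borel \<and>
           (\<forall>k. integrable \<mu> (\<lambda>x. x ^ k) \<and> (\<integral>x. x ^ k \<partial>\<mu>) = jacobi_row A B k 0)"
proof -
  interpret positive_functional "\<lambda>q. poly_row A B q 0"
  proof
    fix p show "poly_row A B (p * p) 0 \<ge> 0"
      unfolding poly_row_mult[where n = n and B = B, OF n B0] using B
      by (intro sum_nonneg) (simp add: mult.assoc prod_nonneg)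
  qed (auto simp: poly_row_add poly_row_smult)
  have "poly_row A B (jacobi_poly A B n) n = 1" by (simp add: poly_row_jacobi_poly)
  then have "jacobi_poly A B n \<noteq> 0" by auto
  moreover have "poly_row A B (jacobi_poly A B n * jacobi_poly A B n) 0 = 0"
    unfolding poly_row_mult[where n = n and B = B, OF n B0] by (simp add: poly_row_jacobi_poly)
  ultimately show ?thesis
    using unique_representing_measure[of "jacobi_poly A B n"]
    by (simp add: poly_row_1 poly_row_monom)
qed

definition jacobi_mat :: "nat \<Rightarrow> (nat \<Rightarrow> real) \<Rightarrow> (nat \<Rightarrow> real) \<Rightarrow> real mat" where
  "jacobi_mat n a b = mat n n (\<lambda>(i, j).
     if i = j then a i else if j = i + 1 then b i else if i = j + 1 then b j else 0)"

lemma jacobi_mat_pow_row: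
  assumes "i < n"
  shows "(jacobi_mat n a b ^\<^sub>m k) $$ (0, i) =
    (\<Prod>j<i. b j) * jacobi_row a (\<lambda>i. if Suc i < n then (b i)\<^sup>2 else 0) k i"
  using assms
proof (induction k arbitrary: i)
  case 0
  then show ?case by (auto simp: jacobi_mat_def)
next
  case (Suc k)
  define J where "J = jacobi_mat n a b"
  define v where "v j = (J ^\<^sub>m k) $$ (0, j)" for j
  define B where "B i = (if Suc i < n then (b i)\<^sup>2 else 0)" for i
  have J: "J \<in> carrier_mat n n" by (simp add: J_def jacobi_mat_def)
  then have Jk: "J ^\<^sub>m k \<in> carrier_mat n n" by simp
  have IH: "v j = (\<Prod>l<j. b l) * jacobi_row a B k j" if "j < n" for j
    using Suc.IH[OF that] by (simp add: v_def J_def B_def[abs_def])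
  have "(J ^\<^sub>m Suc k) $$ (0, i) = (\<Sum>j\<in>{0..<n}. v j * J $$ (j, i))"
    using J Jk Suc.prems by (simp add: times_mat_def scalar_prod_def v_def)
  also have "\<dots> = (\<Sum>j\<in>{0..<n}. (if j = i then v i * a i else 0)
      + (if j = i - 1 then if i = 0 then 0 else v (i - 1) * b (i - 1) else 0)
      + (if j = Suc i then v (Suc i) * b i else 0))"
    using Suc.prems by (intro sum.cong) (auto simp: J_def jacobi_mat_def)
  also have "\<dots> = v i * a i + (if i = 0 then 0 else v (i - 1) * b (i - 1))
      + (if Suc i < n then v (Suc i) * b i else 0)"
    using Suc.prems by (auto simp: sum.distrib)
  also have "\<dots> = (\<Prod>l<i. b l) * jacobi_row a B (Suc k) i"
  proof (cases i)
    case 0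
    then show ?thesis using Suc.prems
      by (simp add: IH B_def power2_eq_square algebra_simps)
  next
    case (Suc i')
    then show ?thesis using Suc.prems
      by (simp add: IH B_def power2_eq_square algebra_simps)
  qed
  finally show ?case by (simp add: J_def B_def[abs_def])
qed

lemma is_spectral_measure_jacobi_mat:
  fixes a b n
  assumes n: "n \<ge> 1"
  defines "B \<equiv> \<lambda>i. if Suc i < n then (b i)\<^sup>2 else 0"
  shows "is_spectral_measure (jacobi_mat n a b) \<mu> \<longleftrightarrow>
     prob_space \<mu> \<and> sets \<mu> = sets borel \<and>
     (\<forall>k. integrable \<mu> (\<lambda>x. x ^ k) \<and> (\<integral>x. x ^ k \<partial>\<mu>) = jacobi_row a B k 0)"
  using n by (simp add: is_spectral_measure_def jacobi_mat_pow_row B_def)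

lemma spectral_measure_jacobi_mat:
  fixes a b n
  assumes n: "n \<ge> 1"
  defines "B \<equiv> \<lambda>i. if Suc i < n then (b i)\<^sup>2 else 0"
    and "\<mu> \<equiv> spectral_measure (jacobi_mat n a b)"
  shows "prob_space \<mu>" "sets \<mu> = sets borel" "integrable \<mu> (\<lambda>x. x ^ k)"
    "(\<integral>x. x ^ k \<partial>\<mu>) = jacobi_row a B k 0"
proof -
  have "B (n - 1) = 0" "\<And>i. B i \<ge> 0" using n by (auto simp: B_def)
  then have "\<exists>!\<mu>. is_spectral_measure (jacobi_mat n a b) \<mu>"
    using jacobi_measure_unique[OF n, of B a]
    unfolding is_spectral_measure_jacobi_mat[OF n] B_def by blast
  then have "is_spectral_measure (jacobi_mat n a b) \<mu>"
    unfolding \<mu>_def spectral_measure_def by (rule theI')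
  then show "prob_space \<mu>" "sets \<mu> = sets borel" "integrable \<mu> (\<lambda>x. x ^ k)"
    "(\<integral>x. x ^ k \<partial>\<mu>) = jacobi_row a B k 0"
    unfolding is_spectral_measure_jacobi_mat[OF n] B_def by auto
qed

lemma manova_jacobi_eq:
  "manova_jacobi n p = jacobi_mat n (\<lambda>i. manova_diag p (int i + 1)) (\<lambda>i. manova_offdiag p (int i + 1))"
  by (simp add: manova_jacobi_def jacobi_mat_def)

section \<open>From moments to weak convergence\<close>

text \<open>
  Mass at distance at least R > C from 0 would make the even moments grow at least like \<open>R ^ (2 *
  k)\<close>.
\<close>

lemma AE_abs_le_of_moment_bound:
  fixes \<mu> :: "real measure"
  assumes "prob_space \<mu>" and [measurable_cong]: "sets \<mu> = sets borel"
    and int: "\<And>k. integrable \<mu> (\<lambda>x. x ^ k)"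
    and bound: "\<And>k. \<bar>\<integral>x. x ^ k \<partial>\<mu>\<bar> \<le> C ^ k" and C: "C > 0"
  shows "AE x in \<mu>. \<bar>x\<bar> \<le> C"
proof -
  interpret prob_space \<mu> by fact
  have "AE x in \<mu>. \<bar>x\<bar> < C + 1 / real (Suc m)" for m
  proof -
    define R where "R = C + 1 / real (Suc m)"
    have R: "R > C" "R > 0" using C by (auto simp: R_def add_pos_pos)
    define p where "p = prob {x \<in> space \<mu>. R \<le> \<bar>x\<bar>}"
    have "p \<le> ((C / R)\<^sup>2) ^ k" for k
    proof -
      have "p = (\<integral>x. indicator {x \<in> space \<mu>. R \<le> \<bar>x\<bar>} x \<partial>\<mu>)"
        by (simp add: p_def Int_absorb2)
      also have "\<dots> \<le> (\<integral>x. x ^ (2 * k) / R ^ (2 * k) \<partial>\<mu>)"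
      proof (rule integral_mono_AE)
        show "AE x in \<mu>. indicator {x \<in> space \<mu>. R \<le> \<bar>x\<bar>} x \<le> x ^ (2 * k) / R ^ (2 * k)"
        proof (rule AE_I2)
          fix x assume "x \<in> space \<mu>"
          have "R ^ (2 * k) \<le> x ^ (2 * k)" if "R \<le> \<bar>x\<bar>"
            using power_mono[OF that, of "2 * k"] R by (simp add: power_even_abs)
          then show "indicator {x \<in> space \<mu>. R \<le> \<bar>x\<bar>} x \<le> x ^ (2 * k) / R ^ (2 * k)"
            using R by (auto simp: indicator_def)
        qed
      qed (use int in \<open>auto simp: integrable_indicator_iff emeasure_eq_measure\<close>)
      also have "\<dots> = (\<integral>x. x ^ (2 * k) \<partial>\<mu>) / R ^ (2 * k)" by simp
      also have "\<dots> \<le> C ^ (2 * k) / R ^ (2 * k)"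
        using bound[of "2 * k"] R by (intro divide_right_mono) auto
      also have "\<dots> = ((C / R)\<^sup>2) ^ k" by (simp add: power_mult power_divide)
      finally show ?thesis .
    qed
    moreover have "(\<lambda>k. ((C / R)\<^sup>2) ^ k) \<longlonglongrightarrow> 0"
      using R C by (intro LIMSEQ_realpow_zero) (auto simp: power_less_one_iff)
    ultimately have "p \<le> 0"
      by (intro LIMSEQ_le_const[where X = "\<lambda>k. ((C / R)\<^sup>2) ^ k"]) auto
    then have "p = 0" by (simp add: p_def measure_nonneg antisym)
    then have "emeasure \<mu> {x \<in> space \<mu>. R \<le> \<bar>x\<bar>} = 0" by (simp add: emeasure_eq_measure p_def)
    then have "AE x in \<mu>. \<not> R \<le> \<bar>x\<bar>" by (intro AE_I[where N = "{x \<in> space \<mu>. R \<le> \<bar>x\<bar>}"]) auto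
    then show ?thesis by (auto simp: R_def not_le)
  qed
  then have "AE x in \<mu>. \<forall>m. \<bar>x\<bar> < C + 1 / real (Suc m)" by (simp add: AE_all_countable)
  then show ?thesis
  proof eventually_elim
    case (elim x)
    have "(\<lambda>m. C + 1 / real (Suc m)) \<longlonglongrightarrow> C + 0"
      by (intro tendsto_intros LIMSEQ_Suc[OF lim_1_over_n])
    then show ?case using elim by (intro LIMSEQ_le_const) (auto intro: less_imp_le)
  qed
qed

text \<open>
  On the common compact support f is uniformly close to a polynomial, by the Weierstrass theorem.
\<close>

lemma tendsto_integral_of_moments:
  fixes \<mu> :: "nat \<Rightarrow> real measure" and \<nu> :: "real measure"
    and f :: "real \<Rightarrow> real"
  assumes mu: "\<And>n. prob_space (\<mu> n)" "\<And>n. sets (\<mu> n) = sets borel" "\<And>n. AE x in \<mu> n. \<bar>x\<bar> \<le> C"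
    and nu: "prob_space \<nu>" "sets \<nu> = sets borel" "AE x in \<nu>. \<bar>x\<bar> \<le> C"
    and mom: "\<And>k. (\<lambda>n. \<integral>x. x ^ k \<partial>\<mu> n) \<longlonglongrightarrow> (\<integral>x. x ^ k \<partial>\<nu>)"
    and f: "continuous_on UNIV f"
  shows "(\<lambda>n. \<integral>x. f x \<partial>\<mu> n) \<longlonglongrightarrow> (\<integral>x. f x \<partial>\<nu>)"
proof (rule tendstoI)
  fix e :: real assume "e > 0"
  then have e3: "e / 3 > 0" by simp
  obtain g where g: "real_polynomial_function g" "\<And>x. x \<in> {-C..C} \<Longrightarrow> \<bar>f x - g x\<bar> < e / 3"
    using Stone_Weierstrass_real_polynomial_function[of "{-C..C}" f "e / 3"] e3
      continuous_on_subset[OF f] by blast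
  obtain a N where gsum: "g = (\<lambda>x. \<Sum>i\<le>N. a i * x ^ i)"
    using g(1) real_polynomial_function_iff_sum by blast
  have int: "integrable M h" if h: "continuous_on UNIV h"
    and M: "prob_space M" "sets M = sets borel" "AE x in M. \<bar>x\<bar> \<le> C" for M and h :: "real \<Rightarrow> real"
  proof -
    interpret prob_space M by fact
    have "bounded (h ` {-C..C})"
      by (intro compact_imp_bounded compact_continuous_image continuous_on_subset[OF h]) auto
    then obtain K where K: "\<forall>y\<in>h ` {-C..C}. norm y \<le> K" unfolding bounded_iff by blast
    have "h \<in> borel_measurable M"
      using borel_measurable_continuous_onI[OF h] M(2) by (simp cong: measurable_cong_sets)
    moreover have "AE x in M. norm (h x) \<le> K" using M(3)
        by eventually_elim (use K in \<open>auto simp: abs_le_iff\<close>)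
    ultimately show ?thesis by (intro integrable_const_bound)
  qed
  have gcont: "continuous_on UNIV g" unfolding gsum by (intro continuous_intros)
  have close: "\<bar>(\<integral>x. f x \<partial>M) - (\<integral>x. g x \<partial>M)\<bar> \<le> e / 3"
    if M: "prob_space M" "sets M = sets borel" "AE x in M. \<bar>x\<bar> \<le> C" for M
  proof -
    interpret prob_space M by fact
    have i: "integrable M (\<lambda>x. f x - g x)" using int[OF f M] int[OF gcont M] by simp
    have bd: "AE x in M. \<bar>f x - g x\<bar> \<le> e / 3"
      using M(3) by eventually_elim (intro less_imp_le g(2), simp add: abs_le_iff)
    have "\<bar>(\<integral>x. f x - g x \<partial>M)\<bar> \<le> (\<integral>x. \<bar>f x - g x\<bar> \<partial>M)" by (rule integral_abs_bound)
    also have "\<dots> \<le> (\<integral>x. e / 3 \<partial>M)"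
      using i bd by (intro integral_mono_AE) auto
    finally show ?thesis using int[OF f M] int[OF gcont M] by (simp add: prob_space)
  qed
  have gint: "(\<integral>x. g x \<partial>M) = (\<Sum>i\<le>N. a i * (\<integral>x. x ^ i \<partial>M))"
    if M: "prob_space M" "sets M = sets borel" "AE x in M. \<bar>x\<bar> \<le> C" for M
  proof -
    have "integrable M (\<lambda>x. x ^ i)" for i by (rule int[OF _ M]) (intro continuous_intros)
    then show ?thesis unfolding gsum by simp
  qed
  have "(\<lambda>n. \<integral>x. g x \<partial>\<mu> n) \<longlonglongrightarrow> (\<integral>x. g x \<partial>\<nu>)"
    unfolding gint[OF nu] gint[OF mu] by (intro tendsto_intros mom)
  from tendstoD[OF this e3]
  show "eventually (\<lambda>n. dist (\<integral>x. f x \<partial>\<mu> n) (\<integral>x. f x \<partial>\<nu>) < e) sequentially"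
  proof eventually_elim
    case (elim n)
    then show ?case using close[OF nu] close[OF mu, of n] unfolding dist_real_def by arith
  qed
qed

section \<open>The moments of the Kesten-McKay distribution\<close>

text \<open>
  With \<open>R x = (x - u) (v - x)\<close>, an antiderivative is a combination of \<open>sqrt (R x)\<close> and of two
  arcsines whose arguments run from -1 to 1 on the interval. The second arcsine has the
  coefficient \<open>sqrt (u v)\<close>; for u = 0 its argument degenerates, but the coefficient vanishes.
\<close>

lemma sqrt_over_id_antiderivative:
  assumes u: "0 \<le> u" "u < v"
  obtains G where "continuous_on {u..v} G" and "G v - G u = pi * ((u + v) / 2 - sqrt (u * v))"
    and "\<And>x. u < x \<Longrightarrow> x < v \<Longrightarrow>
           (G has_real_derivative sqrt ((x - u) * (v - x)) / x) (at x)"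
proof -
  define R where "R x = (x - u) * (v - x)" for x
  define y where "y x = (2 * x - u - v) / (v - u)" for x
  define z where "z x = ((u + v) - 2 * (u * v) / x) / (v - u)" for x
  \<comment> \<open>For u = 0 the argument z is constantly 1, where arcsin is not differentiable.\<close>
  define H where "H x = (if u = 0 then 0 else sqrt (u * v) * arcsin (z x))" for x
  define G where "G x = sqrt (R x) + (u + v) / 2 * arcsin (y x) - H x" for x
  have y1: "1 - (y x)\<^sup>2 = 4 * R x / (v - u)\<^sup>2" for x
  proof -
    have "4 * R x = (v - u)\<^sup>2 - (2 * x - u - v)\<^sup>2"
      by (simp add: R_def power2_eq_square algebra_simps)
    moreover have "1 - (y x)\<^sup>2 = ((v - u)\<^sup>2 - (2 * x - u - v)\<^sup>2) / (v - u)\<^sup>2"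
      using u unfolding y_def power_divide by (subst diff_divide_distrib) simp
    ultimately show ?thesis by simp
  qed
  have z1: "1 - (z x)\<^sup>2 = 4 * (u * v) * R x / ((v - u)\<^sup>2 * x\<^sup>2)" if "x > 0" for x
  proof -
    have "4 * (u * v) * R x = ((v - u) * x)\<^sup>2 - ((u + v) * x - 2 * (u * v))\<^sup>2"
      by (simp add: R_def power2_eq_square algebra_simps)
    moreover have "z x = ((u + v) * x - 2 * (u * v)) / ((v - u) * x)"
      using u that by (simp add: z_def field_simps)
    moreover have "1 - (((u + v) * x - 2 * (u * v)) / ((v - u) * x))\<^sup>2
        = (((v - u) * x)\<^sup>2 - ((u + v) * x - 2 * (u * v))\<^sup>2) / ((v - u) * x)\<^sup>2"
      using u that unfolding power_divide by (subst diff_divide_distrib) simp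
    ultimately show ?thesis by (simp add: power_mult_distrib)
  qed
  have Rnn: "R x \<ge> 0" if "x \<in> {u..v}" for x using that by (simp add: R_def)
  have Rpos: "R x > 0" if "u < x" "x < v" for x using that by (simp add: R_def)
  have ybd: "y x \<in> {-1..1}" if "x \<in> {u..v}" for x
  proof -
    have "(y x)\<^sup>2 \<le> 1" using y1[of x] Rnn[OF that] by (smt (verit) divide_nonneg_nonneg zero_le_power2)
    then show ?thesis by (simp add: abs_square_le_1 abs_le_iff)
  qed
  have zbd: "z x \<in> {-1..1}" if "x \<in> {u..v}" "u \<noteq> 0" for x
  proof -
    have "x > 0" using that u by auto
    then have "(z x)\<^sup>2 \<le> 1" using z1[of x] Rnn[OF that(1)] u
      by (smt (verit) divide_nonneg_nonneg zero_le_power2 mult_nonneg_nonneg)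
    then show ?thesis by (simp add: abs_square_le_1 abs_le_iff)
  qed
  have Hcont: "continuous_on {u..v} H"
  proof (cases "u = 0")
    case False
    have "continuous_on {u..v} (\<lambda>x. sqrt (u * v) * arcsin (z x))"
      unfolding z_def
      by (intro continuous_intros; use u False zbd[unfolded z_def] in force)
    then show ?thesis using False by (simp add: H_def)
  qed (simp add: H_def)
  have ycont: "continuous_on {u..v} (\<lambda>x. arcsin (y x))"
    unfolding y_def by (intro continuous_intros; use u ybd[unfolded y_def] in force)
  have "continuous_on {u..v} (\<lambda>x. sqrt (R x))" unfolding R_def by (intro continuous_intros)
  then have cont: "continuous_on {u..v} G"
    unfolding G_def
    by (intro continuous_on_diff continuous_on_add continuous_on_mult continuous_on_const ycont Hcont)
  have "y v = 1" "y u = -1" using u by (simp_all add: y_def field_simps)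
  moreover have "H v - H u = pi * sqrt (u * v)"
  proof (cases "u = 0")
    case False
    then have "z v = 1" "z u = -1" using u by (simp_all add: z_def field_simps)
    then show ?thesis using False by (simp add: H_def)
  qed (simp add: H_def)
  ultimately have ends: "G v - G u = pi * ((u + v) / 2 - sqrt (u * v))"
    by (simp add: G_def R_def algebra_simps)
  have "(G has_real_derivative sqrt (R x) / x) (at x)" if x: "u < x" "x < v" for x
  proof -
    have xpos: "x > 0" using x u by simp
    note Rp = Rpos[OF x]
    have sy: "sqrt (1 - (y x)\<^sup>2) = 2 * sqrt (R x) / (v - u)"
      using u by (simp add: y1 real_sqrt_divide real_sqrt_mult)
    have yb: "-1 < y x" "y x < 1"
      using x u by (simp_all add: y_def field_simps)
    have dR: "((\<lambda>x. sqrt (R x)) has_real_derivative (u + v - 2 * x) / (2 * sqrt (R x))) (at x)"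
      unfolding R_def using Rp
      by (auto intro!: derivative_eq_intros simp: R_def field_simps)
    have dy: "((\<lambda>x. arcsin (y x)) has_real_derivative 1 / sqrt (R x)) (at x)"
    proof -
      have 1: "(y has_real_derivative 2 / (v - u)) (at x)"
        unfolding y_def by (intro DERIV_cdivide) (auto intro!: derivative_eq_intros)
      have "((\<lambda>x. arcsin (y x)) has_real_derivative inverse (sqrt (1 - (y x)\<^sup>2)) * (2 / (v - u)))
          (at x)"
        by (rule DERIV_chain2[OF DERIV_arcsin 1]) (use yb in auto)
      moreover have cancel: "inverse (2 * r / w) * (2 / w) = 1 / r" if "w \<noteq> 0" for r w :: real
        using that by (simp add: field_simps)
      then have "inverse (2 * sqrt (R x) / (v - u)) * (2 / (v - u)) = 1 / sqrt (R x)"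
        using u by (intro cancel) simp
      ultimately show ?thesis by (simp only: sy)
    qed
    have dH: "(H has_real_derivative u * v / (x * sqrt (R x))) (at x)"
    proof (cases "u = 0")
      case False
      then have uv: "u * v > 0" using u by simp
      have 1: "(z has_real_derivative 2 * (u * v) / x\<^sup>2 / (v - u)) (at x)"
        unfolding z_def using u xpos
        by (auto intro!: derivative_eq_intros simp: power2_eq_square)
      have sz: "sqrt (1 - (z x)\<^sup>2) = 2 * sqrt (u * v) * sqrt (R x) / ((v - u) * x)"
        using u xpos by (simp add: z1 real_sqrt_divide real_sqrt_mult)
      have "1 - (z x)\<^sup>2 > 0" using uv Rp u xpos by (simp add: z1)
      then have zb: "-1 < z x" "z x < 1" by (auto simp: abs_square_less_1 abs_less_iff)
      have "((\<lambda>x. arcsin (z x)) has_real_derivative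
          inverse (sqrt (1 - (z x)\<^sup>2)) * (2 * (u * v) / x\<^sup>2 / (v - u))) (at x)"
        by (rule DERIV_chain2[OF DERIV_arcsin 1]) (use zb in auto)
      then have "((\<lambda>x. sqrt (u * v) * arcsin (z x)) has_real_derivative
          sqrt (u * v) * (inverse (sqrt (1 - (z x)\<^sup>2)) * (2 * (u * v) / x\<^sup>2 / (v - u)))) (at x)"
        by (rule DERIV_cmult)
      also have "sqrt (u * v) * (inverse (sqrt (1 - (z x)\<^sup>2)) * (2 * (u * v) / x\<^sup>2 / (v - u)))
          = u * v / (x * sqrt (R x))"
      proof -
        have cancel: "q * (inverse (2 * q * r / (w * x)) * (2 * q\<^sup>2 / x\<^sup>2 / w)) = q\<^sup>2 / (x * r)"
          if "w \<noteq> 0" "q \<noteq> 0" for q r w :: real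
          using that xpos by (simp add: field_simps power2_eq_square)
        have "v - u \<noteq> 0" "sqrt (u * v) \<noteq> 0" "(sqrt (u * v))\<^sup>2 = u * v" using u uv by auto
        with cancel[of "v - u" "sqrt (u * v)" "sqrt (R x)"] show ?thesis unfolding sz by simp
      qed
      finally show ?thesis using False by (simp add: H_def[abs_def])
    qed (simp add: H_def[abs_def])
    have "(G has_real_derivative (u + v - 2 * x) / (2 * sqrt (R x)) + (u + v) / 2 * (1 / sqrt (R x))
        - u * v / (x * sqrt (R x))) (at x)"
      unfolding G_def[abs_def] by (intro DERIV_diff DERIV_add DERIV_cmult dR dy dH)
    also have "(u + v - 2 * x) / (2 * sqrt (R x)) + (u + v) / 2 * (1 / sqrt (R x))
        - u * v / (x * sqrt (R x)) = R x / (x * sqrt (R x))"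
      using xpos Rp by (simp add: field_simps) (simp add: R_def algebra_simps)
    also have "\<dots> = sqrt (R x) / x" using Rp xpos by (simp add: field_simps)
    finally show ?thesis .
  qed
  with that cont ends show thesis by (simp add: R_def)
qed

lemma has_integral_sqrt_over_id:
  assumes "0 \<le> u" "u < v"
  shows "((\<lambda>x. sqrt ((x - u) * (v - x)) / x) has_integral pi * ((u + v) / 2 - sqrt (u * v))) {u..v}"
proof -
  obtain G where "continuous_on {u..v} G" and G: "G v - G u = pi * ((u + v) / 2 - sqrt (u * v))"
    and "\<And>x. u < x \<Longrightarrow> x < v \<Longrightarrow> (G has_real_derivative sqrt ((x - u) * (v - x)) / x) (at x)"
    using sqrt_over_id_antiderivative[OF assms] by metis
  then show ?thesis using assms unfolding G[symmetric]
    by (intro fundamental_theorem_of_calculus_interior)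
      (auto simp: has_real_derivative_iff_has_vector_derivative)
qed

text \<open>
  Reflection of the previous integral at 1/2.
\<close>

lemma has_integral_sqrt_over_one_minus:
  assumes "u < v" "v \<le> 1"
  shows "((\<lambda>x. sqrt ((x - u) * (v - x)) / (1 - x)) has_integral
           pi * (1 - (u + v) / 2 - sqrt ((1 - u) * (1 - v)))) {u..v}"
proof -
  have uv: "0 \<le> 1 - v" "1 - v < 1 - u" using assms by auto
  obtain G where G: "continuous_on {1-v..1-u} G"
      "G (1-u) - G (1-v) = pi * ((1 - v + (1 - u)) / 2 - sqrt ((1 - v) * (1 - u)))"
      "\<And>x. 1-v < x \<Longrightarrow> x < 1-u \<Longrightarrow>
         (G has_real_derivative sqrt ((x - (1-v)) * (1-u - x)) / x) (at x)"
    using sqrt_over_id_antiderivative[OF uv] by metis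
  define F where "F x = - G (1 - x)" for x
  have "((\<lambda>x. sqrt ((x - u) * (v - x)) / (1 - x)) has_integral F v - F u) {u..v}"
  proof (rule fundamental_theorem_of_calculus_interior)
    show "continuous_on {u..v} F" unfolding F_def
      by (intro continuous_intros continuous_on_compose2[OF G(1)]) auto
    fix x assume x: "x \<in> {u<..<v}"
    have "((\<lambda>x. G (1 - x)) has_real_derivative sqrt ((1 - x - (1-v)) * (1-u - (1 - x))) / (1 - x) *
        (-1)) (at x)"
      by (rule DERIV_chain2[OF G(3)]) (use x in \<open>auto intro!: derivative_eq_intros\<close>)
    then have "(F has_real_derivative - (sqrt ((1 - x - (1-v)) * (1-u - (1 - x))) / (1 - x) * (-1)))
        (at x)"
      unfolding F_def by (rule DERIV_minus)
    then show "(F has_vector_derivative sqrt ((x - u) * (v - x)) / (1 - x)) (at x)"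
      by (simp add: has_real_derivative_iff_has_vector_derivative mult.commute)
  qed (use assms in simp)
  moreover have "F v - F u = pi * (1 - (u + v) / 2 - sqrt ((1 - u) * (1 - v)))"
    using G(2) by (simp add: F_def field_simps)
  ultimately show ?thesis by simp
qed

text \<open>
  The orthogonal polynomials of a Jacobi matrix with constant entries are rescaled Chebyshev
  polynomials of the second kind.
\<close>

lemma chebyshev_sin:
  "sin t * poly (jacobi_poly (\<lambda>_. c) (\<lambda>_. d\<^sup>2) j) (c + 2 * d * cos t) = d ^ j * sin (real (j + 1) * t)"
proof (induction j rule: induct_nat_012)
  case (ge2 j)
  define \<theta> where "\<theta> = real (j + 2) * t"
  have "sin t * poly (jacobi_poly (\<lambda>_. c) (\<lambda>_. d\<^sup>2) (Suc (Suc j))) (c + 2 * d * cos t)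
      = 2 * d * cos t * (d ^ Suc j * sin (real (Suc j + 1) * t)) - d\<^sup>2 * (d ^ j * sin (real (j + 1)
          * t))"
    unfolding ge2[symmetric] by (simp add: algebra_simps)
  also have "\<dots> = d ^ (j + 2) * (2 * cos t * sin \<theta> - sin (\<theta> - t))"
    by (simp add: \<theta>_def algebra_simps power2_eq_square)
  also have "2 * cos t * sin \<theta> - sin (\<theta> - t) = sin (\<theta> + t)"
    by (simp add: sin_add sin_diff algebra_simps)
  finally show ?case by (simp add: \<theta>_def algebra_simps)
qed (auto simp: sin_double)

text \<open>
  Put \<open>x = c + 2 d cos \<theta>\<close>. The integrand becomes a multiple of \<open>sin \<theta> * sin ((j + 1) \<theta>)\<close>, a
  difference of two cosines, and its antiderivative vanishes at 0 and \<open>\<pi>\<close> unless j = 0.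
\<close>

lemma has_integral_semicircle_chebyshev:
  assumes d: "d > 0"
  shows "((\<lambda>x. sqrt ((x - (c - 2 * d)) * (c + 2 * d - x)) * poly (jacobi_poly (\<lambda>_. c) (\<lambda>_. d\<^sup>2) j) x)
           has_integral (if j = 0 then 2 * pi * d\<^sup>2 else 0)) {c - 2 * d..c + 2 * d}"
proof -
  define \<theta> where "\<theta> x = arccos ((x - c) / (2 * d))" for x
  \<comment> \<open>An antiderivative of \<open>cos (j t)\<close>, also for j = 0.\<close>
  define S where "S t = (if j = 0 then t else sin (real j * t) / real j)" for t
  define G where "G x = - (2 * d\<^sup>2 * d ^ j) * (S (\<theta> x) - sin (real (j + 2) * \<theta> x) / real (j + 2))" for x
  have bd: "(x - c) / (2 * d) \<in> {-1..1}" if "x \<in> {c - 2 * d..c + 2 * d}" for x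
    using that d by (simp add: field_simps)
  have th: "continuous_on {c - 2 * d..c + 2 * d} \<theta>"
    unfolding \<theta>_def by (intro continuous_intros; use d bd in force)
  have dS: "(S has_real_derivative cos (real j * t)) (at t)" for t
    unfolding S_def by (cases "j = 0") (auto intro!: derivative_eq_intros)
  have "continuous_on UNIV S"
    using dS by (auto simp: continuous_on_eq_continuous_at intro!: DERIV_isCont)
  then have "continuous_on {c - 2 * d..c + 2 * d} (\<lambda>x. S (\<theta> x))"
    by (rule continuous_on_compose2) (use th in auto)
  then have Gcont: "continuous_on {c - 2 * d..c + 2 * d} G"
    unfolding G_def by (intro continuous_intros th) auto
  have "((\<lambda>x. sqrt ((x - (c - 2 * d)) * (c + 2 * d - x)) * poly (jacobi_poly (\<lambda>_. c) (\<lambda>_. d\<^sup>2) j) x)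
           has_integral G (c + 2 * d) - G (c - 2 * d)) {c - 2 * d..c + 2 * d}"
  proof (rule fundamental_theorem_of_calculus_interior)
    fix x assume x: "x \<in> {c - 2 * d<..<c + 2 * d}"
    define y where "y = (x - c) / (2 * d)"
    have y: "-1 < y" "y < 1" using x d by (simp_all add: y_def field_simps)
    have xy: "x = c + 2 * d * cos (\<theta> x)" using y d
        by (simp add: \<theta>_def y_def[symmetric]) (simp add: y_def)
    have sn: "sin (\<theta> x) = sqrt (1 - y\<^sup>2)" using y by (simp add: \<theta>_def y_def[symmetric] sin_arccos)
    have snp: "sin (\<theta> x) > 0" unfolding sn using y by (simp add: abs_square_less_1 abs_less_iff)
    have "(x - (c - 2 * d)) * (c + 2 * d - x) = (2 * d)\<^sup>2 * (1 - y\<^sup>2)"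
      using d by (simp add: y_def field_simps power2_eq_square)
    then have sR: "sqrt ((x - (c - 2 * d)) * (c + 2 * d - x)) = 2 * d * sin (\<theta> x)"
      using d by (simp add: sn real_sqrt_mult)
    have dth: "(\<theta> has_real_derivative - (1 / (2 * d * sin (\<theta> x)))) (at x)"
    proof -
      have "(\<theta> has_real_derivative inverse (- sqrt (1 - ((x - c) / (2 * d))\<^sup>2)) * (1 / (2 * d))) (at x)"
        unfolding \<theta>_def
        by (rule DERIV_chain2[OF DERIV_arccos]) (use y d in \<open>auto simp: y_def intro!:
            derivative_eq_intros\<close>)
      then show ?thesis using snp d by (simp add: sn y_def field_simps)
    qed
    have "(G has_real_derivative - (2 * d\<^sup>2 * d ^ j) *
        (cos (real j * \<theta> x) * (- (1 / (2 * d * sin (\<theta> x))))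
        - cos (real (j + 2) * \<theta> x) * (real (j + 2) * (- (1 / (2 * d * sin (\<theta> x))))) / real (j + 2)))
            (at x)"
      unfolding G_def
      by (intro DERIV_cmult DERIV_diff DERIV_chain2[OF dS dth] DERIV_cdivide DERIV_chain2[OF
          DERIV_sin] dth)
    also have "- (2 * d\<^sup>2 * d ^ j) *
        (cos (real j * \<theta> x) * (- (1 / (2 * d * sin (\<theta> x))))
        - cos (real (j + 2) * \<theta> x) * (real (j + 2) * (- (1 / (2 * d * sin (\<theta> x))))) / real (j + 2))
        = d * d ^ j * (cos (real j * \<theta> x) - cos (real (j + 2) * \<theta> x)) / sin (\<theta> x)"
    proof -
      have aux: "- (2 * d\<^sup>2 * e) * (a * (- (1 / (2 * d * s))) - b * (k * (- (1 / (2 * d * s)))) / k)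
          = d * e * (a - b) / s" if "k \<noteq> 0" "s \<noteq> 0" for a b e k s :: real
        using that d by (simp add: field_simps power2_eq_square)
      show ?thesis by (rule aux) (use snp in auto)
    qed
    also have "cos (real j * \<theta> x) - cos (real (j + 2) * \<theta> x) = 2 * sin (real (j + 1) * \<theta> x) * sin (\<theta> x)"
    proof -
      have "real j * \<theta> x = real (j + 1) * \<theta> x - \<theta> x" "real (j + 2) * \<theta> x = real (j + 1) * \<theta> x + \<theta> x"
        by (simp_all add: algebra_simps)
      then show ?thesis by (simp only: cos_add cos_diff)
    qed
    also have "d * d ^ j * (2 * sin (real (j + 1) * \<theta> x) * sin (\<theta> x)) / sin (\<theta> x)
        = 2 * d * (d ^ j * sin (real (j + 1) * \<theta> x))"
      using snp by simp
    also have "\<dots> = 2 * d * (sin (\<theta> x) * poly (jacobi_poly (\<lambda>_. c) (\<lambda>_. d\<^sup>2) j) x)"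
      by (simp only: chebyshev_sin[of "\<theta> x" c d j, folded xy])
    finally show "(G has_vector_derivative sqrt ((x - (c - 2 * d)) * (c + 2 * d - x)) *
        poly (jacobi_poly (\<lambda>_. c) (\<lambda>_. d\<^sup>2) j) x) (at x)"
      by (simp add: sR has_real_derivative_iff_has_vector_derivative mult.assoc)
  qed (use d Gcont in auto)
  moreover have "G (c + 2 * d) - G (c - 2 * d) = (if j = 0 then 2 * pi * d\<^sup>2 else 0)"
  proof -
    have "\<theta> (c + 2 * d) = 0" "\<theta> (c - 2 * d) = pi" using d by (simp_all add: \<theta>_def)
    moreover have "sin (real (j + 2) * pi) = 0" "sin (real j * pi) = 0" by (rule sin_npi)+
    ultimately show ?thesis by (simp add: G_def S_def)
  qed
  ultimately show ?thesis by simp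
qed

text \<open>
  The limits of the beta variables with odd and with even index.
\<close>

definition km_odd :: "real \<Rightarrow> real \<Rightarrow> real" where "km_odd ka kb = (1 + ka) / (2 + ka + kb)"
definition km_even :: "real \<Rightarrow> real \<Rightarrow> real" where "km_even ka kb = 1 / (2 + ka + kb)"

text \<open>
  Here \<open>po\<close> and \<open>pe\<close> are the limits of the beta variables, and c and \<open>d\<^sup>2\<close> are the coefficients of
  the limiting Jacobi matrix beyond its first row. Its continuous spectrum \<open>[c - 2 d, c + 2 d]\<close> is
  the support of the Kesten-McKay distribution.
\<close>

locale kesten_mckay_parameters =
  fixes ka kb po pe u v c d :: real
  assumes ka: "ka \<ge> 0" and kb: "kb \<ge> 0"
  defines "po \<equiv> km_odd ka kb" and "pe \<equiv> km_even ka kb"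
    and "u \<equiv> u_minus ka kb" and "v \<equiv> u_plus ka kb"
    and "c \<equiv> po * (1 - pe) + pe * (1 - po)"
    and "d \<equiv> sqrt (po * (1 - pe) * (pe * (1 - po)))"
begin

lemma po_pe: "0 < pe" "0 < po" "pe \<le> po" "po + pe \<le> 1" "po < 1" "pe < 1"
  using ka kb by (auto simp: po_def pe_def km_odd_def km_even_def field_simps)

lemma d_pos: "d > 0" using po_pe by (simp add: d_def)

lemma d_sq: "d\<^sup>2 = po * (1 - pe) * (pe * (1 - po))" using po_pe by (simp add: d_def)

lemma edges: "u = c - 2 * d" "v = c + 2 * d"
proof -
  define K where "K = 2 + ka + kb"
  have K: "K > 0" using ka kb by (simp add: K_def)
  have e: "po * (1 - pe) = (1 + ka) * (1 + ka + kb) / K\<^sup>2" "pe * (1 - po) = (1 + kb) / K\<^sup>2"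
  proof -
    have "po = (1 + ka) / K" "1 - po = (1 + kb) / K" "pe = 1 / K" "1 - pe = (1 + ka + kb) / K"
      using K by (simp_all add: po_def pe_def km_odd_def km_even_def K_def field_simps)
    then show "po * (1 - pe) = (1 + ka) * (1 + ka + kb) / K\<^sup>2" "pe * (1 - po) = (1 + kb) / K\<^sup>2"
      by (simp_all add: power2_eq_square)
  qed
  define s t where "s = sqrt (po * (1 - pe))" and "t = sqrt (pe * (1 - po))"
  have st: "s\<^sup>2 = po * (1 - pe)" "t\<^sup>2 = pe * (1 - po)"
    using po_pe by (simp_all add: s_def t_def)
  have "s * t = d" by (simp add: s_def t_def d_def real_sqrt_mult)
  have "s = sqrt ((1 + ka) * (1 + ka + kb)) / K" "t = sqrt (1 + kb) / K"
    unfolding s_def t_def e using K by (simp_all add: real_sqrt_divide)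
  then have "u = (s - t)\<^sup>2" "v = (s + t)\<^sup>2"
    by (simp_all add: u_def v_def u_minus_def u_plus_def K_def diff_divide_distrib add_divide_distrib)
  then show "u = c - 2 * d" "v = c + 2 * d"
    by (simp_all add: power2_diff power2_sum st \<open>s * t = d\<close> c_def mult.assoc)
qed

lemma mid: "(u + v) / 2 = c" by (simp add: edges)

text \<open>
  The bound v \<open>\<le>\<close> 1 is the inequality of the arithmetic and the geometric mean for \<open>po * pe\<close> and
  \<open>(1 - po) * (1 - pe)\<close>.
\<close>

lemma edges_bounds: "0 \<le> u" "u < v" "v \<le> 1"
proof -
  show "0 \<le> u" by (simp add: u_def u_minus_def)
  show "u < v" using d_pos by (simp add: edges)
  have "d = sqrt (po * pe * ((1 - po) * (1 - pe)))" by (simp add: d_def mult_ac)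
  also have "\<dots> \<le> (po * pe + (1 - po) * (1 - pe)) / 2"
    by (rule arith_geo_mean_sqrt) (use po_pe in auto)
  finally show "v \<le> 1" by (simp add: edges c_def algebra_simps)
qed

definition wt :: "real \<Rightarrow> real" where
  "wt x = (2 + ka + kb) / (2 * pi) * (sqrt ((x - u) * (v - x)) / (x * (1 - x)))"

lemma wt_eq: "wt x = 1 / (2 * pi * pe) * (sqrt ((x - u) * (v - x)) / (x * (1 - x)))"
  by (simp add: wt_def pe_def km_even_def)

lemma wt_nonneg: "x \<in> {u..v} \<Longrightarrow> wt x \<ge> 0"
  using edges_bounds ka kb unfolding wt_def by (intro mult_nonneg_nonneg divide_nonneg_nonneg) auto

lemma wt_edges [simp]: "wt u = 0" "wt v = 0" by (simp_all add: wt_def)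

lemma interior_cases:
  assumes "x \<in> {u..v}" shows "x = u \<or> x = v \<or> (0 < x \<and> x < 1)"
  using assms edges_bounds by auto

lemma has_integral_wt_times_id: "((\<lambda>x. wt x * x) has_integral po) {u..v}"
proof -
  have "(1 - u) * (1 - v) = (1 - c)\<^sup>2 - 4 * d\<^sup>2" by (simp add: edges power2_eq_square algebra_simps)
  also have "\<dots> = (1 - po - pe)\<^sup>2" unfolding d_sq c_def by (simp add: power2_eq_square algebra_simps)
  finally have s: "sqrt ((1 - u) * (1 - v)) = 1 - po - pe" using po_pe by simp
  have "1 - (u + v) / 2 - sqrt ((1 - u) * (1 - v)) = 2 * po * pe"
    unfolding s mid by (simp add: c_def algebra_simps)
  then have "((\<lambda>x. sqrt ((x - u) * (v - x)) / (1 - x)) has_integral pi * (2 * po * pe)) {u..v}"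
    using has_integral_sqrt_over_one_minus[of u v] edges_bounds by simp
  then have "((\<lambda>x. 1 / (2 * pi * pe) * (sqrt ((x - u) * (v - x)) / (1 - x))) has_integral
      1 / (2 * pi * pe) * (pi * (2 * po * pe))) {u..v}"
    by (rule has_integral_mult_right)
  also have "1 / (2 * pi * pe) * (pi * (2 * po * pe)) = po" using po_pe by simp
  finally show ?thesis
    by (rule has_integral_eq[rotated]) (use interior_cases in \<open>force simp: wt_eq\<close>)
qed

text \<open>
  The splitting \<open>1 / (x (1 - x)) = 1 / x + 1 / (1 - x)\<close> reduces this to the two arcsine integrals.
\<close>

lemma has_integral_wt: "(wt has_integral 1) {u..v}"
proof -
  have "u * v = c\<^sup>2 - 4 * d\<^sup>2" by (simp add: edges power2_eq_square algebra_simps)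
  also have "\<dots> = (po - pe)\<^sup>2" unfolding d_sq c_def by (simp add: power2_eq_square algebra_simps)
  finally have s: "sqrt (u * v) = po - pe" using po_pe by simp
  have "(u + v) / 2 - sqrt (u * v) = 2 * pe * (1 - po)"
    unfolding s mid by (simp add: c_def algebra_simps)
  then have "((\<lambda>x. sqrt ((x - u) * (v - x)) / x) has_integral pi * (2 * pe * (1 - po))) {u..v}"
    using has_integral_sqrt_over_id[of u v] edges_bounds by simp
  then have "((\<lambda>x. 1 / (2 * pi * pe) * (sqrt ((x - u) * (v - x)) / x)) has_integral
      1 / (2 * pi * pe) * (pi * (2 * pe * (1 - po)))) {u..v}"
    by (rule has_integral_mult_right)
  also have "1 / (2 * pi * pe) * (pi * (2 * pe * (1 - po))) = 1 - po" using po_pe by simp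
  finally have "((\<lambda>x. 1 / (2 * pi * pe) * (sqrt ((x - u) * (v - x)) / x) + wt x * x)
      has_integral 1 - po + po) {u..v}"
    by (rule has_integral_add) (rule has_integral_wt_times_id)
  also have "1 - po + po = 1" by simp
  finally show ?thesis
  proof (rule has_integral_eq[rotated])
    fix x assume "x \<in> {u..v}"
    then consider "x = u" | "x = v" | "0 < x" "x < 1" using interior_cases by blast
    then show "1 / (2 * pi * pe) * (sqrt ((x - u) * (v - x)) / x) + wt x * x = wt x"
    proof cases
      case 3
      then show ?thesis using po_pe by (simp add: wt_eq divide_simps) (simp add: algebra_simps)
    qed auto
  qed
qed

text \<open>
  The factor \<open>x (1 - x)\<close> cancels the denominator of the density and leaves a semicircle.
\<close>

lemma has_integral_wt_semicircle:
  "((\<lambda>x. wt x * (x * (1 - x) * poly (jacobi_poly (\<lambda>_. c) (\<lambda>_. d\<^sup>2) j) x))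
     has_integral (if j = 0 then po * (1 - po) * (1 - pe) else 0)) {u..v}"
proof -
  have "((\<lambda>x. 1 / (2 * pi * pe) * (sqrt ((x - u) * (v - x)) * poly (jacobi_poly (\<lambda>_. c) (\<lambda>_. d\<^sup>2) j) x))
      has_integral 1 / (2 * pi * pe) * (if j = 0 then 2 * pi * d\<^sup>2 else 0)) {u..v}"
    unfolding edges by (intro has_integral_mult_right has_integral_semicircle_chebyshev d_pos)
  also have "1 / (2 * pi * pe) * (if j = 0 then 2 * pi * d\<^sup>2 else 0)
      = (if j = 0 then po * (1 - po) * (1 - pe) else 0)"
    using po_pe by (simp add: d_sq)
  finally show ?thesis
    by (rule has_integral_eq[rotated]) (use interior_cases in \<open>force simp: wt_eq\<close>)
qed

abbreviation "KM \<equiv> kesten_mckay ka kb"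

lemma KM_eq: "KM = density lborel (\<lambda>x. ennreal (indicator {u..v} x * wt x))"
  unfolding kesten_mckay_def
proof (rule arg_cong[where f = "density lborel"], rule ext)
  fix x
  have eq: "indicator {u<..<v} x * wt x = indicator {u..v} x * wt x"
    by (cases "x = u"; cases "x = v") (auto simp: indicator_def)
  show "ennreal (indicator {u_minus ka kb<..<u_plus ka kb} x * ((2 + ka + kb) / (2 * pi) *
      (sqrt ((x - u_minus ka kb) * (u_plus ka kb - x)) / (x * (1 - x))))) = ennreal (indicator
          {u..v} x * wt x)"
    unfolding eq[symmetric] unfolding wt_def u_def v_def by (rule refl)
qed

lemma wt_measurable [measurable]: "wt \<in> borel_measurable borel"
  unfolding wt_def[abs_def] by measurable

lemma sets_KM: "sets KM = sets borel" by (simp add: KM_eq)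

lemma prob_space_KM: "prob_space KM"
proof
  have "emeasure KM (space KM) = (\<integral>\<^sup>+x. ennreal (wt x) * indicator {u..v} x \<partial>lborel)"
    unfolding KM_eq by (subst emeasure_density) (auto intro!: nn_integral_cong simp: indicator_def)
  also have "\<dots> = 1"
    using nn_integral_has_integral_lebesgue'[OF wt_nonneg has_integral_wt] by simp
  finally show "emeasure KM (space KM) = 1" .
qed

lemma AE_KM: "AE x in KM. \<bar>x\<bar> \<le> 1"
  unfolding KM_eq using edges_bounds by (subst AE_density) (auto simp: indicator_def)

lemma integrable_KM:
  fixes q :: "real \<Rightarrow> real"
  assumes "continuous_on UNIV q"
  shows "integrable KM q"
proof -
  interpret prob_space KM by (rule prob_space_KM)
  have "bounded (q ` {-1..1})"
    by (intro compact_imp_bounded compact_continuous_image continuous_on_subset[OF assms]) auto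
  then obtain K where K: "\<forall>y\<in>q ` {-1..1}. norm y \<le> K" unfolding bounded_iff by blast
  have "q \<in> borel_measurable KM"
    using borel_measurable_continuous_onI[OF assms] sets_KM by (simp cong: measurable_cong_sets)
  moreover have "AE x in KM. norm (q x) \<le> K" using AE_KM
      by eventually_elim (use K in \<open>auto simp: abs_le_iff\<close>)
  ultimately show ?thesis by (intro integrable_const_bound)
qed

lemma integral_KM:
  fixes q :: "real \<Rightarrow> real"
  assumes q: "continuous_on UNIV q" and I: "((\<lambda>x. wt x * q x) has_integral I) {u..v}"
  shows "(\<integral>x. q x \<partial>KM) = I"
proof -
  have [measurable]: "q \<in> borel_measurable borel" by (rule borel_measurable_continuous_onI[OF q])
  have nn: "AE x in lborel. 0 \<le> indicator {u..v} x * wt x" by (auto simp: indicator_def wt_nonneg)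
  have i: "integrable lborel (\<lambda>x. (indicator {u..v} x * wt x) * q x)"
    using integrable_KM[OF q] unfolding KM_eq by (subst (asm) integrable_density) (use nn in auto)
  have "(\<integral>x. q x \<partial>KM) = (\<integral>x. (indicator {u..v} x * wt x) * q x \<partial>lborel)"
    unfolding KM_eq by (subst integral_density) (use nn in auto)
  moreover have "((\<lambda>x. if x \<in> {u..v} then wt x * q x else 0) has_integral
      (\<integral>x. (indicator {u..v} x * wt x) * q x \<partial>lborel)) UNIV"
    using has_integral_integral_lborel[OF i]
        by (rule has_integral_eq[rotated]) (auto simp: indicator_def)
  then have "((\<lambda>x. wt x * q x) has_integral (\<integral>x. (indicator {u..v} x * wt x) * q x \<partial>lborel)) {u..v}"
    by (simp only: has_integral_restrict_UNIV)
  ultimately show ?thesis using has_integral_unique[OF _ I] by simp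
qed

definition A where "A i = (if i = 0 then po else c)" for i :: nat
definition B where "B i = (if i = 0 then po * pe * (1 - po) else d\<^sup>2)" for i :: nat

text \<open>
  The limiting matrix differs from the one with constant entries in the first row only, so both
  sides satisfy the same recurrence in j once the cases j = 0, 1, 2 are checked. The coefficient
  of \<open>P\<^sub>0\<close> is exceptional because the first off-diagonal entry is.
\<close>

lemma bernstein_szego:
  fixes x :: real
  defines "P \<equiv> \<lambda>j. poly (jacobi_poly A B j) x" and "U \<equiv> \<lambda>j. poly (jacobi_poly (\<lambda>_. c) (\<lambda>_. d\<^sup>2) j) x"
  shows "x * (1 - x) * U j = (if j = 0 then 1 else 1 - pe) * (po * (1 - po) * (1 - pe)) * P j
           + (1 - c - po) * P (Suc j) - P (Suc (Suc j))"
proof (induction j rule: induct_nat_012)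
  case 0
  show ?case by (simp add: U_def P_def A_def B_def c_def) (simp add: algebra_simps)
next
  case 1
  show ?case by (simp add: U_def P_def A_def B_def d_sq c_def) (simp add: algebra_simps)
next
  case (ge2 j)
  have U: "U (Suc (Suc j)) = (x - c) * U (Suc j) - d\<^sup>2 * U j"
    by (simp add: U_def algebra_simps)
  have P: "P (Suc (Suc i)) = (x - c) * P (Suc i) - B i * P i" for i
    by (simp add: P_def A_def algebra_simps)
  have "x * (1 - x) * U (Suc (Suc j)) = (x - c) * (x * (1 - x) * U (Suc j)) - d\<^sup>2 * (x * (1 - x) * U j)"
    by (simp add: U algebra_simps)
  also have "\<dots> = (1 - pe) * (po * (1 - po) * (1 - pe)) * P (Suc (Suc j))
           + (1 - c - po) * P (Suc (Suc (Suc j))) - P (Suc (Suc (Suc (Suc j))))"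
    unfolding ge2 by (cases "j = 0"; simp add: P B_def d_sq; simp add: algebra_simps)
  finally show ?case by simp
qed

text \<open>
  Integrating \<open>bernstein_szego\<close> expresses the integral of \<open>P\<^sub>j\<^sub>+\<^sub>2\<close> by those of \<open>P\<^sub>j\<close> and
  \<open>P\<^sub>j\<^sub>+\<^sub>1\<close> and by the semicircle integral of \<open>U\<^sub>j\<close>. The total mass and the mean start the
  induction.
\<close>

lemma KM_orthogonal: "(\<integral>x. poly (jacobi_poly A B j) x \<partial>KM) = (if j = 0 then 1 else 0)"
proof (induction j rule: induct_nat_012)
  case 0
  interpret prob_space KM by (rule prob_space_KM)
  show ?case by (simp add: prob_space)
next
  case 1
  interpret prob_space KM by (rule prob_space_KM)
  have "(\<integral>x. x \<partial>KM) = po" by (rule integral_KM) (auto intro: has_integral_wt_times_id continuous_on_id)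
  moreover have "integrable KM (\<lambda>x. x)" by (rule integrable_KM) (rule continuous_on_id)
  ultimately show ?case by (simp add: A_def prob_space)
next
  case (ge2 j)
  define P where "P j = poly (jacobi_poly A B j)" for j
  define Q where "Q x = x * (1 - x) * poly (jacobi_poly (\<lambda>_. c) (\<lambda>_. d\<^sup>2) j) x" for x
  have int: "integrable KM (P i)" for i
    unfolding P_def by (rule integrable_KM) (intro continuous_intros)
  have Q: "(\<integral>x. Q x \<partial>KM) = (if j = 0 then po * (1 - po) * (1 - pe) else 0)"
    unfolding Q_def by (rule integral_KM[OF _ has_integral_wt_semicircle]) (intro continuous_intros)
  have "(\<integral>x. Q x \<partial>KM) = (\<integral>x. (if j = 0 then 1 else 1 - pe) * (po * (1 - po) * (1 - pe)) * P j x
           + (1 - c - po) * P (Suc j) x - P (Suc (Suc j)) x \<partial>KM)"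
    by (simp only: Q_def bernstein_szego P_def)
  also have "\<dots> = (if j = 0 then 1 else 1 - pe) * (po * (1 - po) * (1 - pe)) * (\<integral>x. P j x \<partial>KM)
           + (1 - c - po) * (\<integral>x. P (Suc j) x \<partial>KM) - (\<integral>x. P (Suc (Suc j)) x \<partial>KM)"
    using int by simp
  finally show ?case unfolding Q using ge2 by (simp add: P_def split: if_splits)
qed

lemma KM_moment: "(\<integral>x. x ^ k \<partial>KM) = jacobi_row A B k 0"
proof -
  have "integrable KM (poly (jacobi_poly A B i))" for i
      by (rule integrable_KM) (intro continuous_intros)
  then have "(\<integral>x. x ^ k \<partial>KM) = (\<Sum>i\<le>k. jacobi_row A B k i * (\<integral>x. poly (jacobi_poly A B i) x \<partial>KM))"
    by (subst jacobi_poly_expansion[of _ k A B]) simp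
  also have "\<dots> = (\<Sum>i\<le>k. if i = 0 then jacobi_row A B k i else 0)"
    by (intro sum.cong) (auto simp: KM_orthogonal)
  finally show ?thesis by simp
qed

end

section \<open>The moments of the MANOVA ensemble as functions of the beta variables\<close>

text \<open>
  A first-order Taylor expansion at \<open>p0\<close> whose remainder is quadratic, uniformly on the cube. The
  gradient D stays implicit: the theorem claims only that some variance exists, and closure under
  sums and products then yields the expansion of every moment.
\<close>

definition quadratic_approx :: "nat set \<Rightarrow> (nat \<Rightarrow> real) \<Rightarrow> ((nat \<Rightarrow> real) \<Rightarrow> real) \<Rightarrow> bool" where
  "quadratic_approx I p0 F \<longleftrightarrow> (\<exists>D C. \<forall>p. (\<forall>k\<in>I. 0 \<le> p k \<and> p k \<le> 1) \<longrightarrow>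
     \<bar>F p - F p0 - (\<Sum>k\<in>I. D k * (p k - p0 k))\<bar> \<le> C * (\<Sum>k\<in>I. (p k - p0 k)\<^sup>2))"

lemma quadratic_approx_cong:
  assumes "quadratic_approx I p0 F" and "\<And>k. k \<in> I \<Longrightarrow> 0 \<le> p0 k \<and> p0 k \<le> 1"
    and "\<And>p. (\<And>k. k \<in> I \<Longrightarrow> 0 \<le> p k \<and> p k \<le> 1) \<Longrightarrow> G p = F p"
  shows "quadratic_approx I p0 G"
proof -
  have p0: "G p0 = F p0" using assms(2) by (intro assms(3)) auto
  obtain D C where F: "\<And>p. (\<forall>k\<in>I. 0 \<le> p k \<and> p k \<le> 1) \<Longrightarrow>
     \<bar>F p - F p0 - (\<Sum>k\<in>I. D k * (p k - p0 k))\<bar> \<le> C * (\<Sum>k\<in>I. (p k - p0 k)\<^sup>2)"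
    using assms(1) unfolding quadratic_approx_def by blast
  show ?thesis unfolding quadratic_approx_def
  proof (intro exI[of _ D] exI[of _ C] allI impI)
    fix p :: "nat \<Rightarrow> real" assume p: "\<forall>k\<in>I. 0 \<le> p k \<and> p k \<le> 1"
    then have "G p = F p" by (intro assms(3)) auto
    then show "\<bar>G p - G p0 - (\<Sum>k\<in>I. D k * (p k - p0 k))\<bar> \<le> C * (\<Sum>k\<in>I. (p k - p0 k)\<^sup>2)"
      using F[OF p] p0 by simp
  qed
qed

lemma quadratic_approx_const: "quadratic_approx I p0 (\<lambda>_. c)"
  unfolding quadratic_approx_def by (intro exI[of _ "\<lambda>_. 0"] exI[of _ 0]) simp

lemma quadratic_approx_coordinate:
  assumes "finite I" "k \<in> I" shows "quadratic_approx I p0 (\<lambda>p. p k)"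
  unfolding quadratic_approx_def
proof (intro exI[of _ "\<lambda>j. if j = k then 1 else 0"] exI[of _ 0] allI impI)
  fix p :: "nat \<Rightarrow> real"
  have "(\<Sum>j\<in>I. (if j = k then 1 else 0) * (p j - p0 j)) = (\<Sum>j\<in>I. if j = k then p j - p0 j else 0)"
    by (intro sum.cong) auto
  then show "\<bar>p k - p0 k - (\<Sum>j\<in>I. (if j = k then 1 else 0) * (p j - p0 j))\<bar> \<le> 0 * (\<Sum>k\<in>I. (p k - p0
      k)\<^sup>2)"
    using assms by simp
qed

lemma quadratic_approx_add:
  assumes "quadratic_approx I p0 F" "quadratic_approx I p0 G" shows "quadratic_approx I p0 (\<lambda>p. F p
      + G p)"
proof -
  obtain D C where F: "\<And>p. (\<forall>k\<in>I. 0 \<le> p k \<and> p k \<le> 1) \<Longrightarrow>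
     \<bar>F p - F p0 - (\<Sum>k\<in>I. D k * (p k - p0 k))\<bar> \<le> C * (\<Sum>k\<in>I. (p k - p0 k)\<^sup>2)"
    using assms(1) unfolding quadratic_approx_def by blast
  obtain E C' where G: "\<And>p. (\<forall>k\<in>I. 0 \<le> p k \<and> p k \<le> 1) \<Longrightarrow>
     \<bar>G p - G p0 - (\<Sum>k\<in>I. E k * (p k - p0 k))\<bar> \<le> C' * (\<Sum>k\<in>I. (p k - p0 k)\<^sup>2)"
    using assms(2) unfolding quadratic_approx_def by blast
  show ?thesis unfolding quadratic_approx_def
  proof (intro exI[of _ "\<lambda>k. D k + E k"] exI[of _ "C + C'"] allI impI)
    fix p :: "nat \<Rightarrow> real" assume p: "\<forall>k\<in>I. 0 \<le> p k \<and> p k \<le> 1"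
    show "\<bar>F p + G p - (F p0 + G p0) - (\<Sum>k\<in>I. (D k + E k) * (p k - p0 k))\<bar>
        \<le> (C + C') * (\<Sum>k\<in>I. (p k - p0 k)\<^sup>2)"
      using F[OF p] G[OF p] unfolding distrib_right sum.distrib by linarith
  qed
qed

text \<open>
  Write \<open>F G - F\<^sub>0 G\<^sub>0 = F\<^sub>0 (G - G\<^sub>0) + G\<^sub>0 (F - F\<^sub>0) + (F - F\<^sub>0) (G - G\<^sub>0)\<close>. The factors of the
  last term are Lipschitz for the 1-norm T on the cube, where squares of coordinate differences
  are at most the differences themselves; and \<open>T\<^sup>2\<close> is at most \<open>card I\<close> times the sum of squares
  S.
\<close>

lemma quadratic_approx_mult:
  assumes "finite I" and p0: "\<And>k. k \<in> I \<Longrightarrow> 0 \<le> p0 k \<and> p0 k \<le> 1"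
    and "quadratic_approx I p0 F" "quadratic_approx I p0 G"
  shows "quadratic_approx I p0 (\<lambda>p. F p * G p)"
proof -
  define S where "S p = (\<Sum>k\<in>I. (p k - p0 k)\<^sup>2)" for p
  define T where "T p = (\<Sum>k\<in>I. \<bar>p k - p0 k\<bar>)" for p
  have ST: "S p \<le> T p" if p: "\<forall>k\<in>I. 0 \<le> p k \<and> p k \<le> 1" for p :: "nat \<Rightarrow> real"
    unfolding S_def T_def
  proof (rule sum_mono)
    fix k assume "k \<in> I"
    then have "\<bar>p k - p0 k\<bar> \<le> 1" using p p0[of k] by (auto simp: abs_le_iff)
    then have "\<bar>p k - p0 k\<bar> * \<bar>p k - p0 k\<bar> \<le> \<bar>p k - p0 k\<bar> * 1" by (intro mult_left_mono) auto
    then show "(p k - p0 k)\<^sup>2 \<le> \<bar>p k - p0 k\<bar>" by (simp add: power2_eq_square)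
  qed
  have TS: "(T p)\<^sup>2 \<le> real (card I) * S p" for p
    using sum_squared_le_sum_of_squares[of "\<lambda>k. \<bar>p k - p0 k\<bar>" I] \<open>finite I\<close>
    by (simp add: T_def S_def mult.commute)
  have Tnn: "T p \<ge> 0" and Snn: "S p \<ge> 0" for p by (simp_all add: T_def S_def sum_nonneg)
  have lip: "\<exists>L\<ge>0. \<forall>p. (\<forall>k\<in>I. 0 \<le> p k \<and> p k \<le> 1) \<longrightarrow> \<bar>F p - F p0\<bar> \<le> L * T p"
    if F: "\<And>p. (\<forall>k\<in>I. 0 \<le> p k \<and> p k \<le> 1) \<Longrightarrow>
       \<bar>F p - F p0 - (\<Sum>k\<in>I. D k * (p k - p0 k))\<bar> \<le> C * S p" for F D C
  proof (intro exI[of _ "(\<Sum>k\<in>I. \<bar>D k\<bar>) + \<bar>C\<bar>"] conjI allI impI)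
    fix p :: "nat \<Rightarrow> real" assume p: "\<forall>k\<in>I. 0 \<le> p k \<and> p k \<le> 1"
    have "\<bar>\<Sum>k\<in>I. D k * (p k - p0 k)\<bar> \<le> (\<Sum>k\<in>I. \<bar>D k\<bar> * \<bar>p k - p0 k\<bar>)"
      by (rule order_trans[OF sum_abs]) (simp add: abs_mult)
    also have "\<dots> \<le> (\<Sum>k\<in>I. \<bar>D k\<bar> * T p)"
      unfolding T_def using \<open>finite I\<close> by (intro sum_mono mult_left_mono member_le_sum) auto
    finally have 1: "\<bar>\<Sum>k\<in>I. D k * (p k - p0 k)\<bar> \<le> (\<Sum>k\<in>I. \<bar>D k\<bar>) * T p"
      by (simp add: sum_distrib_right)
    have "C * S p \<le> \<bar>C\<bar> * S p" by (intro mult_right_mono Snn abs_ge_self)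
    also have "\<dots> \<le> \<bar>C\<bar> * T p" using ST[OF p] by (intro mult_left_mono) auto
    finally have "C * S p \<le> \<bar>C\<bar> * T p" .
    with 1 F[OF p] show "\<bar>F p - F p0\<bar> \<le> ((\<Sum>k\<in>I. \<bar>D k\<bar>) + \<bar>C\<bar>) * T p"
      unfolding distrib_right by linarith
  qed (simp add: sum_nonneg)
  obtain D C where F: "\<And>p. (\<forall>k\<in>I. 0 \<le> p k \<and> p k \<le> 1) \<Longrightarrow>
     \<bar>F p - F p0 - (\<Sum>k\<in>I. D k * (p k - p0 k))\<bar> \<le> C * S p"
    using assms(3) unfolding quadratic_approx_def S_def by blast
  obtain E C' where G: "\<And>p. (\<forall>k\<in>I. 0 \<le> p k \<and> p k \<le> 1) \<Longrightarrow>
     \<bar>G p - G p0 - (\<Sum>k\<in>I. E k * (p k - p0 k))\<bar> \<le> C' * S p"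
    using assms(4) unfolding quadratic_approx_def S_def by blast
  obtain L where L: "L \<ge> 0" "\<And>p. (\<forall>k\<in>I. 0 \<le> p k \<and> p k \<le> 1) \<Longrightarrow> \<bar>F p - F p0\<bar> \<le> L * T p"
    using lip[OF F] by blast
  obtain L' where L': "L' \<ge> 0" "\<And>p. (\<forall>k\<in>I. 0 \<le> p k \<and> p k \<le> 1) \<Longrightarrow> \<bar>G p - G p0\<bar> \<le> L' * T p"
    using lip[OF G] by blast
  show ?thesis unfolding quadratic_approx_def S_def[symmetric]
  proof (intro exI[of _ "\<lambda>k. F p0 * E k + G p0 * D k"]
      exI[of _ "\<bar>F p0\<bar> * C' + \<bar>G p0\<bar> * C + L * L' * real (card I)"] allI impI)
    fix p :: "nat \<Rightarrow> real" assume p: "\<forall>k\<in>I. 0 \<le> p k \<and> p k \<le> 1"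
    define f g where "f = F p - F p0 - (\<Sum>k\<in>I. D k * (p k - p0 k))"
      and "g = G p - G p0 - (\<Sum>k\<in>I. E k * (p k - p0 k))"
    have "(\<Sum>k\<in>I. (F p0 * E k + G p0 * D k) * (p k - p0 k))
        = F p0 * (\<Sum>k\<in>I. E k * (p k - p0 k)) + G p0 * (\<Sum>k\<in>I. D k * (p k - p0 k))"
      by (simp add: algebra_simps sum.distrib sum_distrib_left sum_subtractf)
    then have eq: "F p * G p - F p0 * G p0 - (\<Sum>k\<in>I. (F p0 * E k + G p0 * D k) * (p k - p0 k))
        = F p0 * g + G p0 * f + (F p - F p0) * (G p - G p0)"
      by (simp add: f_def g_def algebra_simps)
    have 1: "\<bar>F p0 * g\<bar> \<le> \<bar>F p0\<bar> * (C' * S p)"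
      unfolding abs_mult g_def by (intro mult_left_mono G p) auto
    have 2: "\<bar>G p0 * f\<bar> \<le> \<bar>G p0\<bar> * (C * S p)"
      unfolding abs_mult f_def by (intro mult_left_mono F p) auto
    have "\<bar>(F p - F p0) * (G p - G p0)\<bar> \<le> (L * T p) * (L' * T p)"
      unfolding abs_mult by (intro mult_mono L L' p mult_nonneg_nonneg Tnn) auto
    also have "\<dots> = L * L' * (T p)\<^sup>2" by (simp add: power2_eq_square)
    also have "\<dots> \<le> L * L' * (real (card I) * S p)"
      using L L' by (intro mult_left_mono TS) auto
    finally have 3: "\<bar>(F p - F p0) * (G p - G p0)\<bar> \<le> L * L' * (real (card I) * S p)" .
    show "\<bar>F p * G p - F p0 * G p0 - (\<Sum>k\<in>I. (F p0 * E k + G p0 * D k) * (p k - p0 k))\<bar>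
        \<le> (\<bar>F p0\<bar> * C' + \<bar>G p0\<bar> * C + L * L' * real (card I)) * S p"
      unfolding eq using 1 2 3 unfolding distrib_right mult.assoc by linarith
  qed
qed

lemma quadratic_approx_sum:
  "(\<And>k. k \<in> K \<Longrightarrow> quadratic_approx I p0 (f k)) \<Longrightarrow> quadratic_approx I p0 (\<lambda>p. \<Sum>k\<in>K. f k p)"
  by (induction K rule: infinite_finite_induct) (auto simp: quadratic_approx_const intro!:
      quadratic_approx_add)

definition manova_A :: "(nat \<Rightarrow> real) \<Rightarrow> nat \<Rightarrow> real" where
  "manova_A p i = manova_diag p (int i + 1)"
text \<open>
  The square of the off-diagonal entry equals the radicand only where the radicand is nonnegative.
  The square itself is nonnegative everywhere, so the matrix has a spectral measure for every p.
\<close>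

definition manova_B :: "(nat \<Rightarrow> real) \<Rightarrow> nat \<Rightarrow> real" where
  "manova_B p i = (manova_offdiag p (int i + 1))\<^sup>2"
definition manova_moment :: "(nat \<Rightarrow> real) \<Rightarrow> nat \<Rightarrow> real" where
  "manova_moment p k = jacobi_row (manova_A p) (manova_B p) k 0"

lemma pext_box:
  assumes "\<And>k. k \<ge> 1 \<Longrightarrow> int k \<le> j \<Longrightarrow> 0 \<le> p k \<and> p k \<le> (1::real)"
  shows "0 \<le> pext p j" "pext p j \<le> 1"
  using assms[of "nat j"] by (auto simp: pext_def)

lemma manova_B_eq:
  assumes "\<And>k. k \<ge> 1 \<Longrightarrow> k \<le> 2 * i + 2 \<Longrightarrow> 0 \<le> p k \<and> p k \<le> (1::real)"
  shows "manova_B p i = pext p (2 * int i + 1) * (1 - pext p (2 * int i)) * pext p (2 * int i + 2) *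
      (1 - pext p (2 * int i + 1))"
proof -
  have "0 \<le> pext p j \<and> pext p j \<le> 1" if "j \<le> 2 * int i + 2" for j
    using assms that by (intro conjI pext_box) auto
  moreover have "2 * (int i + 1) - 1 = 2 * int i + 1" "2 * (int i + 1) - 2 = 2 * int i"
    "2 * (int i + 1) = 2 * int i + 2" by simp_all
  ultimately show ?thesis unfolding manova_B_def manova_offdiag_def
    by (simp only: real_sqrt_pow2 mult_nonneg_nonneg diff_ge_0_iff_ge)
qed

lemma manova_A_eq:
  "manova_A p i = pext p (2 * int i) * (1 - pext p (2 * int i - 1)) + pext p (2 * int i + 1) * (1 -
      pext p (2 * int i))"
proof -
  have "2 * (int i + 1) - 1 = 2 * int i + 1" "2 * (int i + 1) - 2 = 2 * int i"
    "2 * (int i + 1) - 3 = 2 * int i - 1" by simp_all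
  then show ?thesis by (simp only: manova_A_def manova_diag_def)
qed

lemma manova_jacobi_cong:
  assumes "\<And>k. k \<in> {1..2 * n - 1} \<Longrightarrow> p k = q k"
  shows "manova_jacobi n p = manova_jacobi n q"
proof -
  have *: "pext p j = pext q j" if "j \<le> 2 * int n - 1" for j
  proof (cases "j \<le> 0")
    case False
    then have "nat j \<in> {1..2 * n - 1}" using that by auto
    then show ?thesis using assms by (simp add: pext_def)
  qed (simp add: pext_def)
  have "manova_diag p (int i + 1) = manova_diag q (int i + 1)" if "i < n" for i
    using that by (simp add: manova_diag_def *)
  moreover have "manova_offdiag p (int i + 1) = manova_offdiag q (int i + 1)" if "i + 1 < n" for i
    using that by (simp add: manova_offdiag_def *)
  ultimately show ?thesis unfolding manova_jacobi_def by (intro cong_mat) auto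
qed

lemma manova_spectral_measure:
  fixes n p
  assumes n: "n \<ge> 1"
  defines "\<mu> \<equiv> spectral_measure (manova_jacobi n p)"
  shows "prob_space \<mu>" "sets \<mu> = sets borel" "integrable \<mu> (\<lambda>x. x ^ k)"
    and "k < n \<Longrightarrow> (\<integral>x. x ^ k \<partial>\<mu>) = manova_moment p k"
    and "(\<And>k. k \<in> {1..2 * n - 1} \<Longrightarrow> 0 \<le> p k \<and> p k \<le> 1) \<Longrightarrow> AE x in \<mu>. \<bar>x\<bar> \<le> 4"
proof -
  note S = spectral_measure_jacobi_mat[OF n, of "\<lambda>i. manova_diag p (int i + 1)" "\<lambda>i. manova_offdiag
      p (int i + 1)",
      folded manova_jacobi_eq, folded \<mu>_def]
  show 1: "prob_space \<mu>" "sets \<mu> = sets borel" "integrable \<mu> (\<lambda>x. x ^ k)" for k by (rule S)+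
  show "(\<integral>x. x ^ k \<partial>\<mu>) = manova_moment p k" if "k < n"
    unfolding S(4) manova_moment_def using that
    by (intro jacobi_row_cong) (auto simp: manova_A_def manova_B_def)
  assume p: "\<And>k. k \<in> {1..2 * n - 1} \<Longrightarrow> 0 \<le> p k \<and> p k \<le> 1"
  \<comment> \<open>The matrix does not see the values of p beyond 2n - 1; replacing them by 0 puts the whole
    sequence into the cube, and the uniform bound on the recursion applies.\<close>
  define q where "q k = (if k \<in> {1..2 * n - 1} then p k else 0)" for k
  have q: "0 \<le> q k \<and> q k \<le> 1" for k using p by (auto simp: q_def)
  have \<mu>q: "\<mu> = spectral_measure (manova_jacobi n q)"
    unfolding \<mu>_def by (rule arg_cong[OF manova_jacobi_cong]) (auto simp: q_def)
  have pq: "0 \<le> pext q j" "pext q j \<le> 1" "0 \<le> 1 - pext q j" "1 - pext q j \<le> 1" for j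
    using pext_box[of j q] q by auto
  have A: "\<bar>manova_A q i\<bar> \<le> 2" for i
  proof -
    have *: "0 \<le> pext q j * (1 - pext q l)" "pext q j * (1 - pext q l) \<le> 1" for j l
      using pq by (auto intro: mult_le_one)
    then have "0 \<le> manova_A q i" "manova_A q i \<le> 1 + 1"
      unfolding manova_A_eq using *[of "2 * int i" "2 * int i - 1"] *[of "2 * int i + 1" "2 * int i"]
      by linarith+
    then show ?thesis by simp
  qed
  have B: "\<bar>manova_B q i\<bar> \<le> 1" for i
    using pq q by (subst manova_B_eq) (auto intro!: mult_le_one mult_nonneg_nonneg)
  show "AE x in \<mu>. \<bar>x\<bar> \<le> 4"
  proof (rule AE_abs_le_of_moment_bound)
    fix k
    show "\<bar>\<integral>x. x ^ k \<partial>\<mu>\<bar> \<le> 4 ^ k"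
      unfolding \<mu>q manova_jacobi_eq spectral_measure_jacobi_mat(4)[OF n]
      using A B by (intro jacobi_row_bound) (auto simp: manova_A_def manova_B_def)
  qed (use 1 in auto)
qed

lemma quadratic_approx_jacobi_row:
  assumes p0: "\<And>k. k \<in> {1..N} \<Longrightarrow> 0 \<le> p0 k \<and> p0 k \<le> 1" and "2 * (i + k) + 1 \<le> N"
  shows "quadratic_approx {1..N} p0 (\<lambda>p. jacobi_row (manova_A p) (manova_B p) k i)"
proof -
  note mult = quadratic_approx_mult[OF finite_atLeastAtMost p0]
  have ext: "quadratic_approx {1..N} p0 (\<lambda>p. pext p j)" if "j \<le> int N" for j
  proof (cases "j \<le> 0")
    case True
    then show ?thesis by (simp add: pext_def quadratic_approx_const)
  next
    case False
    then have "quadratic_approx {1..N} p0 (\<lambda>p. p (nat j))" using that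
        by (intro quadratic_approx_coordinate) auto
    then show ?thesis using False by (simp add: pext_def)
  qed
  have ext1: "quadratic_approx {1..N} p0 (\<lambda>p. 1 - pext p j)" if "j \<le> int N" for j
  proof -
    have "quadratic_approx {1..N} p0 (\<lambda>p. 1 + (-1) * pext p j)"
      by (intro quadratic_approx_add mult quadratic_approx_const ext that)
    then show ?thesis by simp
  qed
  have A: "quadratic_approx {1..N} p0 (\<lambda>p. manova_A p i)" if "2 * i + 1 \<le> N" for i
    unfolding manova_A_eq using that by (intro quadratic_approx_add mult ext ext1) auto
  have B: "quadratic_approx {1..N} p0 (\<lambda>p. manova_B p i)" if "2 * i + 2 \<le> N" for i
  proof (rule quadratic_approx_cong[OF _ p0])
    show "quadratic_approx {1..N} p0 (\<lambda>p. pext p (2 * int i + 1) * (1 - pext p (2 * int i)) * pext p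
        (2 * int i + 2) * (1 - pext p (2 * int i + 1)))"
      using that by (intro mult ext ext1) auto
    show "manova_B p i = pext p (2 * int i + 1) * (1 - pext p (2 * int i)) * pext p (2 * int i + 2)
        * (1 - pext p (2 * int i + 1))"
      if "\<And>k. k \<in> {1..N} \<Longrightarrow> 0 \<le> p k \<and> p k \<le> 1" for p
      using that \<open>2 * i + 2 \<le> N\<close> by (intro manova_B_eq) auto
  qed
  show ?thesis using assms(2)
  proof (induction k arbitrary: i)
    case 0
    then show ?case by (simp add: quadratic_approx_const)
  next
    case (Suc k)
    have prev: "quadratic_approx {1..N} p0 (\<lambda>p. if i = 0 then 0 else jacobi_row (manova_A p)
        (manova_B p) k (i - 1))"
      using Suc.IH[of "i - 1"] Suc.prems by (cases "i = 0") (auto simp: quadratic_approx_const)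
    show ?case unfolding jacobi_row.simps
      by (rule quadratic_approx_add[OF quadratic_approx_add[OF mult[OF _ A Suc.IH] prev] mult[OF _ B
          Suc.IH]])
        (use Suc.prems in auto)
  qed
qed

lemma measurable_jacobi_row:
  assumes X: "\<And>k. 1 \<le> k \<Longrightarrow> k \<le> 2 * (i + k') + 1 \<Longrightarrow> X k \<in> borel_measurable M"
  shows "(\<lambda>\<omega>. jacobi_row (manova_A (\<lambda>k. X k \<omega>)) (manova_B (\<lambda>k. X k \<omega>)) k' i) \<in> borel_measurable M"
proof -
  define N where "N = 2 * (i + k') + 1"
  have ext: "(\<lambda>\<omega>. pext (\<lambda>k. X k \<omega>) j) \<in> borel_measurable M" if "j \<le> int N" for j
  proof (cases "j \<le> 0")
    case False
    then have "1 \<le> nat j" "nat j \<le> 2 * (i + k') + 1" using that by (auto simp: N_def)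
    then show ?thesis using X False by (simp add: pext_def)
  qed (simp add: pext_def)
  have A: "(\<lambda>\<omega>. manova_A (\<lambda>k. X k \<omega>) i) \<in> borel_measurable M" if "2 * i + 1 \<le> N" for i
    unfolding manova_A_eq using that
    by (intro borel_measurable_add borel_measurable_times borel_measurable_diff
        borel_measurable_const ext) auto
  have B: "(\<lambda>\<omega>. manova_B (\<lambda>k. X k \<omega>) i) \<in> borel_measurable M" if "2 * i + 2 \<le> N" for i
  proof -
    have [measurable]: "(\<lambda>\<omega>. pext (\<lambda>k. X k \<omega>) (2 * (int i + 1) - 1)) \<in> borel_measurable M"
      "(\<lambda>\<omega>. pext (\<lambda>k. X k \<omega>) (2 * (int i + 1) - 2)) \<in> borel_measurable M"
      "(\<lambda>\<omega>. pext (\<lambda>k. X k \<omega>) (2 * (int i + 1))) \<in> borel_measurable M"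
      using that by (intro ext; simp)+
    show ?thesis unfolding manova_B_def manova_offdiag_def by measurable
  qed
  have "2 * (i + k') + 1 \<le> N" by (simp add: N_def)
  then show ?thesis
  proof (induction k' arbitrary: i)
    case (Suc k)
    have prev: "(\<lambda>\<omega>. if i = 0 then 0 else jacobi_row (manova_A (\<lambda>k. X k \<omega>)) (manova_B (\<lambda>k. X k \<omega>)) k
        (i - 1)) \<in> borel_measurable M"
      using Suc.IH[of "i - 1"] Suc.prems by (cases "i = 0") auto
    show ?case unfolding jacobi_row.simps
      by (rule borel_measurable_add[OF borel_measurable_add[OF borel_measurable_times[OF A Suc.IH] prev]
            borel_measurable_times[OF B Suc.IH]]) (use Suc.prems in auto)
  qed simp
qed

lemma tendsto_manova_moment:
  assumes p: "\<And>k. k \<ge> 1 \<Longrightarrow> (\<lambda>n. p n k) \<longlonglongrightarrow> p0 k"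
  shows "(\<lambda>n. manova_moment (p n) k) \<longlonglongrightarrow> manova_moment p0 k"
proof -
  have ext: "(\<lambda>n. pext (p n) j) \<longlonglongrightarrow> pext p0 j" for j
    using p[of "nat j"] by (cases "j \<le> 0") (auto simp: pext_def)
  have A: "(\<lambda>n. manova_A (p n) i) \<longlonglongrightarrow> manova_A p0 i" for i
    unfolding manova_A_eq by (intro tendsto_intros ext)
  have B: "(\<lambda>n. manova_B (p n) i) \<longlonglongrightarrow> manova_B p0 i" for i
    unfolding manova_B_def manova_offdiag_def by (intro tendsto_intros ext)
  have "(\<lambda>n. jacobi_row (manova_A (p n)) (manova_B (p n)) k i) \<longlonglongrightarrow> jacobi_row (manova_A p0) (manova_B
      p0) k i" for i
  proof (induction k arbitrary: i)
    case (Suc k)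
    show ?case by (cases "i = 0") (auto intro!: tendsto_intros A B Suc)
  qed simp
  then show ?thesis by (simp add: manova_moment_def)
qed

definition km_point :: "real \<Rightarrow> real \<Rightarrow> nat \<Rightarrow> real" where
  "km_point ka kb k = (if even k then km_even ka kb else km_odd ka kb)"

lemma kesten_mckay_moment:
  assumes "ka \<ge> 0" "kb \<ge> 0"
  shows "prob_space (kesten_mckay ka kb)" "sets (kesten_mckay ka kb) = sets borel"
    and "AE x in kesten_mckay ka kb. \<bar>x\<bar> \<le> 1"
    and "integrable (kesten_mckay ka kb) (\<lambda>x. x ^ k)"
    and "(\<integral>x. x ^ k \<partial>kesten_mckay ka kb) = manova_moment (km_point ka kb) k"
    and "0 \<le> km_point ka kb k \<and> km_point ka kb k \<le> 1"
proof -
  interpret kesten_mckay_parameters ka kb "km_odd ka kb" "km_even ka kb" "u_minus ka kb" "u_plus ka kb"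
    "km_odd ka kb * (1 - km_even ka kb) + km_even ka kb * (1 - km_odd ka kb)"
    "sqrt (km_odd ka kb * (1 - km_even ka kb) * (km_even ka kb * (1 - km_odd ka kb)))"
    by unfold_locales (use assms in auto)
  show "prob_space KM" "sets KM = sets borel" "AE x in KM. \<bar>x\<bar> \<le> 1"
    by (rule prob_space_KM sets_KM AE_KM)+
  show "integrable KM (\<lambda>x. x ^ k)" by (rule integrable_KM) (intro continuous_intros)
  show box: "0 \<le> km_point ka kb k \<and> km_point ka kb k \<le> 1" for k
    using po_pe by (auto simp: km_point_def)
  have ext: "pext (km_point ka kb) j = (if j \<le> 0 then 0 else if even j then km_even ka kb else
      km_odd ka kb)" for j
    by (auto simp: pext_def km_point_def even_nat_iff)
  have "manova_A (km_point ka kb) i = A i" for i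
    by (auto simp: manova_A_eq ext A_def)
  moreover have "manova_B (km_point ka kb) i = B i" for i
    using box d_sq by (subst manova_B_eq) (auto simp: ext B_def)
  ultimately have "manova_A (km_point ka kb) = A" "manova_B (km_point ka kb) = B" by auto
  then show "(\<integral>x. x ^ k \<partial>KM) = manova_moment (km_point ka kb) k"
      by (simp add: KM_moment manova_moment_def)
qed

section \<open>Beta variables with large parameters\<close>

text \<open>
  The logarithm h of a beta density, up to a constant, has its maximum at m. The Lagrange form of
  the remainder serves both for a Gaussian bound and for the limit after rescaling.
\<close>

lemma beta_log_taylor:
  fixes P Q t :: real
  assumes P: "P > 0" and Q: "Q > 0" and t: "0 < t" "t < 1"
  defines "h \<equiv> \<lambda>s. P * ln s + Q * ln (1 - s)" and "m \<equiv> P / (P + Q)"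
  obtains \<xi> where "0 < \<xi>" "\<xi> < 1" "\<bar>\<xi> - m\<bar> \<le> \<bar>t - m\<bar>"
    "h t - h m = - (P / \<xi>\<^sup>2 + Q / (1 - \<xi>)\<^sup>2) / 2 * (t - m)\<^sup>2"
proof (cases "t = m")
  case True
  then show thesis using that[of m] t by simp
next
  case False
  have m: "0 < m" "m < 1" using P Q by (auto simp: m_def field_simps)
  define diff where "diff k s = (if k = 0 then h s else if k = 1 then P / s - Q / (1 - s)
      else - (P / s\<^sup>2 + Q / (1 - s)\<^sup>2))" for k :: nat and s
  have d0: "(h has_real_derivative P / s - Q / (1 - s)) (at s)" if "0 < s" "s < 1" for s
    unfolding h_def using that by (auto intro!: derivative_eq_intros)
  have d1: "((\<lambda>s. P / s - Q / (1 - s)) has_real_derivative - (P / s\<^sup>2 + Q / (1 - s)\<^sup>2)) (at s)"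
    if "0 < s" "s < 1" for s
    using that by (auto intro!: derivative_eq_intros simp: power2_eq_square)
  have "\<exists>\<xi>. (if t < m then t < \<xi> \<and> \<xi> < m else m < \<xi> \<and> \<xi> < t) \<and>
      h t = (\<Sum>k<2. diff k m / fact k * (t - m) ^ k) + diff 2 \<xi> / fact 2 * (t - m) ^ 2"
  proof (rule Taylor[of 2 diff h "min t m" "max t m" m t])
    show "\<forall>(k::nat) s. k < 2 \<and> min t m \<le> s \<and> s \<le> max t m \<longrightarrow> DERIV (diff k) s :> diff (Suc k) s"
    proof (intro allI impI)
      fix k :: nat and s assume *: "k < 2 \<and> min t m \<le> s \<and> s \<le> max t m"
      then have s: "0 < s" "s < 1" using t m by (auto simp: min_def max_def split: if_splits)
      from * consider "k = 0" | "k = 1" by linarith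
      then show "DERIV (diff k) s :> diff (Suc k) s"
        by cases (use d0[OF s] d1[OF s] in \<open>auto simp: diff_def[abs_def]\<close>)
    qed
  qed (use False in \<open>auto simp: diff_def\<close>)
  then obtain \<xi> where \<xi>: "if t < m then t < \<xi> \<and> \<xi> < m else m < \<xi> \<and> \<xi> < t"
    and eq: "h t = (\<Sum>k<2. diff k m / fact k * (t - m) ^ k) + diff 2 \<xi> / fact 2 * (t - m) ^ 2"
    by blast
  have "P / m - Q / (1 - m) = 0" using P Q by (simp add: m_def field_simps)
  then have "h t - h m = - (P / \<xi>\<^sup>2 + Q / (1 - \<xi>)\<^sup>2) / 2 * (t - m)\<^sup>2"
    using eq by (simp add: diff_def numeral_2_eq_2)
  moreover have "0 < \<xi>" "\<xi> < 1" "\<bar>\<xi> - m\<bar> \<le> \<bar>t - m\<bar>"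
    using \<xi> t m by (auto split: if_splits)
  ultimately show thesis using that by blast
qed

text \<open>
  The beta density with exponents P and Q divided by its value at the mode \<open>P / (P + Q)\<close>. In a
  quotient of two integrals the normalising constant cancels, so that this function can replace
  the density.
\<close>

definition beta_profile :: "real \<Rightarrow> real \<Rightarrow> real \<Rightarrow> real" where
  "beta_profile P Q t = indicator {0<..<1} t *
     exp ((P * ln t + Q * ln (1 - t)) - (P * ln (P / (P + Q)) + Q * ln (1 - P / (P + Q))))"

lemma beta_profile_measurable [measurable]: "beta_profile P Q \<in> borel_measurable borel"
  unfolding beta_profile_def[abs_def] by measurable

lemma beta_profile_nonneg [simp]: "beta_profile P Q t \<ge> 0"
  by (simp add: beta_profile_def)

text \<open>
  The second derivative of the log-density is at most \<open>- (P + Q)\<close> throughout the unit interval.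
\<close>

lemma beta_profile_le_gaussian:
  assumes "P > 0" "Q > 0"
  shows "beta_profile P Q t \<le> exp (- (P + Q) / 2 * (t - P / (P + Q))\<^sup>2)"
proof (cases "t \<in> {0<..<1}")
  case True
  then obtain \<xi> where \<xi>: "0 < \<xi>" "\<xi> < 1"
    and eq: "(P * ln t + Q * ln (1 - t)) - (P * ln (P / (P + Q)) + Q * ln (1 - P / (P + Q)))
      = - (P / \<xi>\<^sup>2 + Q / (1 - \<xi>)\<^sup>2) / 2 * (t - P / (P + Q))\<^sup>2"
    using beta_log_taylor[OF assms, of t] by auto
  have "P \<le> P / \<xi>\<^sup>2" "Q \<le> Q / (1 - \<xi>)\<^sup>2"
    using assms \<xi> by (auto simp: pos_le_divide_eq power_le_one mult_left_le)
  moreover have "- (a + b) / 2 \<le> - (P + Q) / 2" if "P \<le> a" "Q \<le> b" for a b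
    using that by simp
  ultimately have "- (P / \<xi>\<^sup>2 + Q / (1 - \<xi>)\<^sup>2) / 2 * (t - P / (P + Q))\<^sup>2 \<le> - (P + Q) / 2 * (t - P /
      (P + Q))\<^sup>2"
    by (intro mult_right_mono zero_le_power2) blast
  then show ?thesis using True by (simp add: beta_profile_def eq)
qed (simp add: beta_profile_def)

lemma beta_density_eq_profile:
  "beta_density x y t = exp ((x - 1) * ln ((x - 1) / (x - 1 + (y - 1))) + (y - 1) * ln (1 - (x - 1)
      / (x - 1 + (y - 1))))
     / Beta x y * beta_profile (x - 1) (y - 1) t"
  by (auto simp: beta_density_def beta_profile_def indicator_def powr_def exp_diff exp_add)

text \<open>
  The second derivative of the log-density at the mode, divided by \<open>r\<^sup>2\<close>, tends to \<open>- (A + B)\<^sup>3 /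
  (A B)\<close>; the intermediate point of the Taylor formula tends to the limit of the mode.
\<close>

lemma beta_profile_tendsto:
  fixes P Q r :: "nat \<Rightarrow> real"
  assumes PQ: "\<And>n. P n > 0" "\<And>n. Q n > 0" and r: "\<And>n. r n > 0" "filterlim r at_top sequentially"
    and A: "(\<lambda>n. P n / (r n)\<^sup>2) \<longlonglongrightarrow> A" "A > 0" and B: "(\<lambda>n. Q n / (r n)\<^sup>2) \<longlonglongrightarrow> B" "B > 0"
  shows "(\<lambda>n. beta_profile (P n) (Q n) (P n / (P n + Q n) + s / r n))
           \<longlonglongrightarrow> exp (- s\<^sup>2 / (2 * (A * B / (A + B) ^ 3)))"
proof -
  define m where "m n = P n / (P n + Q n)" for n
  define M where "M = A / (A + B)"
  have M: "0 < M" "M < 1" using A B by (auto simp: M_def)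
  have s0: "(\<lambda>n. s / r n) \<longlonglongrightarrow> 0"
    by (rule real_tendsto_divide_at_top[OF tendsto_const r(2)])
  have "(\<lambda>n. (P n / (r n)\<^sup>2) / (P n / (r n)\<^sup>2 + Q n / (r n)\<^sup>2)) \<longlonglongrightarrow> M"
    unfolding M_def using A B by (intro tendsto_intros) auto
  moreover have "(P n / (r n)\<^sup>2) / (P n / (r n)\<^sup>2 + Q n / (r n)\<^sup>2) = m n" for n
    using r(1)[of n] by (simp add: m_def flip: add_divide_distrib)
  ultimately have m: "m \<longlonglongrightarrow> M" by simp
  have lim: "(\<lambda>n. m n + s / r n) \<longlonglongrightarrow> M" using tendsto_add[OF m s0] by simp
  have ev: "eventually (\<lambda>n. 0 < m n + s / r n \<and> m n + s / r n < 1) sequentially"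
    using order_tendstoD[OF lim] M by (intro eventually_conj) auto
  have "\<forall>n. \<exists>\<xi>. \<bar>\<xi> - m n\<bar> \<le> \<bar>s / r n\<bar> \<and> (0 < m n + s / r n \<and> m n + s / r n < 1 \<longrightarrow>
      beta_profile (P n) (Q n) (m n + s / r n) =
      exp (- (P n / \<xi>\<^sup>2 + Q n / (1 - \<xi>)\<^sup>2) / 2 * (s / r n)\<^sup>2))"
  proof
    fix n
    show "\<exists>\<xi>. \<bar>\<xi> - m n\<bar> \<le> \<bar>s / r n\<bar> \<and> (0 < m n + s / r n \<and> m n + s / r n < 1 \<longrightarrow>
      beta_profile (P n) (Q n) (m n + s / r n) =
      exp (- (P n / \<xi>\<^sup>2 + Q n / (1 - \<xi>)\<^sup>2) / 2 * (s / r n)\<^sup>2))"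
    proof (cases "0 < m n + s / r n \<and> m n + s / r n < 1")
      case True
      then obtain \<xi> where "\<bar>\<xi> - m n\<bar> \<le> \<bar>m n + s / r n - m n\<bar>"
        and "(P n * ln (m n + s / r n) + Q n * ln (1 - (m n + s / r n))) - (P n * ln (m n) + Q n *
            ln (1 - m n))
          = - (P n / \<xi>\<^sup>2 + Q n / (1 - \<xi>)\<^sup>2) / 2 * (m n + s / r n - m n)\<^sup>2"
        using beta_log_taylor[OF PQ, of "m n + s / r n" n] unfolding m_def by metis
      then show ?thesis using True by (intro exI[of _ \<xi>]) (simp add: beta_profile_def m_def)
    qed (auto intro!: exI[of _ "m n"])
  qed
  then obtain \<xi> where \<xi>: "\<And>n. \<bar>\<xi> n - m n\<bar> \<le> \<bar>s / r n\<bar>"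
    and eq: "\<And>n. 0 < m n + s / r n \<and> m n + s / r n < 1 \<Longrightarrow>
      beta_profile (P n) (Q n) (m n + s / r n) =
      exp (- (P n / (\<xi> n)\<^sup>2 + Q n / (1 - \<xi> n)\<^sup>2) / 2 * (s / r n)\<^sup>2)"
    by metis
  have "(\<lambda>n. \<xi> n - m n) \<longlonglongrightarrow> 0"
    by (rule Lim_null_comparison[OF _ tendsto_rabs_zero[OF s0]]) (use \<xi> in auto)
  from tendsto_add[OF this m] have \<xi>M: "\<xi> \<longlonglongrightarrow> M" by simp
  have "(\<lambda>n. exp (- (P n / (r n)\<^sup>2 / (\<xi> n)\<^sup>2 + Q n / (r n)\<^sup>2 / (1 - \<xi> n)\<^sup>2) / 2 * s\<^sup>2))
      \<longlonglongrightarrow> exp (- (A / M\<^sup>2 + B / (1 - M)\<^sup>2) / 2 * s\<^sup>2)"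
    using M by (intro tendsto_intros A B \<xi>M) auto
  also have "A / M\<^sup>2 + B / (1 - M)\<^sup>2 = (A + B) ^ 3 / (A * B)"
  proof -
    have "A + B > 0" "1 - M = B / (A + B)" using A B by (auto simp: M_def field_simps)
    then show ?thesis using A B
      by (simp add: M_def power_divide power2_eq_square power3_eq_cube divide_simps) (simp add:
          algebra_simps)
  qed
  also have "- ((A + B) ^ 3 / (A * B)) / 2 * s\<^sup>2 = - s\<^sup>2 / (2 * (A * B / (A + B) ^ 3))"
    by (simp add: field_simps)
  finally have "(\<lambda>n. exp (- (P n / (\<xi> n)\<^sup>2 + Q n / (1 - \<xi> n)\<^sup>2) / 2 * (s / r n)\<^sup>2))
      \<longlonglongrightarrow> exp (- s\<^sup>2 / (2 * (A * B / (A + B) ^ 3)))"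
    by (rule Lim_transform_eventually)
      (auto simp: power_divide add_divide_distrib algebra_simps)
  then show ?thesis unfolding m_def[symmetric]
    by (rule Lim_transform_eventually) (use ev eq in \<open>auto elim: eventually_mono\<close>)
qed

lemma integrable_quartic_gaussian:
  assumes c: "c > 0"
  shows "integrable lborel (\<lambda>s::real. (1 + s ^ 4) * exp (- c * s\<^sup>2))"
proof -
  define \<sigma> where "\<sigma> = sqrt (1 / (2 * c))"
  have \<sigma>: "\<sigma> > 0" "2 * \<sigma>\<^sup>2 = 1 / c" using c by (auto simp: \<sigma>_def)
  have "integrable lborel (\<lambda>s. sqrt (2 * pi * \<sigma>\<^sup>2) *
      (normal_density 0 \<sigma> s * (s - 0) ^ 0 + normal_density 0 \<sigma> s * (s - 0) ^ 4))"
    using \<sigma> by (intro integrable_mult_right Bochner_Integration.integrable_add integrable_normal_moment)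
  also have "(\<lambda>s. sqrt (2 * pi * \<sigma>\<^sup>2) *
      (normal_density 0 \<sigma> s * (s - 0) ^ 0 + normal_density 0 \<sigma> s * (s - 0) ^ 4))
      = (\<lambda>s. (1 + s ^ 4) * exp (- c * s\<^sup>2))"
    using \<sigma> c by (simp add: normal_density_def fun_eq_iff \<sigma>(2) field_simps)
  finally show ?thesis .
qed

text \<open>
  The constant factor between the density and the profile is found by integrating the function 1.
\<close>

lemma beta_rescaled_integral:
  fixes \<phi> :: "real \<Rightarrow> 'b::{banach, second_countable_topology}"
  assumes prob: "prob_space (density lborel (\<lambda>t. ennreal (beta_density x y t)))"
    and xy: "x > 1" "y > 1" and r: "r > 0" and [measurable]: "\<phi> \<in> borel_measurable borel"
  defines "m \<equiv> (x - 1) / (x - 1 + (y - 1))"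
  defines "g \<equiv> \<lambda>s. beta_profile (x - 1) (y - 1) (m + s / r)"
  shows "(\<integral>s. g s \<partial>lborel) > 0"
    and "(\<integral>t. \<phi> (r * (t - m)) \<partial>density lborel (\<lambda>t. ennreal (beta_density x y t)))
      = (\<integral>s. g s *\<^sub>R \<phi> s \<partial>lborel) /\<^sub>R (\<integral>s. g s \<partial>lborel)"
proof -
  define K where "K = exp ((x - 1) * ln m + (y - 1) * ln (1 - m)) / Beta x y"
  have dens: "beta_density x y t = K * beta_profile (x - 1) (y - 1) t" for t
    unfolding beta_density_eq_profile K_def m_def by simp
  have Kpos: "K \<ge> 0" using xy by (simp add: K_def Beta_def Gamma_real_pos less_imp_le)
  have [measurable]: "beta_density x y \<in> borel_measurable borel"
    unfolding dens[abs_def] by measurable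
  have *: "(\<integral>t. \<psi> (r * (t - m)) \<partial>density lborel (\<lambda>t. ennreal (beta_density x y t)))
      = (K / r) *\<^sub>R (\<integral>s. g s *\<^sub>R \<psi> s \<partial>lborel)"
    if [measurable]: "\<psi> \<in> borel_measurable borel"
        for \<psi> :: "real \<Rightarrow> 'c::{banach, second_countable_topology}"
  proof -
    have "(\<integral>t. \<psi> (r * (t - m)) \<partial>density lborel (\<lambda>t. ennreal (beta_density x y t)))
      = (\<integral>t. beta_density x y t *\<^sub>R \<psi> (r * (t - m)) \<partial>lborel)"
      using Kpos by (subst integral_density) (auto simp: dens)
    also have "\<dots> = \<bar>1 / r\<bar> *\<^sub>R (\<integral>s. beta_density x y (m + 1 / r * s) *\<^sub>R \<psi> (r * (m + 1 / r * s - m))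
        \<partial>lborel)"
      using r by (intro lborel_integral_real_affine) auto
    also have "(\<lambda>s. beta_density x y (m + 1 / r * s) *\<^sub>R \<psi> (r * (m + 1 / r * s - m)))
        = (\<lambda>s. K *\<^sub>R (g s *\<^sub>R \<psi> s))"
      using r by (simp add: dens g_def)
    finally show ?thesis using r by (simp only: integral_scaleR_right) simp
  qed
  have one: "(K / r) * (\<integral>s. g s \<partial>lborel) = 1"
  proof -
    interpret D: prob_space "density lborel (\<lambda>t. ennreal (beta_density x y t))" by (rule prob)
    have "(K / r) *\<^sub>R (\<integral>s. g s *\<^sub>R (1::real) \<partial>lborel) = 1"
      unfolding *[of "\<lambda>_. 1::real", OF borel_measurable_const, symmetric]
      by (simp only: lebesgue_integral_const D.prob_space scaleR_one)
    then show ?thesis by (simp only: real_scaleR_def mult_1_right)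
  qed
  have "(\<integral>s. g s \<partial>lborel) \<ge> 0" by (simp add: g_def)
  then show pos: "(\<integral>s. g s \<partial>lborel) > 0" using one by (cases "(\<integral>s. g s \<partial>lborel) = 0") auto
  have "K / r = inverse (\<integral>s. g s \<partial>lborel)" using one
      by (subst inverse_unique[of _ "K / r"]) (simp_all only: mult.commute)
  then show "(\<integral>t. \<phi> (r * (t - m)) \<partial>density lborel (\<lambda>t. ennreal (beta_density x y t)))
      = (\<integral>s. g s *\<^sub>R \<phi> s \<partial>lborel) /\<^sub>R (\<integral>s. g s \<partial>lborel)"
    by (simp add: *)
qed

text \<open>
  Dominated convergence in numerator and denominator of \<open>beta_rescaled_integral\<close>. Test functions
  of quartic growth are admitted, so that characteristic functions, second moments and fourth
  moments are all covered.
\<close>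

lemma beta_central_limit:
  fixes x y r :: "nat \<Rightarrow> real" and \<phi> :: "real \<Rightarrow> 'b::{banach, second_countable_topology}"
  assumes prob: "\<And>n. prob_space (density lborel (\<lambda>t. ennreal (beta_density (x n) (y n) t)))"
    and r: "filterlim r at_top sequentially"
    and A: "(\<lambda>n. x n / (r n)\<^sup>2) \<longlonglongrightarrow> A" "A > 0" and B: "(\<lambda>n. y n / (r n)\<^sup>2) \<longlonglongrightarrow> B" "B > 0"
    and [measurable]: "\<phi> \<in> borel_measurable borel" and \<phi>: "\<And>s. norm (\<phi> s) \<le> 1 + s ^ 4"
  shows "(\<lambda>n. \<integral>t. \<phi> (r n * (t - (x n - 1) / (x n - 1 + (y n - 1))))
             \<partial>density lborel (\<lambda>t. ennreal (beta_density (x n) (y n) t)))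
           \<longlonglongrightarrow> (\<integral>s. \<phi> s \<partial>density lborel (\<lambda>s. ennreal (normal_density 0 (sqrt (A * B / (A + B) ^ 3)) s)))"
proof -
  define \<tau> where "\<tau> = A * B / (A + B) ^ 3"
  have \<tau>: "\<tau> > 0" using A B by (simp add: \<tau>_def)
  \<comment> \<open>Half of the curvature \<open>(A + B) / 2\<close> that the Gaussian bound has in the limit leaves room
    for finite n.\<close>
  define c where "c = (A + B) / 4"
  have c: "c > 0" using A B by (simp add: c_def)
  have r2: "(\<lambda>n. 1 / (r n)\<^sup>2) \<longlonglongrightarrow> 0"
    by (intro real_tendsto_divide_at_top[OF tendsto_const] filterlim_pow_at_top r) auto
  have A': "(\<lambda>n. (x n - 1) / (r n)\<^sup>2) \<longlonglongrightarrow> A" and B': "(\<lambda>n. (y n - 1) / (r n)\<^sup>2) \<longlonglongrightarrow> B"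
    using tendsto_diff[OF A(1) r2] tendsto_diff[OF B(1) r2] by (simp_all add: diff_divide_distrib)
  have "eventually (\<lambda>n. r n > 0) sequentially" using r by (simp add: filterlim_at_top_dense)
  moreover have "eventually (\<lambda>n. (x n - 1) / (r n)\<^sup>2 > 0) sequentially"
    using order_tendstoD(1)[OF A'] A(2) .
  moreover have "eventually (\<lambda>n. (y n - 1) / (r n)\<^sup>2 > 0) sequentially"
    using order_tendstoD(1)[OF B'] B(2) .
  moreover have "eventually (\<lambda>n. (x n - 1) / (r n)\<^sup>2 + (y n - 1) / (r n)\<^sup>2 > 2 * c) sequentially"
    by (rule order_tendstoD(1)[OF tendsto_add[OF A' B']]) (use A B in \<open>simp add: c_def\<close>)
  ultimately have "eventually (\<lambda>n. r n > 0 \<and> x n > 1 \<and> y n > 1 \<and> x n - 1 + (y n - 1) > 2 * c * (r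
      n)\<^sup>2) sequentially"
    by eventually_elim (auto simp: zero_less_divide_iff pos_less_divide_eq simp flip:
        add_divide_distrib)
  then obtain N where N: "\<And>n. n \<ge> N \<Longrightarrow> r n > 0 \<and> x n > 1 \<and> y n > 1 \<and> x n - 1 + (y n - 1) > 2 * c * (r
      n)\<^sup>2"
    by (auto simp: eventually_sequentially)
  \<comment> \<open>From N on, all conditions on the parameters hold; the sequences are shifted by N.\<close>
  define P Q \<rho> where "P n = x (n + N) - 1" and "Q n = y (n + N) - 1" and "\<rho> n = r (n + N)" for n
  have PQ: "P n > 0" "Q n > 0" "\<rho> n > 0" "P n + Q n > 2 * c * (\<rho> n)\<^sup>2" for n
    using N[of "n + N"] by (auto simp: P_def Q_def \<rho>_def)
  define g where "g n s = beta_profile (P n) (Q n) (P n / (P n + Q n) + s / \<rho> n)" for n s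
  define w where "w s = exp (- s\<^sup>2 / (2 * \<tau>))" for s
  have [measurable]: "g n \<in> borel_measurable borel" for n unfolding g_def[abs_def] by measurable
  have [measurable]: "w \<in> borel_measurable borel" unfolding w_def[abs_def] by measurable
  have glim: "(\<lambda>n. g n s) \<longlonglongrightarrow> w s" for s
    unfolding g_def w_def \<tau>_def
  proof (rule beta_profile_tendsto)
    show "filterlim \<rho> at_top sequentially" unfolding \<rho>_def
      by (rule filterlim_compose[OF r]) (rule filterlim_add_const_nat_at_top)
    show "(\<lambda>n. P n / (\<rho> n)\<^sup>2) \<longlonglongrightarrow> A" "(\<lambda>n. Q n / (\<rho> n)\<^sup>2) \<longlonglongrightarrow> B"
      unfolding P_def Q_def \<rho>_def
      by (rule LIMSEQ_ignore_initial_segment[OF A'] LIMSEQ_ignore_initial_segment[OF B'])+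
  qed (use PQ A B in auto)
  have gbd: "g n s \<le> exp (- c * s\<^sup>2)" for n s
  proof -
    have "g n s \<le> exp (- (P n + Q n) / 2 * (s / \<rho> n)\<^sup>2)"
      unfolding g_def using beta_profile_le_gaussian[OF PQ(1,2), of n n "P n / (P n + Q n) + s / \<rho>
          n"] by simp
    also have "- (P n + Q n) / 2 * (s / \<rho> n)\<^sup>2 \<le> - (2 * c * (\<rho> n)\<^sup>2) / 2 * (s / \<rho> n)\<^sup>2"
      using PQ(4)[of n] by (intro mult_right_mono divide_right_mono) auto
    also have "\<dots> = - c * s\<^sup>2" using PQ(3)[of n] by (simp add: power_divide)
    finally show ?thesis by simp
  qed
  have gnn: "0 \<le> g n s" for n s by (simp add: g_def)
  have lim: "(\<lambda>n. \<integral>s. g n s *\<^sub>R \<psi> s \<partial>lborel) \<longlonglongrightarrow> (\<integral>s. w s *\<^sub>R \<psi> s \<partial>lborel)"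
    if [measurable]: "\<psi> \<in> borel_measurable borel" and \<psi>: "\<And>s. norm (\<psi> s) \<le> 1 + s ^ 4"
    for \<psi> :: "real \<Rightarrow> 'c::{banach, second_countable_topology}"
  proof (rule integral_dominated_convergence[OF _ _ integrable_quartic_gaussian[OF c]])
    show "AE s in lborel. (\<lambda>n. g n s *\<^sub>R \<psi> s) \<longlonglongrightarrow> w s *\<^sub>R \<psi> s"
      by (intro AE_I2 tendsto_intros glim)
    show "AE s in lborel. norm (g n s *\<^sub>R \<psi> s) \<le> (1 + s ^ 4) * exp (- c * s\<^sup>2)" for n
    proof (rule AE_I2)
      fix s
      have "g n s * norm (\<psi> s) \<le> exp (- c * s\<^sup>2) * (1 + s ^ 4)"
        by (intro mult_mono gbd \<psi> gnn) auto
      then show "norm (g n s *\<^sub>R \<psi> s) \<le> (1 + s ^ 4) * exp (- c * s\<^sup>2)"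
        using gnn by (simp add: mult.commute)
    qed
  qed auto
  have w_eq: "w s = sqrt (2 * pi * \<tau>) * normal_density 0 (sqrt \<tau>) s" for s
    using \<tau> by (simp add: w_def normal_density_def)
  have wint: "(\<integral>s. w s \<partial>lborel) = sqrt (2 * pi * \<tau>)"
    using \<tau> by (simp add: w_eq)
  have "(\<lambda>n. (\<integral>s. g n s *\<^sub>R \<phi> s \<partial>lborel) /\<^sub>R (\<integral>s. g n s *\<^sub>R (1::real) \<partial>lborel))
      \<longlonglongrightarrow> (\<integral>s. w s *\<^sub>R \<phi> s \<partial>lborel) /\<^sub>R (\<integral>s. w s *\<^sub>R (1::real) \<partial>lborel)"
    by (intro tendsto_intros lim \<phi>) (use wint \<tau> in auto)
  also have "(\<integral>s. w s *\<^sub>R \<phi> s \<partial>lborel) /\<^sub>R (\<integral>s. w s *\<^sub>R (1::real) \<partial>lborel)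
      = (\<integral>s. \<phi> s \<partial>density lborel (\<lambda>s. ennreal (normal_density 0 (sqrt \<tau>) s)))"
  proof -
    have "(\<integral>s. w s *\<^sub>R \<phi> s \<partial>lborel) = sqrt (2 * pi * \<tau>) *\<^sub>R (\<integral>s. normal_density 0 (sqrt \<tau>) s *\<^sub>R \<phi> s
        \<partial>lborel)"
      unfolding w_eq scaleR_scaleR[symmetric] by (rule integral_scaleR_right)
    then show ?thesis using \<tau> by (simp add: wint integral_density)
  qed
  finally have "(\<lambda>n. \<integral>t. \<phi> (r (n + N) * (t - (x (n + N) - 1) / (x (n + N) - 1 + (y (n + N) - 1))))
             \<partial>density lborel (\<lambda>t. ennreal (beta_density (x (n + N)) (y (n + N)) t)))
      \<longlonglongrightarrow> (\<integral>s. \<phi> s \<partial>density lborel (\<lambda>s. ennreal (normal_density 0 (sqrt \<tau>) s)))"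
    using N by (subst beta_rescaled_integral(2)[OF prob]) (auto simp: g_def P_def Q_def \<rho>_def)
  then show ?thesis unfolding \<tau>_def by (rule LIMSEQ_offset)
qed

lemma char_centered_normal:
  assumes "v \<ge> 0"
  shows "char (centered_normal v) t = of_real (exp (- v * t\<^sup>2 / 2))"
proof (cases "v = 0")
  case True
  then show ?thesis by (simp add: centered_normal_def char_def integral_return)
next
  case False
  define \<sigma> where "\<sigma> = sqrt v"
  have \<sigma>: "\<sigma> > 0" "\<sigma>\<^sup>2 = v" using assms False by (auto simp: \<sigma>_def)
  have nd: "normal_density 0 \<sigma> (0 + \<sigma> * s) = std_normal_density s / \<sigma>" for s
    using \<sigma> False by (simp add: normal_density_def real_sqrt_mult power_mult_distrib) (simp add: \<sigma>_def)
  have "char (centered_normal v) t = (\<integral>x. normal_density 0 \<sigma> x *\<^sub>R iexp (t * x) \<partial>lborel)"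
    using False \<sigma> by (simp add: centered_normal_def char_def integral_density \<sigma>_def)
  also have "\<dots> = \<bar>\<sigma>\<bar> *\<^sub>R (\<integral>s. normal_density 0 \<sigma> (0 + \<sigma> * s) *\<^sub>R iexp (t * (0 + \<sigma> * s)) \<partial>lborel)"
    using \<sigma> by (intro lborel_integral_real_affine) auto
  also have "\<dots> = (\<integral>s. \<bar>\<sigma>\<bar> *\<^sub>R (normal_density 0 \<sigma> (0 + \<sigma> * s) *\<^sub>R iexp (t * (0 + \<sigma> * s))) \<partial>lborel)"
    by (rule integral_scaleR_right[symmetric])
  also have "\<dots> = (\<integral>s. std_normal_density s *\<^sub>R iexp ((t * \<sigma>) * s) \<partial>lborel)"
    using \<sigma> unfolding nd by (intro Bochner_Integration.integral_cong) (auto simp: mult.assoc)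
  also have "\<dots> = char std_normal_distribution (t * \<sigma>)"
    by (simp add: char_def integral_density)
  also have "\<dots> = of_real (exp (- v * t\<^sup>2 / 2))"
    by (simp add: char_std_normal_distribution power_mult_distrib \<sigma> mult.commute)
  finally show ?thesis .
qed

lemma real_distribution_centered_normal:
  assumes "v \<ge> 0" shows "real_distribution (centered_normal v)"
proof (cases "v = 0")
  case True
  then show ?thesis
    by (auto simp: centered_normal_def real_distribution_def real_distribution_axioms_def intro!:
        prob_space_return)
next
  case False
  then show ?thesis using assms prob_space_normal_density[of "sqrt v" 0]
    by (auto simp: centered_normal_def real_distribution_def real_distribution_axioms_def)
qed

lemma sqrt_linear_at_top: "\<gamma> > 0 \<Longrightarrow> filterlim (\<lambda>n. sqrt (real n * \<gamma>)) at_top sequentially"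
  by (rule filterlim_compose[OF sqrt_at_top])
     (auto intro: filterlim_at_top_mult_tendsto_pos[OF tendsto_const _ filterlim_real_sequentially])

text \<open>
  The mode and the limit \<open>A / (A + B)\<close> differ by less than the scale \<open>1 / r\<close> of the fluctuations.
  This is where the error terms of order \<open>o(sqrt n)\<close> in the parameters are needed.
\<close>

lemma beta_mode_limit:
  fixes x y r :: "nat \<Rightarrow> real"
  assumes r: "filterlim r at_top sequentially" and AB: "A > 0" "B > 0"
    and x: "(\<lambda>n. (x n - A * (r n)\<^sup>2) / r n) \<longlonglongrightarrow> 0"
    and y: "(\<lambda>n. (y n - B * (r n)\<^sup>2) / r n) \<longlonglongrightarrow> 0"
  shows "(\<lambda>n. x n / (r n)\<^sup>2) \<longlonglongrightarrow> A" "(\<lambda>n. y n / (r n)\<^sup>2) \<longlonglongrightarrow> B"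
    and "(\<lambda>n. r n * ((x n - 1) / (x n - 1 + (y n - 1)) - A / (A + B))) \<longlonglongrightarrow> 0"
proof -
  have rpos: "eventually (\<lambda>n. r n > 0) sequentially" using r by (simp add: filterlim_at_top_dense)
  have ratio: "(\<lambda>n. z n / (r n)\<^sup>2) \<longlonglongrightarrow> c" if "(\<lambda>n. (z n - c * (r n)\<^sup>2) / r n) \<longlonglongrightarrow> 0" for z c
  proof -
    have "(\<lambda>n. (z n - c * (r n)\<^sup>2) / r n / r n + c) \<longlonglongrightarrow> 0 + c"
      by (intro tendsto_add tendsto_const real_tendsto_divide_at_top[OF that r])
    moreover have "eventually (\<lambda>n. (z n - c * (r n)\<^sup>2) / r n / r n + c = z n / (r n)\<^sup>2) sequentially"
      using rpos by eventually_elim (simp add: field_simps power2_eq_square)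
    ultimately show ?thesis by (simp add: tendsto_cong)
  qed
  show X: "(\<lambda>n. x n / (r n)\<^sup>2) \<longlonglongrightarrow> A" and Y: "(\<lambda>n. y n / (r n)\<^sup>2) \<longlonglongrightarrow> B"
    by (rule ratio[OF x] ratio[OF y])+
  have r1: "(\<lambda>n. 1 / r n) \<longlonglongrightarrow> 0" by (rule real_tendsto_divide_at_top[OF tendsto_const r])
  have r2: "(\<lambda>n. 1 / (r n)\<^sup>2) \<longlonglongrightarrow> 0"
    by (intro real_tendsto_divide_at_top[OF tendsto_const] filterlim_pow_at_top r) auto
  define den where "den n = x n / (r n)\<^sup>2 - 1 / (r n)\<^sup>2 + (y n / (r n)\<^sup>2 - 1 / (r n)\<^sup>2)" for n
  have den: "den \<longlonglongrightarrow> A - 0 + (B - 0)" unfolding den_def[abs_def] by (intro tendsto_intros X Y r2)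
  have "eventually (\<lambda>n. den n > 0) sequentially" using order_tendstoD(1)[OF den, of 0] AB by simp
  with rpos have "eventually (\<lambda>n.
      (B * ((x n - A * (r n)\<^sup>2) / r n - 1 / r n) - A * ((y n - B * (r n)\<^sup>2) / r n - 1 / r n)) / ((A
          + B) * den n)
      = r n * ((x n - 1) / (x n - 1 + (y n - 1)) - A / (A + B))) sequentially"
  proof eventually_elim
    case (elim n)
    define s where "s = x n - 1 + (y n - 1)"
    have ds: "den n = s / (r n)\<^sup>2" by (simp add: den_def s_def diff_divide_distrib add_divide_distrib)
    have s: "s > 0" using elim by (simp add: ds zero_less_divide_iff)
    have "B * ((x n - A * (r n)\<^sup>2) / r n - 1 / r n) - A * ((y n - B * (r n)\<^sup>2) / r n - 1 / r n)
        = (B * (x n - 1) - A * (y n - 1)) / r n"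
      using elim by (simp add: field_simps)
    moreover have "(x n - 1) / s - A / (A + B) = (B * (x n - 1) - A * (y n - 1)) / (s * (A + B))"
      using s AB by (simp add: field_simps) (simp add: s_def algebra_simps)
    moreover have "W / r n / ((A + B) * (s / (r n)\<^sup>2)) = r n * (W / (s * (A + B)))" for W
      using elim s AB by (simp add: divide_simps power2_eq_square)
    ultimately show ?case unfolding s_def[symmetric] ds by (simp only:)
  qed
  moreover have "(\<lambda>n. (B * ((x n - A * (r n)\<^sup>2) / r n - 1 / r n) - A * ((y n - B * (r n)\<^sup>2) / r n -
      1 / r n))
      / ((A + B) * den n)) \<longlonglongrightarrow> (B * (0 - 0) - A * (0 - 0)) / ((A + B) * (A - 0 + (B - 0)))"
    by (intro tendsto_intros x y r1 den) (use AB in auto)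
  ultimately show "(\<lambda>n. r n * ((x n - 1) / (x n - 1 + (y n - 1)) - A / (A + B))) \<longlonglongrightarrow> 0"
    by (simp add: tendsto_cong)
qed

text \<open>
  One beta variable for each n, with parameters \<open>A n \<gamma>\<close> and \<open>B n \<gamma>\<close> up to \<open>o(sqrt n)\<close>. The joint
  distribution for different n is arbitrary.
\<close>

locale scaled_beta_variables = prob_space M for M :: "'w measure" +
  fixes X :: "nat \<Rightarrow> 'w \<Rightarrow> real" and x y :: "nat \<Rightarrow> real" and n0 :: nat and A B \<gamma> :: real
  assumes distributed: "\<And>n. n \<ge> n0 \<Longrightarrow> distributed M lborel (X n) (\<lambda>t. ennreal (beta_density (x n) (y
      n) t))"
    and AB: "A > 0" "B > 0" and \<gamma>: "\<gamma> > 0"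
    and x: "(\<lambda>n. (x n - A * (real n * \<gamma>)) / sqrt (real n * \<gamma>)) \<longlonglongrightarrow> 0"
    and y: "(\<lambda>n. (y n - B * (real n * \<gamma>)) / sqrt (real n * \<gamma>)) \<longlonglongrightarrow> 0"
begin

definition r where "r n = sqrt (real n * \<gamma>)" for n :: nat
definition m where "m n = (x n - 1) / (x n - 1 + (y n - 1))" for n
definition p0 where "p0 = A / (A + B)"
definition \<tau> where "\<tau> = A * B / (A + B) ^ 3"

lemma \<tau>_pos: "\<tau> > 0" using AB by (simp add: \<tau>_def)

lemma r_sq: "(r n)\<^sup>2 = real n * \<gamma>" using \<gamma> by (simp add: r_def)

lemma r_at_top: "filterlim r at_top sequentially"
  unfolding r_def using \<gamma> by (rule sqrt_linear_at_top)

lemmas mode_limit = beta_mode_limit[where r = r and x = x and y = y, OF r_at_top AB, unfolded r_sq,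
    unfolded r_def, OF x y, folded r_def]

lemma X_measurable: "n \<ge> n0 \<Longrightarrow> X n \<in> borel_measurable M"
  using distributed_measurable[OF distributed] by simp

lemma X_AE: "n \<ge> n0 \<Longrightarrow> AE \<omega> in M. 0 < X n \<omega> \<and> X n \<omega> < 1"
proof -
  assume n: "n \<ge> n0"
  have "AE t in density lborel (\<lambda>t. ennreal (beta_density (x n) (y n) t)). 0 < t \<and> t < 1"
    using distributed_borel_measurable[OF distributed[OF n]]
    by (subst AE_density) (auto simp: beta_density_def indicator_def split: if_splits)
  then show ?thesis
    unfolding distributed_distr_eq_density[OF distributed[OF n], symmetric]
    by (subst (asm) AE_distr_iff) (use X_measurable[OF n] in auto)
qed

lemma X_integrable:
  fixes \<phi> :: "real \<Rightarrow> real"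
  assumes n: "n \<ge> n0" and \<phi>: "continuous_on UNIV \<phi>"
  shows "integrable M (\<lambda>\<omega>. \<phi> (X n \<omega>))"
proof -
  have "bounded (\<phi> ` {0..1})"
    by (intro compact_imp_bounded compact_continuous_image continuous_on_subset[OF \<phi>]) auto
  then obtain K where K: "\<forall>y\<in>\<phi> ` {0..1}. norm y \<le> K" unfolding bounded_iff by blast
  have "(\<lambda>\<omega>. \<phi> (X n \<omega>)) \<in> borel_measurable M"
    using measurable_compose[OF X_measurable[OF n] borel_measurable_continuous_onI[OF \<phi>]] .
  moreover have "AE \<omega> in M. norm (\<phi> (X n \<omega>)) \<le> K"
    using X_AE[OF n] by eventually_elim (use K in auto)
  ultimately show ?thesis by (intro integrable_const_bound)
qed

lemma limit:
  fixes \<phi> :: "real \<Rightarrow> 'b::{banach, second_countable_topology}"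
  assumes [measurable]: "\<phi> \<in> borel_measurable borel" and \<phi>: "\<And>s. norm (\<phi> s) \<le> 1 + s ^ 4"
  shows "(\<lambda>n. \<integral>\<omega>. \<phi> (r n * (X n \<omega> - m n)) \<partial>M) \<longlonglongrightarrow> (\<integral>s. \<phi> s \<partial>centered_normal \<tau>)"
proof (rule LIMSEQ_offset[of _ n0])
  have "(\<lambda>n. \<integral>t. \<phi> (r (n + n0) * (t - (x (n + n0) - 1) / (x (n + n0) - 1 + (y (n + n0) - 1))))
           \<partial>density lborel (\<lambda>t. ennreal (beta_density (x (n + n0)) (y (n + n0)) t)))
         \<longlonglongrightarrow> (\<integral>s. \<phi> s \<partial>density lborel (\<lambda>s. ennreal (normal_density 0 (sqrt (A * B / (A + B) ^ 3)) s)))"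
  proof (rule beta_central_limit[OF _ _ _ AB(1) _ AB(2)])
    show "prob_space (density lborel (\<lambda>t. ennreal (beta_density (x (n + n0)) (y (n + n0)) t)))" for n
      using prob_space_distr[of "X (n + n0)" lborel] X_measurable[of "n + n0"]
      by (simp add: distributed_distr_eq_density[OF distributed[of "n + n0"], symmetric])
    show "filterlim (\<lambda>n. r (n + n0)) at_top sequentially"
      by (rule filterlim_compose[OF r_at_top]) (rule filterlim_add_const_nat_at_top)
    show "(\<lambda>n. x (n + n0) / (r (n + n0))\<^sup>2) \<longlonglongrightarrow> A" "(\<lambda>n. y (n + n0) / (r (n + n0))\<^sup>2) \<longlonglongrightarrow> B"
      unfolding r_sq using LIMSEQ_ignore_initial_segment[OF mode_limit(1)]
          LIMSEQ_ignore_initial_segment[OF mode_limit(2)]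
      by (simp_all add: r_sq)
  qed (use \<phi> in auto)
  moreover have "density lborel (\<lambda>s. ennreal (normal_density 0 (sqrt (A * B / (A + B) ^ 3)) s)) =
      centered_normal \<tau>"
    using \<tau>_pos unfolding \<tau>_def[symmetric] by (simp add: centered_normal_def)
  moreover have "(\<integral>t. \<phi> (r n * (t - (x n - 1) / (x n - 1 + (y n - 1))))
           \<partial>density lborel (\<lambda>t. ennreal (beta_density (x n) (y n) t))) = (\<integral>\<omega>. \<phi> (r n * (X n \<omega> - m
               n)) \<partial>M)"
    if n: "n \<ge> n0" for n
    unfolding distributed_distr_eq_density[OF distributed[OF n], symmetric] m_def
    by (subst integral_distr) (use X_measurable[OF n] in auto)
  ultimately show "(\<lambda>n. \<integral>\<omega>. \<phi> (r (n + n0) * (X (n + n0) \<omega> - m (n + n0))) \<partial>M) \<longlonglongrightarrow> (\<integral>s. \<phi> s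
      \<partial>centered_normal \<tau>)"
    by simp
qed

lemma char_limit:
  "(\<lambda>n. char (distr M borel (\<lambda>\<omega>. r n * (X n \<omega> - p0))) t) \<longlonglongrightarrow> of_real (exp (- \<tau> * t\<^sup>2 / 2))"
proof -
  have "(\<lambda>n. iexp (t * (r n * (m n - p0))) * (\<integral>\<omega>. iexp (t * (r n * (X n \<omega> - m n))) \<partial>M))
      \<longlonglongrightarrow> iexp (t * 0) * (\<integral>s. iexp (t * s) \<partial>centered_normal \<tau>)"
  proof (intro tendsto_mult limit[where \<phi> = "\<lambda>s. iexp (t * s)"])
    show "(\<lambda>n. iexp (t * (r n * (m n - p0)))) \<longlonglongrightarrow> iexp (t * 0)"
      using mode_limit(3) unfolding m_def p0_def by (intro tendsto_intros)
  qed auto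
  also have "iexp (t * 0) * (\<integral>s. iexp (t * s) \<partial>centered_normal \<tau>) = of_real (exp (- \<tau> * t\<^sup>2 / 2))"
    using char_centered_normal[of \<tau> t] \<tau>_pos by (simp add: char_def)
  finally show ?thesis
  proof (rule Lim_transform_eventually)
    show "eventually (\<lambda>n. iexp (t * (r n * (m n - p0))) * (\<integral>\<omega>. iexp (t * (r n * (X n \<omega> - m n))) \<partial>M)
        = char (distr M borel (\<lambda>\<omega>. r n * (X n \<omega> - p0))) t) sequentially"
      using eventually_ge_at_top[of n0]
    proof eventually_elim
      case (elim n)
      have [measurable]: "X n \<in> borel_measurable M" by (rule X_measurable[OF elim])
      have "char (distr M borel (\<lambda>\<omega>. r n * (X n \<omega> - p0))) t = (\<integral>\<omega>. iexp (t * (r n * (X n \<omega> - p0))) \<partial>M)"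
        unfolding char_def by (subst integral_distr) auto
      also have "\<dots> = (\<integral>\<omega>. iexp (t * (r n * (m n - p0))) * iexp (t * (r n * (X n \<omega> - m n))) \<partial>M)"
        by (intro Bochner_Integration.integral_cong) (auto simp: algebra_simps simp flip: exp_add)
      finally show ?case by simp
    qed
  qed
qed

lemma second_moment_bounded:
  "\<exists>K. eventually (\<lambda>n. expectation (\<lambda>\<omega>. (r n * (X n \<omega> - p0))\<^sup>2) \<le> K) sequentially"
proof -
  define L where "L = (\<integral>s. s\<^sup>2 \<partial>centered_normal \<tau>)"
  have "s\<^sup>2 \<le> 1 + s ^ 4" for s :: real
  proof -
    have "0 \<le> (s\<^sup>2 - 1)\<^sup>2 + s\<^sup>2" by simp
    also have "\<dots> = s ^ 4 + 1 - s\<^sup>2" by (simp add: power2_diff flip: power_mult)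
    finally show ?thesis by simp
  qed
  then have "(\<lambda>n. expectation (\<lambda>\<omega>. (r n * (X n \<omega> - m n))\<^sup>2)) \<longlonglongrightarrow> L"
    unfolding L_def by (intro limit) auto
  then have "(\<lambda>n. 2 * expectation (\<lambda>\<omega>. (r n * (X n \<omega> - m n))\<^sup>2) + 2 * (r n * (m n - p0))\<^sup>2) \<longlonglongrightarrow> 2 * L
      + 2 * 0\<^sup>2"
    using mode_limit(3) unfolding m_def p0_def by (intro tendsto_intros)
  then have "eventually (\<lambda>n. 2 * expectation (\<lambda>\<omega>. (r n * (X n \<omega> - m n))\<^sup>2) + 2 * (r n * (m n -
      p0))\<^sup>2 < 2 * L + 1) sequentially"
    by (rule order_tendstoD) simp
  with eventually_ge_at_top[of n0]
  have "eventually (\<lambda>n. expectation (\<lambda>\<omega>. (r n * (X n \<omega> - p0))\<^sup>2) \<le> 2 * L + 1) sequentially"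
  proof eventually_elim
    case (elim n)
    have i: "integrable M (\<lambda>\<omega>. (r n * (X n \<omega> - c))\<^sup>2)" for c
      by (rule X_integrable[OF elim(1), where \<phi> = "\<lambda>s. (r n * (s - c))\<^sup>2"]) (intro continuous_intros)
    have "expectation (\<lambda>\<omega>. (r n * (X n \<omega> - p0))\<^sup>2)
        \<le> expectation (\<lambda>\<omega>. 2 * (r n * (X n \<omega> - m n))\<^sup>2 + 2 * (r n * (m n - p0))\<^sup>2)"
    proof (intro integral_mono i Bochner_Integration.integrable_add integrable_mult_right
        integrable_const)
      fix \<omega>
      have "(u + v)\<^sup>2 \<le> 2 * u\<^sup>2 + 2 * v\<^sup>2" for u v :: real
        using zero_le_power2[of "u - v"] by (simp add: power2_sum power2_diff)
      from this[of "r n * (X n \<omega> - m n)" "r n * (m n - p0)"]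
      show "(r n * (X n \<omega> - p0))\<^sup>2 \<le> 2 * (r n * (X n \<omega> - m n))\<^sup>2 + 2 * (r n * (m n - p0))\<^sup>2"
        by (simp add: algebra_simps)
    qed
    also have "\<dots> = 2 * expectation (\<lambda>\<omega>. (r n * (X n \<omega> - m n))\<^sup>2) + 2 * (r n * (m n - p0))\<^sup>2"
      using i by (simp add: prob_space)
    finally show ?case using elim(2) by simp
  qed
  then show ?thesis by blast
qed

text \<open>
  The fourth central moments are \<open>O(1 / n\<^sup>2)\<close>, so the sum over n of the fourth powers of the
  deviations has finite expectation. Hence it is finite almost surely, and its terms tend to 0.
\<close>

lemma almost_sure_limit: "AE \<omega> in M. (\<lambda>n. X n \<omega>) \<longlonglongrightarrow> p0"
proof -
  define L where "L = (\<integral>s. s ^ 4 \<partial>centered_normal \<tau>)"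
  have "(\<lambda>n. expectation (\<lambda>\<omega>. (r n * (X n \<omega> - m n)) ^ 4)) \<longlonglongrightarrow> L"
    unfolding L_def by (intro limit) auto
  then have "eventually (\<lambda>n. expectation (\<lambda>\<omega>. (r n * (X n \<omega> - m n)) ^ 4) < L + 1) sequentially"
    by (rule order_tendstoD) simp
  then obtain N where N: "\<And>n. n \<ge> N \<Longrightarrow> expectation (\<lambda>\<omega>. (r n * (X n \<omega> - m n)) ^ 4) < L + 1"
    by (auto simp: eventually_sequentially)
  define N' where "N' = Suc (max N n0)"
  define f where "f n \<omega> = (X (n + N') \<omega> - m (n + N')) ^ 4" for n \<omega>
  have n0: "n + N' \<ge> n0" for n by (simp add: N'_def)
  have [measurable]: "X (n + N') \<in> borel_measurable M" for n by (rule X_measurable[OF n0])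
  have fm [measurable]: "f n \<in> borel_measurable M" for n unfolding f_def[abs_def] by measurable
  have fnn: "f n \<omega> \<ge> 0" for n \<omega> by (simp add: f_def)
  define g where "g n = (L + 1) / \<gamma>\<^sup>2 * inverse (real (n + N') ^ 2)" for n
  have fint: "(\<integral>\<^sup>+\<omega>. ennreal (f n \<omega>) \<partial>M) \<le> ennreal (g n)" for n
  proof -
    define k where "k = n + N'"
    have k: "k \<ge> N" "real k > 0" "k \<ge> n0" by (auto simp: k_def N'_def)
    have "(r k) ^ 4 = ((r k)\<^sup>2)\<^sup>2" by simp
    then have r4: "(r k) ^ 4 = (real k)\<^sup>2 * \<gamma>\<^sup>2" unfolding r_sq by (simp add: power_mult_distrib)
    have i: "integrable M (f n)"
      unfolding f_def[abs_def]
      by (rule X_integrable[OF n0, where \<phi> = "\<lambda>s. (s - m (n + N')) ^ 4"]) (intro continuous_intros)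
    have "expectation (\<lambda>\<omega>. (r k * (X k \<omega> - m k)) ^ 4) = (real k)\<^sup>2 * \<gamma>\<^sup>2 * expectation (f n)"
      by (simp add: power_mult_distrib r4 f_def[abs_def] k_def[symmetric])
    then have "(real k)\<^sup>2 * \<gamma>\<^sup>2 * expectation (f n) \<le> L + 1" using N[OF k(1)] by simp
    then have "expectation (f n) \<le> (L + 1) / ((real k)\<^sup>2 * \<gamma>\<^sup>2)"
      using k \<gamma> by (simp add: pos_le_divide_eq mult.commute)
    also have "\<dots> = g n" by (simp add: g_def k_def field_simps)
    finally show ?thesis using i fnn by (simp add: nn_integral_eq_integral ennreal_leI)
  qed
  have gnn: "g n \<ge> 0" for n
  proof -
    have "0 \<le> expectation (\<lambda>\<omega>. (r N * (X N \<omega> - m N)) ^ 4)" by simp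
    then have "L + 1 \<ge> 0" using N[of N] by linarith
    then show ?thesis by (simp add: g_def)
  qed
  have "summable (\<lambda>n. inverse (real n ^ 2))" by (rule inverse_power_summable) simp
  then have "summable (\<lambda>n. inverse (real (n + N') ^ 2))" by (subst summable_iff_shift)
  then have gs: "summable g" unfolding g_def by (rule summable_mult)
  have "(\<integral>\<^sup>+\<omega>. (\<Sum>n. ennreal (f n \<omega>)) \<partial>M) = (\<Sum>n. \<integral>\<^sup>+\<omega>. ennreal (f n \<omega>) \<partial>M)"
    by (rule nn_integral_suminf) measurable
  also have "\<dots> \<le> (\<Sum>n. ennreal (g n))" by (intro suminf_le fint) auto
  also have "\<dots> = ennreal (\<Sum>n. g n)" using gs gnn by (simp add: suminf_ennreal2)
  also have "\<dots> < \<infinity>" by simp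
  finally have "(\<integral>\<^sup>+\<omega>. (\<Sum>n. ennreal (f n \<omega>)) \<partial>M) \<noteq> \<infinity>" by simp
  then have "AE \<omega> in M. (\<Sum>n. ennreal (f n \<omega>)) \<noteq> \<infinity>" by (intro nn_integral_PInf_AE) auto
  then show ?thesis
  proof eventually_elim
    case (elim \<omega>)
    then have "summable (\<lambda>n. f n \<omega>)" using fnn by (intro summable_suminf_not_top) auto
    then have "(\<lambda>n. f n \<omega>) \<longlonglongrightarrow> 0" by (rule summable_LIMSEQ_zero)
    then have "(\<lambda>n. root 4 (f n \<omega>)) \<longlonglongrightarrow> root 4 0" by (rule tendsto_real_root)
    moreover have "root 4 (f n \<omega>) = \<bar>X (n + N') \<omega> - m (n + N')\<bar>" for n
    proof -
      have "f n \<omega> = \<bar>X (n + N') \<omega> - m (n + N')\<bar> ^ 4" by (simp add: f_def power_even_abs)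
      then show ?thesis by (simp only:) (rule real_root_power_cancel, auto)
    qed
    ultimately have "(\<lambda>n. X (n + N') \<omega> - m (n + N')) \<longlonglongrightarrow> 0" by (simp add: tendsto_rabs_zero_iff)
    then have 1: "(\<lambda>n. X n \<omega> - m n) \<longlonglongrightarrow> 0" by (rule LIMSEQ_offset)
    have "(\<lambda>n. (r n * (m n - p0)) / r n) \<longlonglongrightarrow> 0"
      using mode_limit(3) r_at_top unfolding m_def p0_def by (rule real_tendsto_divide_at_top)
    moreover have "eventually (\<lambda>n. r n > 0) sequentially" using r_at_top
        by (simp add: filterlim_at_top_dense)
    then have "eventually (\<lambda>n. (r n * (m n - p0)) / r n = m n - p0) sequentially"
      by eventually_elim simp
    ultimately have "(\<lambda>n. m n - p0) \<longlonglongrightarrow> 0" by (simp add: tendsto_cong)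
    from tendsto_add[OF 1 this] show ?case by (simp add: LIM_zero_iff)
  qed
qed

end

section \<open>The limit theorems\<close>

text \<open>
  This replaces Slutsky's theorem: variables that are close in mean have close characteristic
  functions.
\<close>

lemma (in prob_space) char_diff_bound:
  assumes [measurable]: "V \<in> borel_measurable M" "W \<in> borel_measurable M"
    and S: "integrable M S" "AE \<omega> in M. \<bar>V \<omega> - W \<omega>\<bar> \<le> S \<omega>"
  shows "norm (char (distr M borel V) t - char (distr M borel W) t) \<le> \<bar>t\<bar> * expectation S"
proof -
  have i: "integrable M (\<lambda>\<omega>. iexp (t * U \<omega>))" if [measurable]: "U \<in> borel_measurable M" for U
    by (rule integrable_const_bound[where B = 1]) auto
  have c: "char (distr M borel U) t = (\<integral>\<omega>. iexp (t * U \<omega>) \<partial>M)"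
      if [measurable]: "U \<in> borel_measurable M" for U
    unfolding char_def by (subst integral_distr) auto
  have "char (distr M borel V) t - char (distr M borel W) t = (\<integral>\<omega>. iexp (t * V \<omega>) - iexp (t * W \<omega>) \<partial>M)"
    using i assms(1,2) by (simp add: c)
  also have "norm \<dots> \<le> (\<integral>\<omega>. norm (iexp (t * V \<omega>) - iexp (t * W \<omega>)) \<partial>M)"
    by (rule integral_norm_bound)
  also have "\<dots> \<le> (\<integral>\<omega>. \<bar>t\<bar> * S \<omega> \<partial>M)"
  proof (rule integral_mono_AE)
    show "AE \<omega> in M. norm (iexp (t * V \<omega>) - iexp (t * W \<omega>)) \<le> \<bar>t\<bar> * S \<omega>"
      using S(2)
    proof eventually_elim
      case (elim \<omega>)
      have "iexp (t * V \<omega>) - iexp (t * W \<omega>) = iexp (t * W \<omega>) * (iexp (t * (V \<omega> - W \<omega>)) - 1)"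
        by (simp add: algebra_simps flip: exp_add)
      then have "norm (iexp (t * V \<omega>) - iexp (t * W \<omega>)) = norm (iexp (t * (V \<omega> - W \<omega>)) - 1)"
        by (simp add: norm_mult)
      also have "\<dots> \<le> \<bar>t * (V \<omega> - W \<omega>)\<bar>" using iexp_approx1[of "t * (V \<omega> - W \<omega>)" 0] by simp
      also have "\<dots> \<le> \<bar>t\<bar> * S \<omega>" using elim by (simp add: abs_mult mult_left_mono)
      finally show ?case .
    qed
  qed (use S(1) i assms(1,2) in auto)
  finally show ?thesis by simp
qed

lemma (in prob_space) char_weighted_sum:
  assumes "indep_vars (\<lambda>_. borel) Z I"
  shows "char (distr M borel (\<lambda>\<omega>. \<Sum>k\<in>I. D k * Z k \<omega>)) t = (\<Prod>k\<in>I. char (distr M borel (Z k)) (t * D k))"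
proof -
  have "indep_vars (\<lambda>_. borel) (\<lambda>k \<omega>. D k * Z k \<omega>) I"
    by (rule indep_vars_compose2[OF assms]) auto
  then have "char (distr M borel (\<lambda>\<omega>. \<Sum>k\<in>I. D k * Z k \<omega>)) t
      = (\<Prod>k\<in>I. char (distr M borel (\<lambda>\<omega>. D k * Z k \<omega>)) t)"
    by (rule char_distr_sum)
  also have "\<dots> = (\<Prod>k\<in>I. char (distr M borel (Z k)) (t * D k))"
  proof (rule prod.cong)
    fix k assume "k \<in> I"
    then have [measurable]: "Z k \<in> borel_measurable M" using assms by (auto simp: indep_vars_def)
    show "char (distr M borel (\<lambda>\<omega>. D k * Z k \<omega>)) t = char (distr M borel (Z k)) (t * D k)"
      unfolding char_def by (subst (1 2) integral_distr) (auto simp: mult.assoc)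
  qed simp
  finally show ?thesis .
qed

text \<open>
  For fixed k the parameters of the k-th variable are \<open>A n \<beta> / 2\<close> and \<open>B n \<beta> / 2\<close> up to \<open>o(sqrt
  n)\<close>, where A and B depend on the parity of k only.
\<close>

lemma manova_variable_limits:
  fixes p :: "nat \<Rightarrow> nat \<Rightarrow> 'w \<Rightarrow> real"
  assumes "prob_space M" and \<beta>: "\<beta> > 0" and \<kappa>: "\<kappa>a \<ge> 0" "\<kappa>b \<ge> 0"
    and a: "(\<lambda>n. a n - real n * \<beta> / 2 * \<kappa>a) \<in> o(\<lambda>n. sqrt (real n * \<beta>))"
    and b: "(\<lambda>n. b n - real n * \<beta> / 2 * \<kappa>b) \<in> o(\<lambda>n. sqrt (real n * \<beta>))"
    and p: "\<And>n. n \<ge> 1 \<Longrightarrow> manova_variables M n \<beta> (a n) (b n) (p n)"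
    and k: "k \<ge> 1"
  defines "r \<equiv> \<lambda>n. sqrt (real n * (\<beta> / 2))" and "q \<equiv> km_point \<kappa>a \<kappa>b k"
  shows "AE \<omega> in M. (\<lambda>n. p n k \<omega>) \<longlonglongrightarrow> q"
    and "\<exists>\<tau>\<ge>0. \<forall>t. (\<lambda>n. char (distr M borel (\<lambda>\<omega>. r n * (p n k \<omega> - q))) t) \<longlonglongrightarrow> of_real (exp (- \<tau> * t\<^sup>2
        / 2))"
    and "\<exists>K. eventually (\<lambda>n. (\<integral>\<omega>. (r n * (p n k \<omega> - q))\<^sup>2 \<partial>M) \<le> K) sequentially"
    and "n \<ge> 1 \<Longrightarrow> k \<le> 2 * n - 1 \<Longrightarrow> p n k \<in> borel_measurable M"
    and "n \<ge> 1 \<Longrightarrow> k \<le> 2 * n - 1 \<Longrightarrow> AE \<omega> in M. 0 < p n k \<omega> \<and> p n k \<omega> < 1"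
    and "n \<ge> 1 \<Longrightarrow> k \<le> 2 * n - 1 \<Longrightarrow> integrable M (\<lambda>\<omega>. (r n * (p n k \<omega> - q))\<^sup>2)"
proof -
  have half: "u / sqrt (real n * (\<beta> / 2)) = sqrt 2 * (u / sqrt (real n * \<beta>))" for u n
    by (simp add: real_sqrt_divide)
  have la: "(\<lambda>n. (a n - real n * (\<beta> / 2) * \<kappa>a) / r n) \<longlonglongrightarrow> 0"
    using tendsto_mult[OF tendsto_const[of "sqrt 2"] smalloD_tendsto[OF a]] unfolding r_def half by simp
  have lb: "(\<lambda>n. (b n - real n * (\<beta> / 2) * \<kappa>b) / r n) \<longlonglongrightarrow> 0"
    using tendsto_mult[OF tendsto_const[of "sqrt 2"] smalloD_tendsto[OF b]] unfolding r_def half by simp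
  have "filterlim r at_top sequentially"
    unfolding r_def using \<beta> by (intro sqrt_linear_at_top) simp
  then have lc: "(\<lambda>n. c / r n) \<longlonglongrightarrow> 0" for c
    by (rule real_tendsto_divide_at_top[OF tendsto_const])
  define A where "A = (if even k then 1 else 1 + \<kappa>a)"
  define B where "B = (if even k then 1 + \<kappa>a + \<kappa>b else 1 + \<kappa>b)"
  define x where "x n = manova_alpha1 n \<beta> (a n) (b n) k" for n
  define y where "y n = manova_alpha2 n \<beta> (a n) (b n) k" for n
  have x: "(\<lambda>n. (x n - A * (real n * (\<beta> / 2))) / r n) \<longlonglongrightarrow> 0"
  proof (cases "even k")
    case True
    then have "x n - A * (real n * (\<beta> / 2)) = - (real k * \<beta> / 4)" for n
      by (simp add: x_def A_def manova_alpha1_def field_simps)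
    then show ?thesis using lc[of "- (real k * \<beta> / 4)"] by (simp only:)
  next
    case False
    then have "x n - A * (real n * (\<beta> / 2)) = (1 - (real k + 1) * \<beta> / 4) + (a n - real n * (\<beta> / 2) *
        \<kappa>a)" for n
      by (simp add: x_def A_def manova_alpha1_def field_simps)
    then show ?thesis using tendsto_add[OF lc la] by (simp only: add_divide_distrib) simp
  qed
  have y: "(\<lambda>n. (y n - B * (real n * (\<beta> / 2))) / r n) \<longlonglongrightarrow> 0"
  proof (cases "even k")
    case True
    then have "y n - B * (real n * (\<beta> / 2)) = (2 - (real k + 2) * \<beta> / 4) + (a n - real n * (\<beta> / 2) * \<kappa>a)
        + (b n - real n * (\<beta> / 2) * \<kappa>b)" for n
      by (simp add: y_def B_def manova_alpha2_def field_simps)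
    then show ?thesis using tendsto_add[OF tendsto_add[OF lc la] lb]
        by (simp only: add_divide_distrib) simp
  next
    case False
    then have "y n - B * (real n * (\<beta> / 2)) = (1 - (real k + 1) * \<beta> / 4) + (b n - real n * (\<beta> / 2) *
        \<kappa>b)" for n
      by (simp add: y_def B_def manova_alpha2_def field_simps)
    then show ?thesis using tendsto_add[OF lc lb] by (simp only: add_divide_distrib) simp
  qed
  have dist: "distributed M lborel (p n k) (\<lambda>t. ennreal (beta_density (x n) (y n) t))"
    if "n \<ge> 1" "k \<le> 2 * n - 1" for n
    using p[OF that(1)] that k by (auto simp: manova_variables_def x_def y_def)
  interpret S: scaled_beta_variables M "\<lambda>n. p n k" x y "k div 2 + 1" A B "\<beta> / 2"
  proof (intro scaled_beta_variables.intro scaled_beta_variables_axioms.intro)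
    show "distributed M lborel (p n k) (\<lambda>t. ennreal (beta_density (x n) (y n) t))"
        if "n \<ge> k div 2 + 1" for n
      using that k by (intro dist) auto
  qed (use assms x y in \<open>auto simp: A_def B_def r_def\<close>)
  have q: "S.p0 = q"
    unfolding S.p0_def unfolding q_def km_point_def A_def B_def km_even_def km_odd_def
        by (simp add: add_ac)
  have r: "S.r = r" by (simp add: fun_eq_iff S.r_def r_def)
  show "AE \<omega> in M. (\<lambda>n. p n k \<omega>) \<longlonglongrightarrow> q"
    using S.almost_sure_limit by (simp add: q)
  show "\<exists>\<tau>\<ge>0. \<forall>t. (\<lambda>n. char (distr M borel (\<lambda>\<omega>. r n * (p n k \<omega> - q))) t) \<longlonglongrightarrow> of_real (exp (- \<tau> * t\<^sup>2 /
      2))"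
    using S.char_limit S.\<tau>_pos by (intro exI[of _ S.\<tau>]) (simp add: q r)
  show "\<exists>K. eventually (\<lambda>n. (\<integral>\<omega>. (r n * (p n k \<omega> - q))\<^sup>2 \<partial>M) \<le> K) sequentially"
    using S.second_moment_bounded by (simp add: q r)
  assume "n \<ge> 1" "k \<le> 2 * n - 1"
  then have n: "n \<ge> k div 2 + 1" by auto
  show "p n k \<in> borel_measurable M" by (rule S.X_measurable[OF n])
  show "AE \<omega> in M. 0 < p n k \<omega> \<and> p n k \<omega> < 1" by (rule S.X_AE[OF n])
  show "integrable M (\<lambda>\<omega>. (r n * (p n k \<omega> - q))\<^sup>2)"
    by (rule S.X_integrable[OF n, where \<phi> = "\<lambda>s. (r n * (s - q))\<^sup>2"]) (intro continuous_intros)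
qed

theorem theorem5p3:
  fixes M :: "'w measure"
    and \<beta> \<kappa>a \<kappa>b :: real
    and a b :: "nat \<Rightarrow> real"
    and p :: "nat \<Rightarrow> nat \<Rightarrow> 'w \<Rightarrow> real"
    and \<mu> :: "nat \<Rightarrow> 'w \<Rightarrow> real measure"
  assumes "prob_space M"
    and "\<beta> > 0" and "\<kappa>a \<ge> 0" and "\<kappa>b \<ge> 0"
    and "\<And>n. n \<ge> 1 \<Longrightarrow> a n > -1"
    and "\<And>n. n \<ge> 1 \<Longrightarrow> b n > -1"
    and "(\<lambda>n. a n - real n * \<beta> / 2 * \<kappa>a) \<in> o(\<lambda>n. sqrt (real n * \<beta>))"
    and "(\<lambda>n. b n - real n * \<beta> / 2 * \<kappa>b) \<in> o(\<lambda>n. sqrt (real n * \<beta>))"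
    and "\<And>n. n \<ge> 1 \<Longrightarrow> manova_variables M n \<beta> (a n) (b n) (p n)"
    and "\<And>n \<omega>. n \<ge> 1 \<Longrightarrow> \<omega> \<in> space M \<Longrightarrow>
           \<mu> n \<omega> = spectral_measure (manova_jacobi n (\<lambda>k. p n k \<omega>))"
  shows "(AE \<omega> in M. \<forall>f :: real \<Rightarrow> real. continuous_on UNIV f \<longrightarrow> bounded (range f) \<longrightarrow>
            (\<lambda>n. \<integral>x. f x \<partial>\<mu> n \<omega>) \<longlonglongrightarrow> (\<integral>x. f x \<partial>kesten_mckay \<kappa>a \<kappa>b)) \<and>
         (\<forall>q :: real poly. \<exists>\<sigma>2 \<ge> 0.
            weak_conv_m
              (\<lambda>n. distr M borel (\<lambda>\<omega>. sqrt (real n * \<beta>) / sqrt 2 *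
                     ((\<integral>x. poly q x \<partial>\<mu> n \<omega>) - (\<integral>x. poly q x \<partial>kesten_mckay \<kappa>a \<kappa>b))))
              (centered_normal \<sigma>2))"
proof (intro conjI allI)
  interpret prob_space M by fact
  define p0 where "p0 = km_point \<kappa>a \<kappa>b"
  define KM where "KM = kesten_mckay \<kappa>a \<kappa>b"
  define r where "r n = sqrt (real n * (\<beta> / 2))" for n
  note L = manova_variable_limits[OF assms(1-4,7,8) assms(9), folded p0_def, folded r_def]
  note KM = kesten_mckay_moment[OF assms(3,4), folded p0_def KM_def]
  have S: "prob_space (\<mu> n \<omega>)" "sets (\<mu> n \<omega>) = sets borel" "integrable (\<mu> n \<omega>) (\<lambda>x. x ^ k)"
    "k < n \<Longrightarrow> (\<integral>x. x ^ k \<partial>\<mu> n \<omega>) = manova_moment (\<lambda>k. p n k \<omega>) k"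
    "(\<And>k. k \<in> {1..2 * n - 1} \<Longrightarrow> 0 \<le> p n k \<omega> \<and> p n k \<omega> \<le> 1) \<Longrightarrow> AE x in \<mu> n \<omega>. \<bar>x\<bar> \<le> 4"
    if "n \<ge> 1" "\<omega> \<in> space M" for n \<omega> k
    using manova_spectral_measure[OF that(1), where p = "\<lambda>k. p n k \<omega>"] unfolding assms(10)[OF that]
        by auto
  have box: "AE \<omega> in M. \<forall>n\<ge>1. \<forall>k\<in>{1..2 * n - 1}. 0 \<le> p n k \<omega> \<and> p n k \<omega> \<le> 1"
    unfolding AE_all_countable
  proof (intro allI)
    fix n show "AE \<omega> in M. 1 \<le> n \<longrightarrow> (\<forall>k\<in>{1..2 * n - 1}. 0 \<le> p n k \<omega> \<and> p n k \<omega> \<le> 1)"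
    proof (cases "n \<ge> 1")
      case True
      have "AE \<omega> in M. \<forall>k\<in>{1..2 * n - 1}. 0 \<le> p n k \<omega> \<and> p n k \<omega> \<le> 1"
      proof (rule AE_finite_allI)
        fix k assume "k \<in> {1..2 * n - 1}"
        then have "AE \<omega> in M. 0 < p n k \<omega> \<and> p n k \<omega> < 1" using True by (intro L(5)) auto
        then show "AE \<omega> in M. 0 \<le> p n k \<omega> \<and> p n k \<omega> \<le> 1" by eventually_elim auto
      qed simp
      then show ?thesis by eventually_elim auto
    qed auto
  qed
  show "AE \<omega> in M. \<forall>f :: real \<Rightarrow> real. continuous_on UNIV f \<longrightarrow> bounded (range f) \<longrightarrow>
            (\<lambda>n. \<integral>x. f x \<partial>\<mu> n \<omega>) \<longlonglongrightarrow> (\<integral>x. f x \<partial>kesten_mckay \<kappa>a \<kappa>b)"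
  proof -
    have "AE \<omega> in M. \<forall>k. k \<ge> 1 \<longrightarrow> (\<lambda>n. p n k \<omega>) \<longlonglongrightarrow> p0 k"
      unfolding AE_all_countable
    proof (intro allI)
      fix k show "AE \<omega> in M. k \<ge> 1 \<longrightarrow> (\<lambda>n. p n k \<omega>) \<longlonglongrightarrow> p0 k"
        using L(1)[of k] by (cases "k \<ge> 1") auto
    qed
    with box show ?thesis
      using AE_space
    proof eventually_elim
      case (elim \<omega>)
      show ?case
      proof (intro allI impI)
        fix f :: "real \<Rightarrow> real" assume f: "continuous_on UNIV f"
        \<comment> \<open>The hypotheses determine \<open>\<mu> n\<close> from n = 1 on.\<close>
        have "(\<lambda>n. \<integral>x. f x \<partial>\<mu> (Suc n) \<omega>) \<longlonglongrightarrow> (\<integral>x. f x \<partial>KM)"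
        proof (rule tendsto_integral_of_moments[OF _ _ _ _ _ _ _ f])
          show "prob_space (\<mu> (Suc n) \<omega>)" "sets (\<mu> (Suc n) \<omega>) = sets borel" for n
            using S[of "Suc n" \<omega>] elim(3) by auto
          show "AE x in \<mu> (Suc n) \<omega>. \<bar>x\<bar> \<le> 4" for n
            using S(5)[of "Suc n" \<omega>] elim by auto
          show "prob_space KM" "sets KM = sets borel" by (rule KM)+
          show "AE x in KM. \<bar>x\<bar> \<le> 4" using KM(3) by eventually_elim auto
          fix k
          have "(\<lambda>n. manova_moment (\<lambda>k. p n k \<omega>) k) \<longlonglongrightarrow> manova_moment p0 k"
            using elim(2) by (intro tendsto_manova_moment) auto
          then have "(\<lambda>n. manova_moment (\<lambda>k. p (Suc n) k \<omega>) k) \<longlonglongrightarrow> manova_moment p0 k"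
            by (rule LIMSEQ_Suc)
          then have "(\<lambda>n. manova_moment (\<lambda>k. p (Suc n) k \<omega>) k) \<longlonglongrightarrow> (\<integral>x. x ^ k \<partial>KM)"
            by (simp add: KM(5))
          then show "(\<lambda>n. \<integral>x. x ^ k \<partial>\<mu> (Suc n) \<omega>) \<longlonglongrightarrow> (\<integral>x. x ^ k \<partial>KM)"
            by (rule Lim_transform_eventually)
              (use eventually_gt_at_top[of k] in eventually_elim, use S(4) elim(3) in auto)
        qed
        then show "(\<lambda>n. \<integral>x. f x \<partial>\<mu> n \<omega>) \<longlonglongrightarrow> (\<integral>x. f x \<partial>kesten_mckay \<kappa>a \<kappa>b)"
          unfolding KM_def by (rule LIMSEQ_imp_Suc)
      qed
    qed
  qed
  fix q :: "real poly"
  define d where "d = degree q"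
  define I where "I = {1..2 * d + 1}"
  define F where "F p = (\<Sum>k\<le>d. coeff q k * manova_moment p k)" for p
  define V where "V n \<omega> = r n * (F (\<lambda>k. p n k \<omega>) - F p0)" for n \<omega>
  have poly_int: "(\<integral>x. poly q x \<partial>\<nu>) = (\<Sum>k\<le>d. coeff q k * (\<integral>x. x ^ k \<partial>\<nu>))"
    if "\<And>k. integrable \<nu> (\<lambda>x. x ^ k)" for \<nu> :: "real measure"
    using that by (simp add: poly_altdef d_def)
  have V_eq: "sqrt (real n * \<beta>) / sqrt 2 * ((\<integral>x. poly q x \<partial>\<mu> n \<omega>) - (\<integral>x. poly q x \<partial>kesten_mckay \<kappa>a
      \<kappa>b)) = V n \<omega>"
    if "n > d" "\<omega> \<in> space M" for n \<omega>
  proof -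
    have "(\<integral>x. poly q x \<partial>\<mu> n \<omega>) = F (\<lambda>k. p n k \<omega>)"
      using S[of n \<omega>] that by (subst poly_int) (auto simp: F_def)
    moreover have "(\<integral>x. poly q x \<partial>kesten_mckay \<kappa>a \<kappa>b) = F p0"
      using KM by (subst poly_int) (auto simp: F_def KM_def)
    moreover have "sqrt (real n * \<beta>) / sqrt 2 = r n" by (simp add: r_def real_sqrt_divide)
    ultimately show ?thesis by (simp add: V_def)
  qed
  have p_meas: "p n k \<in> borel_measurable M" if "n > d" "k \<in> I" for n k
    using that by (intro L(4)) (auto simp: I_def)
  have V_meas: "V n \<in> borel_measurable M" if "n > d" for n
  proof -
    have "(\<lambda>\<omega>. manova_moment (\<lambda>k. p n k \<omega>) k) \<in> borel_measurable M" if "k \<le> d" for k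
      unfolding manova_moment_def using that \<open>n > d\<close>
      by (intro measurable_jacobi_row p_meas) (auto simp: I_def)
    then show ?thesis unfolding V_def[abs_def] F_def
      by (intro borel_measurable_times borel_measurable_diff borel_measurable_sum
          borel_measurable_const) auto
  qed
  have p0_box: "0 \<le> p0 k \<and> p0 k \<le> 1" for k by (rule KM(6))
  have "quadratic_approx I p0 F"
    unfolding F_def I_def manova_moment_def
    by (intro quadratic_approx_sum quadratic_approx_mult quadratic_approx_const
        quadratic_approx_jacobi_row p0_box) auto
  then obtain D C where DC: "\<And>p. (\<forall>k\<in>I. 0 \<le> p k \<and> p k \<le> 1) \<Longrightarrow>
     \<bar>F p - F p0 - (\<Sum>k\<in>I. D k * (p k - p0 k))\<bar> \<le> C * (\<Sum>k\<in>I. (p k - p0 k)\<^sup>2)"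
    unfolding quadratic_approx_def by blast
  define Z where "Z n k \<omega> = r n * (p n k \<omega> - p0 k)" for n k \<omega>
  \<comment> \<open>The linear part of V.\<close>
  define W where "W n \<omega> = (\<Sum>k\<in>I. D k * Z n k \<omega>)" for n \<omega>
  have Z_meas [measurable]: "Z n k \<in> borel_measurable M" if "n > d" "k \<in> I" for n k
    using p_meas[OF that] unfolding Z_def[abs_def] by measurable
  have W_meas: "W n \<in> borel_measurable M" if "n > d" for n
    unfolding W_def[abs_def] using Z_meas[OF that]
        by (intro borel_measurable_sum borel_measurable_times) auto
  have "\<forall>k\<in>I. \<exists>\<tau>\<ge>0. \<forall>t. (\<lambda>n. char (distr M borel (Z n k)) t) \<longlonglongrightarrow> of_real (exp (- \<tau> * t\<^sup>2 / 2))"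
    unfolding Z_def[abs_def] by (intro ballI L(2)) (auto simp: I_def)
  then obtain \<tau> where \<tau>: "\<And>k. k \<in> I \<Longrightarrow> \<tau> k \<ge> 0"
    "\<And>k t. k \<in> I \<Longrightarrow> (\<lambda>n. char (distr M borel (Z n k)) t) \<longlonglongrightarrow> of_real (exp (- \<tau> k * t\<^sup>2 / 2))"
    by metis
  define v where "v = (\<Sum>k\<in>I. \<tau> k * (D k)\<^sup>2)"
  have v: "v \<ge> 0" unfolding v_def using \<tau>(1) by (intro sum_nonneg) auto
  have W_char: "(\<lambda>n. char (distr M borel (W n)) t) \<longlonglongrightarrow> of_real (exp (- v * t\<^sup>2 / 2))" for t
  proof -
    have "(\<lambda>n. \<Prod>k\<in>I. char (distr M borel (Z n k)) (t * D k)) \<longlonglongrightarrow> (\<Prod>k\<in>I. of_real (exp (- \<tau> k * (t * D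
        k)\<^sup>2 / 2)))"
      by (intro tendsto_prod \<tau>)
    also have "(\<Prod>k\<in>I. complex_of_real (exp (- \<tau> k * (t * D k)\<^sup>2 / 2))) = of_real (exp (- v * t\<^sup>2 / 2))"
    proof -
      have "(\<Prod>k\<in>I. exp (- \<tau> k * (t * D k)\<^sup>2 / 2)) = exp (\<Sum>k\<in>I. - \<tau> k * (t * D k)\<^sup>2 / 2)"
        by (rule exp_sum[symmetric]) (simp add: I_def)
      also have "(\<Sum>k\<in>I. - \<tau> k * (t * D k)\<^sup>2 / 2) = - v * t\<^sup>2 / 2"
      proof -
        have "(\<Sum>k\<in>I. - \<tau> k * (t * D k)\<^sup>2 / 2) = (\<Sum>k\<in>I. - (t\<^sup>2 / 2) * (\<tau> k * (D k)\<^sup>2))"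
          by (intro sum.cong) (auto simp: power_mult_distrib)
        then show ?thesis unfolding v_def sum_distrib_left[symmetric] by simp
      qed
      finally show ?thesis by (simp flip: of_real_prod)
    qed
    finally show ?thesis
    proof (rule Lim_transform_eventually)
      show "eventually (\<lambda>n. (\<Prod>k\<in>I. char (distr M borel (Z n k)) (t * D k)) = char (distr M borel (W
          n)) t) sequentially"
        using eventually_gt_at_top[of d]
      proof eventually_elim
        case (elim n)
        have "indep_vars (\<lambda>_. borel) (p n) {1..2 * n - 1}"
          using assms(9)[of n] elim by (simp add: manova_variables_def)
        then have "indep_vars (\<lambda>_. borel) (p n) I"
          by (rule indep_vars_subset) (use elim in \<open>auto simp: I_def\<close>)
        then have "indep_vars (\<lambda>_. borel) (\<lambda>k \<omega>. r n * (p n k \<omega> - p0 k)) I"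
          by (rule indep_vars_compose2) auto
        then have "indep_vars (\<lambda>_. borel) (Z n) I" by (simp add: Z_def[abs_def])
        from char_weighted_sum[OF this, of D t] show ?case by (simp add: W_def[abs_def])
      qed
    qed
  qed
  have "\<forall>k\<in>I. \<exists>K. eventually (\<lambda>n. expectation (\<lambda>\<omega>. (Z n k \<omega>)\<^sup>2) \<le> K) sequentially"
    unfolding Z_def by (intro ballI L(3)) (auto simp: I_def)
  then obtain K where K: "\<And>k. k \<in> I \<Longrightarrow> eventually (\<lambda>n. expectation (\<lambda>\<omega>. (Z n k \<omega>)\<^sup>2) \<le> K k) sequentially"
    by metis
  have r_top: "filterlim r at_top sequentially"
    unfolding r_def using assms(2) by (intro sqrt_linear_at_top) simp
  \<comment> \<open>The quadratic error is C times the sum of the squares of the \<open>Z n k\<close>, divided by \<open>r n\<close>;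
    the squares are bounded in mean.\<close>
  have diff: "(\<lambda>n. char (distr M borel (V n)) t - char (distr M borel (W n)) t) \<longlonglongrightarrow> 0" for t
  proof (rule Lim_null_comparison)
    show "(\<lambda>n. \<bar>t\<bar> * (\<bar>C\<bar> * (\<Sum>k\<in>I. K k)) / r n) \<longlonglongrightarrow> 0"
      by (rule real_tendsto_divide_at_top[OF tendsto_const r_top])
    have "eventually (\<lambda>n. \<forall>k\<in>I. expectation (\<lambda>\<omega>. (Z n k \<omega>)\<^sup>2) \<le> K k) sequentially"
      by (intro eventually_ball_finite ballI K) (simp_all add: I_def)
    moreover have "eventually (\<lambda>n. n > d) sequentially" by (rule eventually_gt_at_top)
    ultimately show "eventually (\<lambda>n. norm (char (distr M borel (V n)) t - char (distr M borel (W n)) t)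
        \<le> \<bar>t\<bar> * (\<bar>C\<bar> * (\<Sum>k\<in>I. K k)) / r n) sequentially"
    proof eventually_elim
      case (elim n)
      have rn: "r n > 0" using elim assms(2) by (simp add: r_def)
      have nd: "n > d" using elim(2) .
      define R where "R \<omega> = \<bar>C\<bar> * (\<Sum>k\<in>I. (Z n k \<omega>)\<^sup>2) / r n" for \<omega>
      have Zint: "integrable M (\<lambda>\<omega>. (Z n k \<omega>)\<^sup>2)" if "k \<in> I" for k
        unfolding Z_def using that nd by (intro L(6)) (auto simp: I_def)
      have Rint: "integrable M R" unfolding R_def[abs_def] using Zint by auto
      have "AE \<omega> in M. \<bar>V n \<omega> - W n \<omega>\<bar> \<le> R \<omega>"
        using box
      proof eventually_elim
        case (elim \<omega>)
        have p_box: "\<forall>k\<in>I. 0 \<le> p n k \<omega> \<and> p n k \<omega> \<le> 1" using elim nd by (auto simp: I_def)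
        have "V n \<omega> - W n \<omega> = r n * (F (\<lambda>k. p n k \<omega>) - F p0 - (\<Sum>k\<in>I. D k * (p n k \<omega> - p0 k)))"
          by (simp add: V_def W_def Z_def right_diff_distrib sum_distrib_left mult_ac)
        then have "\<bar>V n \<omega> - W n \<omega>\<bar> = r n * \<bar>F (\<lambda>k. p n k \<omega>) - F p0 - (\<Sum>k\<in>I. D k * (p n k \<omega> - p0 k))\<bar>"
          using rn by (simp add: abs_mult)
        also have "\<dots> \<le> r n * (\<bar>C\<bar> * (\<Sum>k\<in>I. (p n k \<omega> - p0 k)\<^sup>2))"
          using rn DC[OF p_box] by (intro mult_left_mono order_trans[OF DC[OF p_box]]
              mult_right_mono sum_nonneg) auto
        also have "\<dots> = R \<omega>"
          using rn by (simp add: R_def Z_def power_mult_distrib power2_eq_square[of "r n"] flip: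
              sum_distrib_left)
        finally show ?case .
      qed
      then have "norm (char (distr M borel (V n)) t - char (distr M borel (W n)) t) \<le> \<bar>t\<bar> *
          expectation R"
        using V_meas[OF nd] W_meas[OF nd] Rint by (intro char_diff_bound)
      also have "expectation R = \<bar>C\<bar> * (\<Sum>k\<in>I. expectation (\<lambda>\<omega>. (Z n k \<omega>)\<^sup>2)) / r n"
        unfolding R_def using Zint by simp
      also have "\<bar>t\<bar> * \<dots> \<le> \<bar>t\<bar> * (\<bar>C\<bar> * (\<Sum>k\<in>I. K k) / r n)"
        using rn elim by (intro mult_left_mono divide_right_mono sum_mono) auto
      finally show ?case by simp
    qed
  qed
  have V_char: "(\<lambda>n. char (distr M borel (V n)) t) \<longlonglongrightarrow> char (centered_normal v) t" for t
    using tendsto_add[OF diff[of t] W_char[of t]] by (simp add: char_centered_normal[OF v])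
  have distr_eq: "distr M borel (\<lambda>\<omega>. sqrt (real n * \<beta>) / sqrt 2 *
      ((\<integral>x. poly q x \<partial>\<mu> n \<omega>) - (\<integral>x. poly q x \<partial>kesten_mckay \<kappa>a \<kappa>b))) = distr M borel (V n)" if "n >
          d" for n
    using V_eq[OF that] by (intro distr_cong) auto
  \<comment> \<open>The moments up to order d are given by \<open>manova_moment\<close> for n > d only; weak convergence
    does not depend on the first d + 1 terms.\<close>
  have "weak_conv_m (\<lambda>n. distr M borel (V (n + Suc d))) (centered_normal v)"
  proof (rule levy_continuity)
    show "real_distribution (distr M borel (V (n + Suc d)))" for n
      by (rule real_distribution_distr) (rule V_meas, simp)
    show "(\<lambda>n. char (distr M borel (V (n + Suc d))) t) \<longlonglongrightarrow> char (centered_normal v) t" for t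
      by (rule LIMSEQ_ignore_initial_segment[OF V_char])
  qed (rule real_distribution_centered_normal[OF v])
  moreover have "distr M borel (V (n + Suc d)) = distr M borel (\<lambda>\<omega>. sqrt (real (n + Suc d) * \<beta>) /
      sqrt 2 *
      ((\<integral>x. poly q x \<partial>\<mu> (n + Suc d) \<omega>) - (\<integral>x. poly q x \<partial>kesten_mckay \<kappa>a \<kappa>b)))" for n
    by (rule distr_eq[symmetric]) simp
  ultimately have "weak_conv_m (\<lambda>n. distr M borel (\<lambda>\<omega>. sqrt (real n * \<beta>) / sqrt 2 *
      ((\<integral>x. poly q x \<partial>\<mu> n \<omega>) - (\<integral>x. poly q x \<partial>kesten_mckay \<kappa>a \<kappa>b)))) (centered_normal v)"
    unfolding weak_conv_m_def weak_conv_def by (simp only:) (blast intro: LIMSEQ_offset[of _ "Suc d"])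
  then show "\<exists>\<sigma>2\<ge>0. weak_conv_m (\<lambda>n. distr M borel (\<lambda>\<omega>. sqrt (real n * \<beta>) / sqrt 2 *
      ((\<integral>x. poly q x \<partial>\<mu> n \<omega>) - (\<integral>x. poly q x \<partial>kesten_mckay \<kappa>a \<kappa>b)))) (centered_normal \<sigma>2)"
    using v by blast
qed

end
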